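(* For every compact subset $\mathcal C$ of $K$ and every $C_2>0$ there exist positive numbers $r_1$, $r_2>r_1$, $\tau$, $C_3$ and $h_1$ such that for all $t_0\in[0,T)$, all $\overline u\in\mathcal C$, all $h\in(0,h_1]$ and all $U^0,U^1$ satisfying condition $E(\overline u,r_1,C_2,h)$, the scheme relations $$U^{m+1}=-eU^{m-1}+(1+e)P_K\Big(\tfrac{2U^m-(1-e)U^{m-1}+h^2F^m}{1+e}\Big),\quad F^m=F\Big(t_m,U^m,U^{m-1},\tfrac{U^{m+1}-U^{m-1}}{2h},h\Big)$$ define uniquely the vectors $U^m$ for $2\le m\le n:=\lfloor\min(\tau,T-t_0)/h\rfloor$ under the condition $$|V^l|\le C_3\quad\text{for all } l\le n-1 .$$
   Context: Data. $d\ge1$, $T>0$, $e\in[0,1]$. $K\subset\mathbb R^d$ is closed with non-empty interior, $\partial K$ is an embedded submanifold (hypersurface) of class $C^3$, and $K$ lies on only one side of $\partial K$. $M$ is a $C^3$ map from $\mathbb R^d$ to symmetric positive definite $d\times d$ matrices. $f:[0,T]\times\mathbb R^d\times\mathbb R^d\to\mathbb R^d$ is continuous and locally Lipschitz continuous in its last two arguments. $F:[0,T]\times\mathbb R^d\times\mathbb R^d\times\mathbb R^d\times[0,h^*]\to\mathbb R^d$ ($0<h^*\le1$) is continuous, locally Lipschitz continuous in its second, third and fourth arguments, and consistent: $F(t,u,u,v,0)=M(u)^{-1}f(t,u,M(u)v)$. $|\cdot|$ is the Euclidean norm, $B(\overline u,r)$ the closed Euclidean ball. $t_m=t_0+mh$,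 $V^m=(U^{m+1}-U^m)/h$. Projection. $\mathrm{dist}$ is the Riemannian distance on $\mathbb R^d$ for the metric $M(u)$. Every compact subset of $K$ has a relatively compact neighborhood on which each $x\notin K$ has a unique $\mathrm{dist}$-nearest point $P_{\partial K}(x)\in\partial K$; there $P_K(x)=P_{\partial K}(x)$ if $x\notin K$ and $P_K(x)=x$ if $x\in K$. Condition $E(\overline u,r,C_2,h)$ (for given $t_0$ with $t_1\le T$): $U^0,U^1\in\mathbb R^d$ satisfy $|U^0-\overline u|\le r$, $|U^1-\overline u|\le r$, $|U^1-U^0|\le C_2h$; moreover $U^2$ is uniquely defined in $B(\overline u,r)$ by $$\frac{U^2+eU^0}{1+e}=P_K\Big(\frac{2U^1-(1-e)U^0+h^2F^1}{1+e}\Big),\quad F^1=F\Big(t_1,U^1,U^0,\tfrac{U^2-U^0}{2h},h\Big),$$ and $|U^2-\overline u|\le r$, $|U^2-U^1|\le C_2h$. *)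

theory Defs
  imports "HOL-Analysis.Analysis"
begin

text \<open>Meant for open \<open>S\<close>; since the spaces are finite-dimensional, continuity of all iterated
  directional derivatives is the usual class \<open>C\<^sup>k\<close>.\<close>

primrec Ck_on ::
  "nat \<Rightarrow> ('a::euclidean_space \<Rightarrow> 'b::euclidean_space) \<Rightarrow> 'a set \<Rightarrow> bool" where
  "Ck_on 0 g S \<longleftrightarrow> continuous_on S g"
| "Ck_on (Suc k) g S \<longleftrightarrow> (\<forall>x\<in>S. g differentiable (at x)) \<and>
     (\<forall>v. Ck_on k (\<lambda>x. frechet_derivative g (at x) v) S)"

definition sym_pos_def :: "real^'n^'n \<Rightarrow> bool" where
  "sym_pos_def A \<longleftrightarrow> transpose A = A \<and> (\<forall>v. v \<noteq> 0 \<longrightarrow> v \<bullet> (A *v v) > 0)"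

definition local_C3_equation ::
  "(real^'n) set \<Rightarrow> (real^'n) set \<Rightarrow> (real^'n \<Rightarrow> real) \<Rightarrow> bool" where
  "local_C3_equation S W \<phi> \<longleftrightarrow> open W \<and> Ck_on 3 \<phi> W \<and>
     (\<forall>x\<in>W. frechet_derivative \<phi> (at x) \<noteq> (\<lambda>v. 0)) \<and> S \<inter> W = {x\<in>W. \<phi> x = 0}"

definition C3_hypersurface :: "(real^'n) set \<Rightarrow> bool" where
  "C3_hypersurface S \<longleftrightarrow> (\<forall>p\<in>S. \<exists>W \<phi>. p \<in> W \<and> local_C3_equation S W \<phi>)"

text \<open>Being on one side is a local notion. The equality (rather than an inclusion) also excludes
  the degenerate case in which \<open>K\<close> coincides with its boundary near a boundary point.\<close>

definition on_one_side_of_frontier :: "(real^'n) set \<Rightarrow> bool" where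
  "on_one_side_of_frontier K \<longleftrightarrow> (\<forall>p\<in>frontier K. \<exists>W \<phi>. p \<in> W \<and>
     local_C3_equation (frontier K) W \<phi> \<and> K \<inter> W = {x\<in>W. \<phi> x \<le> 0})"

definition riem_length :: "(real^'n \<Rightarrow> real^'n^'n) \<Rightarrow> (real \<Rightarrow> real^'n) \<Rightarrow> real" where
  "riem_length M \<gamma> = integral {0..1} (\<lambda>s.
     sqrt (vector_derivative \<gamma> (at s) \<bullet> (M (\<gamma> s) *v vector_derivative \<gamma> (at s))))"

text \<open>The infimum over \<open>C\<^sup>1\<close> curves is the same as the one over piecewise \<open>C\<^sup>1\<close> curves
  (reparametrise so that the velocity vanishes at the corners). The library predicate
  \<open>piecewise_C1_differentiable_on\<close> alone would not do: it admits curves of infinite length, for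
  which the integral takes the default value 0.\<close>

definition riem_dist :: "(real^'n \<Rightarrow> real^'n^'n) \<Rightarrow> real^'n \<Rightarrow> real^'n \<Rightarrow> real" where
  "riem_dist M x y =
     Inf {riem_length M \<gamma> | \<gamma>. \<gamma> C1_differentiable_on {0..1} \<and> \<gamma> 0 = x \<and> \<gamma> 1 = y}"

definition nearest_frontier_point ::
  "(real^'n \<Rightarrow> real^'n^'n) \<Rightarrow> (real^'n) set \<Rightarrow> real^'n \<Rightarrow> real^'n \<Rightarrow> bool" where
  "nearest_frontier_point M K x p \<longleftrightarrow>
     p \<in> frontier K \<and> (\<forall>q\<in>frontier K. riem_dist M x p \<le> riem_dist M x q)"

text \<open>\<open>P\<^sub>K\<close> is a partial map. Its domain is taken to be the set of all points at which it makes
  sense; this contains a neighbourhood of every compact subset of \<open>K\<close>. Every equation involving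
  \<open>P\<^sub>K\<close> below is accompanied by the requirement that its argument lies in that domain.\<close>

definition proj_dom :: "(real^'n \<Rightarrow> real^'n^'n) \<Rightarrow> (real^'n) set \<Rightarrow> (real^'n) set" where
  "proj_dom M K = K \<union> {x. \<exists>!p. nearest_frontier_point M K x p}"

definition proj :: "(real^'n \<Rightarrow> real^'n^'n) \<Rightarrow> (real^'n) set \<Rightarrow> real^'n \<Rightarrow> real^'n" where
  "proj M K x = (if x \<in> K then x else (THE p. nearest_frontier_point M K x p))"

text \<open>The argument of \<open>P\<^sub>K\<close> in the scheme at time \<open>t\<close>, for three consecutive positions
  \<open>u0\<close>, \<open>u1\<close>, \<open>u2\<close>; the scheme is implicit, as \<open>u2\<close> enters through \<open>F\<close>.\<close>

definition scheme_arg ::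
  "real \<Rightarrow> (real \<Rightarrow> real^'n \<Rightarrow> real^'n \<Rightarrow> real^'n \<Rightarrow> real \<Rightarrow> real^'n) \<Rightarrow> real \<Rightarrow> real
     \<Rightarrow> real^'n \<Rightarrow> real^'n \<Rightarrow> real^'n \<Rightarrow> real^'n" where
  "scheme_arg e F h t u0 u1 u2 =
     (2 *\<^sub>R u1 - (1 - e) *\<^sub>R u0 + h\<^sup>2 *\<^sub>R F t u1 u0 ((u2 - u0) /\<^sub>R (2 * h)) h) /\<^sub>R (1 + e)"

definition first_step ::
  "(real^'n \<Rightarrow> real^'n^'n) \<Rightarrow> (real^'n) set \<Rightarrow> real
     \<Rightarrow> (real \<Rightarrow> real^'n \<Rightarrow> real^'n \<Rightarrow> real^'n \<Rightarrow> real \<Rightarrow> real^'n) \<Rightarrow> real \<Rightarrow> real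
     \<Rightarrow> real^'n \<Rightarrow> real^'n \<Rightarrow> real^'n \<Rightarrow> bool" where
  "first_step M K e F h t u0 u1 u2 \<longleftrightarrow>
     scheme_arg e F h t u0 u1 u2 \<in> proj_dom M K \<and>
     (u2 + e *\<^sub>R u0) /\<^sub>R (1 + e) = proj M K (scheme_arg e F h t u0 u1 u2)"

text \<open>Uniqueness of \<open>U2\<close> is among all points of the ball; the bound on \<open>U2 - U1\<close> is then a
  property of that point and does not take part in the uniqueness.\<close>

definition cond_E ::
  "(real^'n \<Rightarrow> real^'n^'n) \<Rightarrow> (real^'n) set \<Rightarrow> real
     \<Rightarrow> (real \<Rightarrow> real^'n \<Rightarrow> real^'n \<Rightarrow> real^'n \<Rightarrow> real \<Rightarrow> real^'n) \<Rightarrow> real \<Rightarrow> real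
     \<Rightarrow> real^'n \<Rightarrow> real \<Rightarrow> real \<Rightarrow> real \<Rightarrow> real^'n \<Rightarrow> real^'n \<Rightarrow> bool" where
  "cond_E M K e F T t0 ubar r C2 h U0 U1 \<longleftrightarrow>
     t0 + h \<le> T \<and>
     norm (U0 - ubar) \<le> r \<and> norm (U1 - ubar) \<le> r \<and> norm (U1 - U0) \<le> C2 * h \<and>
     (\<exists>U2. U2 \<in> cball ubar r \<and> first_step M K e F h (t0 + h) U0 U1 U2 \<and>
        (\<forall>W\<in>cball ubar r. first_step M K e F h (t0 + h) U0 U1 W \<longrightarrow> W = U2) \<and>
        norm (U2 - ubar) \<le> r \<and> norm (U2 - U1) \<le> C2 * h)"

text \<open>Only the values \<open>U 0, \<dots>, U n\<close> matter (together with \<open>U 1 = U1\<close> when \<open>n = 0\<close>).\<close>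

definition scheme_solution ::
  "(real^'n \<Rightarrow> real^'n^'n) \<Rightarrow> (real^'n) set \<Rightarrow> real
     \<Rightarrow> (real \<Rightarrow> real^'n \<Rightarrow> real^'n \<Rightarrow> real^'n \<Rightarrow> real \<Rightarrow> real^'n) \<Rightarrow> real \<Rightarrow> real
     \<Rightarrow> real \<Rightarrow> nat \<Rightarrow> real^'n \<Rightarrow> real^'n \<Rightarrow> (nat \<Rightarrow> real^'n) \<Rightarrow> bool" where
  "scheme_solution M K e F t0 h C3 n U0 U1 U \<longleftrightarrow>
     U 0 = U0 \<and> U 1 = U1 \<and>
     (\<forall>m. 1 \<le> m \<and> m < n \<longrightarrow>
        (let a = scheme_arg e F h (t0 + real m * h) (U (m - 1)) (U m) (U (m + 1))
         in a \<in> proj_dom M K \<and>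
            U (m + 1) = - (e *\<^sub>R U (m - 1)) + (1 + e) *\<^sub>R proj M K a)) \<and>
     (\<forall>l<n. norm ((U (l + 1) - U l) /\<^sub>R h) \<le> C3)"

end

theory Submission
  imports Defs
begin

text \<open>
  Why the scheme keeps a bounded velocity. Near a point of the boundary write \<open>K = {\<phi> \<le> 0}\<close> and let
  \<open>n\<close> be the gradient of \<open>\<phi>\<close>. The projection moves a point \<open>x\<close> with \<open>\<phi> x > 0\<close> to \<open>\<phi> = 0\<close> by the
  displacement \<open>- (\<phi> x) b\<close> with \<open>b = M\<^sup>-\<^sup>1 n / (n \<bullet> M\<^sup>-\<^sup>1 n)\<close>, up to an error \<open>O((\<phi> x)\<^sup>2)\<close>. Hence
  the discrete velocity splits into a normal part \<open>w m = (\<phi> (U (m + 1)) - \<phi> (U m)) / h\<close> and a tangential part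
  \<open>V m - w m * b (U m)\<close>. The tangential part does not feel the impacts: it changes by \<open>O(h)\<close> per
  step. For the normal part, a step with contact gives \<open>\<phi> (U (m + 1)) = - e * \<phi> (U (m - 1))\<close> up to
  \<open>O(h\<^sup>2)\<close>, whereas \<open>\<phi> (U m) \<le> - e * \<phi> (U (m - 2))\<close> always holds up to \<open>O(h\<^sup>2)\<close>; so
  \<open>- e * w (m - 2) \<le> w m \<le> w (m - 1)\<close> up to \<open>O(h)\<close>. A step without contact changes \<open>w\<close> by \<open>O(h)\<close>.
  Hence \<open>max \<bar>w m\<bar> \<bar>w (m - 1)\<bar>\<close> grows by at most \<open>O(h)\<close> per step. Over a time \<open>\<tau>\<close> the velocity changes by \<open>O(\<tau>)\<close> beyond a multiple of \<open>C2\<close>; this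
  is \<open>velocity_bound\<close>. The \<open>O\<close>-constants depend on the bound \<open>C3\<close> that is being proved, and a small
  \<open>\<tau>\<close> compensates for that. Each step is solved by Banach's fixed point theorem: the unknown enters
  the argument of the projection with a factor \<open>O(h)\<close> and the projection is Lipschitz continuous
  (\<open>step_exists\<close>, \<open>step_contraction\<close>). Together this is \<open>local_scheme\<close>; a finite cover of the compact
  set makes the constants uniform. The recursion for \<open>w\<close> starts from two velocities, and condition
  \<open>E\<close> bounds exactly these two.

  The properties of the projection used above are collected in the locale \<open>regular_projection\<close>. They
  are obtained without geodesics. The squared Riemannian distance is the infimum of the energies of
  curves, and on short curves the energy is close to the flat one, which is convex: averaging two near-minimisers, or
  perturbing one near-minimiser by plus and minus a linear field, bounds the second differences of
  the squared distance from below and from above. In a ball of radius \<open>r\<close> about \<open>z\<close> it therefore has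
  the same second differences as the flat squared distance frozen at \<open>z\<close>, up to a relative error
  \<open>O(r)\<close> (\<open>D2_second_difference_upper\<close>, \<open>D2_second_difference_lower\<close>). Convexity in the end point
  gives uniqueness of the nearest point and quadratic growth around it, the mixed second difference
  gives Lipschitz continuity of the nearest point, and a first variation
  (\<open>first_variation_upper\<close>) gives the direction of the projection up to second order.
\<close>

section \<open>Functions with Lipschitz derivatives\<close>

lemma Ck_on_SucD: "Ck_on (Suc k) g S \<Longrightarrow> Ck_on k g S"
proof (induction k arbitrary: g)
  case 0
  then show ?case
    by (auto intro!: continuous_at_imp_continuous_on differentiable_imp_continuous_within)
qed simp

lemma Ck_on_antimono: "Ck_on k g S \<Longrightarrow> j \<le> k \<Longrightarrow> Ck_on j g S"
  by (induction k) (auto dest: Ck_on_SucD simp del: Ck_on.simps simp: le_Suc_eq)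

lemma C1_on_has_derivative:
  assumes "Ck_on (Suc k) g S" "x \<in> S"
  shows "(g has_derivative frechet_derivative g (at x)) (at x)"
  using assms by (simp add: frechet_derivative_works)

text \<open>The coordinatewise requirement in \<^const>\<open>Ck_on\<close> gives bounds for one direction at a time;
  expanding a vector in the basis turns them into bounds in operator norm.\<close>

lemma C1_on_Lipschitz_cball:
  fixes g :: "'a::euclidean_space \<Rightarrow> 'b::euclidean_space"
  assumes g: "Ck_on 1 g S" and sub: "cball z R \<subseteq> S"
  obtains A where "0 \<le> A" "\<And>x y. x \<in> cball z R \<Longrightarrow> y \<in> cball z R \<Longrightarrow> norm (g x - g y) \<le> A * norm (x - y)"
proof -
  let ?D = "\<lambda>x. frechet_derivative g (at x)"
  have "\<exists>B. \<forall>x\<in>cball z R. norm (?D x i) \<le> B" for i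
  proof -
    have "continuous_on (cball z R) (\<lambda>x. ?D x i)"
      using g by (intro continuous_on_subset[OF _ sub]) simp
    then have "bounded ((\<lambda>x. ?D x i) ` cball z R)"
      by (intro compact_imp_bounded compact_continuous_image) auto
    then show ?thesis
      by (auto simp: bounded_iff)
  qed
  then obtain B where B: "\<And>i x. x \<in> cball z R \<Longrightarrow> norm (?D x i) \<le> B i"
    by metis
  let ?A = "\<bar>\<Sum>i\<in>(Basis::'a set). B i\<bar>"
  have der: "(g has_derivative ?D x) (at x)" if "x \<in> cball z R" for x
    using C1_on_has_derivative[of 0 g S x] g sub that by auto
  have on: "onorm (?D x) \<le> ?A" if x: "x \<in> cball z R" for x
  proof (rule onorm_bound)
    fix v :: 'a
    have "?D x v = ?D x (\<Sum>i\<in>Basis. (v \<bullet> i) *\<^sub>R i)"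
      by (simp add: euclidean_representation)
    also have "\<dots> = (\<Sum>i\<in>Basis. (v \<bullet> i) *\<^sub>R ?D x i)"
      using has_derivative_linear[OF der[OF x]] by (simp add: linear_sum linear_scale)
    also have "norm \<dots> \<le> (\<Sum>i\<in>Basis. norm v * B i)"
      by (intro sum_norm_le) (auto intro!: mult_mono B x simp: Basis_le_norm)
    also have "\<dots> \<le> ?A * norm v"
      using mult_right_mono[OF abs_ge_self norm_ge_zero, of "\<Sum>i\<in>(Basis::'a set). B i" v]
      by (simp add: sum_distrib_left[symmetric] sum_distrib_right[symmetric] mult.commute)
    finally show "norm (?D x v) \<le> ?A * norm v" .
  qed simp
  have "norm (g x - g y) \<le> ?A * norm (x - y)" if "x \<in> cball z R" "y \<in> cball z R" for x y
    using differentiable_bound[of "cball z R" g ?D ?A, OF _ _ on] that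
      has_derivative_at_withinI[OF der] by auto
  then show ?thesis
    using that[of ?A] by auto
qed

lemma C2_on_Taylor_cball:
  fixes g :: "'a::euclidean_space \<Rightarrow> 'b::euclidean_space"
  assumes g: "Ck_on 2 g S" and sub: "cball z R \<subseteq> S" and R: "0 \<le> R"
  obtains A where "0 \<le> A"
    "\<And>x v. x \<in> cball z R \<Longrightarrow> norm (frechet_derivative g (at x) v) \<le> A * norm v"
    "\<And>x y v. x \<in> cball z R \<Longrightarrow> y \<in> cball z R \<Longrightarrow>
       norm (frechet_derivative g (at x) v - frechet_derivative g (at y) v) \<le> A * norm (x - y) * norm v"
    "\<And>x y. x \<in> cball z R \<Longrightarrow> y \<in> cball z R \<Longrightarrow>
       norm (g y - g x - frechet_derivative g (at x) (y - x)) \<le> A * (norm (y - x))\<^sup>2"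
proof -
  let ?D = "\<lambda>x. frechet_derivative g (at x)"
  have g2: "Ck_on (Suc 1) g S"
    using g by (simp add: numeral_2_eq_2)
  have "\<exists>A\<ge>0. \<forall>x\<in>cball z R. \<forall>y\<in>cball z R. norm (?D x i - ?D y i) \<le> A * norm (x - y)" for i
  proof -
    have "Ck_on 1 (\<lambda>x. ?D x i) S"
      using g2 Ck_on.simps(2) by blast
    from C1_on_Lipschitz_cball[OF this sub] show ?thesis
      by metis
  qed
  then obtain B where B0: "\<And>i. B i \<ge> 0" and
    B: "\<And>i x y. x \<in> cball z R \<Longrightarrow> y \<in> cball z R \<Longrightarrow> norm (?D x i - ?D y i) \<le> B i * norm (x - y)"
    by metis
  define A where "A = (\<Sum>i\<in>(Basis::'a set). B i)"
  have A0: "A \<ge> 0"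
    unfolding A_def by (simp add: sum_nonneg B0)
  have der: "(g has_derivative ?D x) (at x)" if "x \<in> cball z R" for x
    using C1_on_has_derivative[OF g2, of x] sub that by auto
  have lin: "linear (?D x)" if "x \<in> cball z R" for x
    using has_derivative_linear[OF der[OF that]] .
  have Lip: "norm (?D x v - ?D y v) \<le> A * norm (x - y) * norm v"
    if x: "x \<in> cball z R" and y: "y \<in> cball z R" for x y v
  proof -
    have "?D x v - ?D y v = ?D x (\<Sum>i\<in>Basis. (v \<bullet> i) *\<^sub>R i) - ?D y (\<Sum>i\<in>Basis. (v \<bullet> i) *\<^sub>R i)"
      by (simp add: euclidean_representation)
    also have "\<dots> = (\<Sum>i\<in>Basis. (v \<bullet> i) *\<^sub>R (?D x i - ?D y i))"
      using lin[OF x] lin[OF y]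
      by (simp add: linear_sum linear_scale scaleR_diff_right sum_subtractf)
    also have "norm \<dots> \<le> (\<Sum>i\<in>Basis. norm v * (B i * norm (x - y)))"
      by (intro sum_norm_le) (auto intro!: mult_mono B x y simp: Basis_le_norm)
    also have "\<dots> = A * norm (x - y) * norm v"
      unfolding A_def by (simp add: sum_distrib_left sum_distrib_right mult_ac)
    finally show ?thesis .
  qed
  have z: "z \<in> cball z R"
    using R by simp
  have bdd: "norm (?D x v) \<le> (onorm (?D z) + A * R) * norm v" if x: "x \<in> cball z R" for x v
  proof -
    have "norm (?D x v) \<le> norm (?D z v) + norm (?D x v - ?D z v)"
      by norm
    also have "\<dots> \<le> onorm (?D z) * norm v + A * R * norm v"
    proof (intro add_mono)
      show "norm (?D z v) \<le> onorm (?D z) * norm v"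
        by (rule onorm[OF has_derivative_bounded_linear[OF der[OF z]]])
      have "A * norm (x - z) * norm v \<le> A * R * norm v"
        using x A0 by (intro mult_right_mono mult_left_mono) (auto simp: dist_norm norm_minus_commute)
      with Lip[OF x z, of v] show "norm (?D x v - ?D z v) \<le> A * R * norm v"
        by linarith
    qed
    finally show ?thesis
      by (simp add: algebra_simps)
  qed
  have Tay: "norm (g y - g x - ?D x (y - x)) \<le> A * (norm (y - x))\<^sup>2"
    if x: "x \<in> cball z R" and y: "y \<in> cball z R" for x y
  proof -
    have seg: "closed_segment x y \<subseteq> cball z R"
      using x y by (intro closed_segment_subset) auto
    have "norm (g y - g x - ?D x (y - x)) \<le> norm (y - x) * (A * norm (y - x))"
    proof (rule differentiable_bound_linearization[where S = "closed_segment x y"])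
      show "x + t *\<^sub>R (y - x) \<in> closed_segment x y" if "t \<in> {0..1}" for t
        using that by (auto simp: in_segment algebra_simps intro!: exI[of _ t])
      show "(g has_derivative ?D u) (at u within closed_segment x y)" if "u \<in> closed_segment x y" for u
        using has_derivative_at_withinI[OF der] seg that by blast
      show "onorm (?D u - ?D x) \<le> A * norm (y - x)" if u: "u \<in> closed_segment x y" for u
      proof (rule onorm_bound)
        have "norm (u - x) \<le> norm (y - x)"
          using segment_bound(1)[OF u] by simp
        then have "A * norm (u - x) * norm v \<le> A * norm (y - x) * norm v" for v :: 'a
          using A0 by (intro mult_right_mono mult_left_mono) auto
        moreover have "norm (?D u v - ?D x v) \<le> A * norm (u - x) * norm v" for v
          using Lip[of u x v] seg u x by auto
        ultimately show "norm ((?D u - ?D x) v) \<le> A * norm (y - x) * norm v" for v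
          by (simp add: fun_diff_def) (meson order_trans)
      qed (use A0 in simp)
    qed simp
    then show ?thesis
      by (simp add: power2_eq_square mult_ac)
  qed
  define A' where "A' = max A (onorm (?D z) + A * R)"
  have "A \<le> A'" "onorm (?D z) + A * R \<le> A'"
    by (auto simp: A'_def)
  show ?thesis
  proof (rule that[of A'])
    show "0 \<le> A'"
      using A0 \<open>A \<le> A'\<close> by simp
    show "norm (?D x v) \<le> A' * norm v" if "x \<in> cball z R" for x v
      using bdd[OF that, of v] mult_right_mono[OF \<open>onorm (?D z) + A * R \<le> A'\<close>, of "norm v"] by simp
    show "norm (?D x v - ?D y v) \<le> A' * norm (x - y) * norm v"
      if "x \<in> cball z R" "y \<in> cball z R" for x y v
      using Lip[OF that, of v] mult_right_mono[OF \<open>A \<le> A'\<close>, of "norm (x - y) * norm v"]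
      by (simp add: mult.assoc)
    show "norm (g y - g x - ?D x (y - x)) \<le> A' * (norm (y - x))\<^sup>2"
      if "x \<in> cball z R" "y \<in> cball z R" for x y
      using Tay[OF that] mult_right_mono[OF \<open>A \<le> A'\<close>, of "(norm (y - x))\<^sup>2"] by simp
  qed
qed

section \<open>Quadratic forms\<close>

lemma norm_matrix_vector_le:
  fixes A :: "real^'n^'m"
  shows "norm (A *v x) \<le> norm A * norm x"
proof -
  have "norm (A *v x) = L2_set (\<lambda>i. \<bar>row i A \<bullet> x\<bar>) UNIV"
    by (simp add: norm_vec_def matrix_mult_dot row_def inner_vec_def matrix_vector_mult_def)
  also have "\<dots> \<le> L2_set (\<lambda>i. norm (A $ i) * norm x) UNIV"
    by (intro L2_set_mono) (auto simp: row_def vec_eq_iff[symmetric] vec_nth_inverse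
      intro!: Cauchy_Schwarz_ineq2)
  also have "\<dots> = norm A * norm x"
    by (simp add: L2_set_left_distrib norm_vec_def)
  finally show ?thesis .
qed

lemma sym_pos_def_inner_commute:
  assumes "sym_pos_def A"
  shows "v \<bullet> (A *v w) = w \<bullet> (A *v v)"
  using assms unfolding sym_pos_def_def by (metis dot_lmul_matrix inner_commute transpose_matrix_vector)

lemma sym_pos_def_nonneg: "sym_pos_def A \<Longrightarrow> 0 \<le> v \<bullet> (A *v v)"
  unfolding sym_pos_def_def by (cases "v = 0") (auto simp: less_imp_le)

lemma inner_matrix_le: "\<bar>v \<bullet> (A *v w)\<bar> \<le> norm A * norm v * norm w" for A :: "real^'n^'n"
proof -
  have "\<bar>v \<bullet> (A *v w)\<bar> \<le> norm v * norm (A *v w)"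
    by (rule Cauchy_Schwarz_ineq2)
  also have "\<dots> \<le> norm v * (norm A * norm w)"
    by (intro mult_left_mono norm_matrix_vector_le) auto
  finally show ?thesis
    by (simp add: mult_ac)
qed

lemma quadratic_form_add:
  assumes "sym_pos_def B"
  shows "(v + w) \<bullet> (B *v (v + w)) = v \<bullet> (B *v v) + 2 * (w \<bullet> (B *v v)) + w \<bullet> (B *v w)"
  using sym_pos_def_inner_commute[OF assms, of v w]
  by (simp add: matrix_vector_right_distrib inner_simps)

lemma quadratic_form_diff:
  assumes "sym_pos_def B"
  shows "(v - w) \<bullet> (B *v (v - w)) = v \<bullet> (B *v v) - 2 * (w \<bullet> (B *v v)) + w \<bullet> (B *v w)"
  using sym_pos_def_inner_commute[OF assms, of v w]
  by (simp add: matrix_vector_mult_diff_distrib inner_simps)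

lemma inner_matrix_diff_le:
  fixes B C :: "real^'n^'n"
  shows "\<bar>v \<bullet> (B *v w) - v \<bullet> (C *v w)\<bar> \<le> norm (B - C) * norm v * norm w"
  using inner_matrix_le[of v "B - C" w]
  by (simp add: matrix_vector_mult_diff_rdistrib inner_simps)

section \<open>Riemannian distance and energy\<close>

text \<open>The velocity is carried along explicitly, so that sums of curves have the sum of the velocities
  by construction.\<close>

definition C1_curve :: "(real \<Rightarrow> real^'n) \<Rightarrow> (real \<Rightarrow> real^'n) \<Rightarrow> bool" where
  "C1_curve \<gamma> \<gamma>' \<longleftrightarrow>
     (\<forall>s\<in>{0..1}. (\<gamma> has_vector_derivative \<gamma>' s) (at s)) \<and> continuous_on {0..1} \<gamma>'"

definition energy :: "(real^'n \<Rightarrow> real^'n^'n) \<Rightarrow> (real \<Rightarrow> real^'n) \<Rightarrow> (real \<Rightarrow> real^'n) \<Rightarrow> real" where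
  "energy M \<gamma> \<gamma>' = integral {0..1} (\<lambda>s. \<gamma>' s \<bullet> (M (\<gamma> s) *v \<gamma>' s))"

lemma C1_differentiable_on_iff_curve:
  "\<gamma> C1_differentiable_on {0..1} \<longleftrightarrow> (\<exists>\<gamma>'. C1_curve \<gamma> \<gamma>')"
  by (auto simp: C1_differentiable_on_def C1_curve_def)

lemma C1_curve_continuous_on: "C1_curve \<gamma> \<gamma>' \<Longrightarrow> continuous_on {0..1} \<gamma>"
  unfolding C1_curve_def
  by (meson continuous_at_imp_continuous_on has_vector_derivative_continuous)

lemma C1_curve_deriv_continuous_on: "C1_curve \<gamma> \<gamma>' \<Longrightarrow> continuous_on {0..1} \<gamma>'"
  by (simp add: C1_curve_def)

lemma C1_curve_line: "C1_curve (\<lambda>s. a + s *\<^sub>R v) (\<lambda>s. v)"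
  unfolding C1_curve_def by (auto intro!: derivative_eq_intros continuous_intros)

lemma C1_curve_add:
  "C1_curve \<gamma> \<gamma>' \<Longrightarrow> C1_curve \<delta> \<delta>' \<Longrightarrow> C1_curve (\<lambda>s. \<gamma> s + \<delta> s) (\<lambda>s. \<gamma>' s + \<delta>' s)"
  unfolding C1_curve_def by (auto intro!: derivative_eq_intros continuous_intros)

lemma C1_curve_scale:
  "C1_curve \<gamma> \<gamma>' \<Longrightarrow> C1_curve (\<lambda>s. c *\<^sub>R \<gamma> s) (\<lambda>s. c *\<^sub>R \<gamma>' s)"
  unfolding C1_curve_def by (auto intro!: derivative_eq_intros continuous_intros)

lemma C1_curve_has_integral:
  assumes "C1_curve \<gamma> \<gamma>'" "0 \<le> a" "a \<le> b" "b \<le> 1"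
  shows "(\<gamma>' has_integral (\<gamma> b - \<gamma> a)) {a..b}"
  using assms unfolding C1_curve_def
  by (intro fundamental_theorem_of_calculus) (auto intro: has_vector_derivative_at_within)

lemma continuous_on_matrix_vector_mult:
  fixes A :: "'a::topological_space \<Rightarrow> real^'n^'m"
  assumes "continuous_on S A" "continuous_on S v"
  shows "continuous_on S (\<lambda>x. A x *v v x)"
  unfolding matrix_vector_mult_def
  using assms by (auto intro!: continuous_intros)

lemma continuous_on_energy_density:
  assumes "continuous_on UNIV M" "C1_curve \<gamma> \<gamma>'"
  shows "continuous_on {0..1} (\<lambda>s. \<gamma>' s \<bullet> (M (\<gamma> s) *v \<gamma>' s))"
  using assms C1_curve_continuous_on C1_curve_deriv_continuous_on
  by (intro continuous_on_inner continuous_on_matrix_vector_mult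
      continuous_on_compose2[OF assms(1)]) auto

text \<open>The variance of \<open>k\<close> on the interval is nonnegative.\<close>

lemma square_integral_le:
  fixes k :: "real \<Rightarrow> real"
  assumes k: "continuous_on {a..b} k" and ab: "a \<le> b"
  shows "(integral {a..b} k)\<^sup>2 \<le> (b - a) * integral {a..b} (\<lambda>s. (k s)\<^sup>2)"
proof (cases "a = b")
  case False
  define c where "c = integral {a..b} k / (b - a)"
  have i: "k integrable_on {a..b}" "(\<lambda>s. (k s)\<^sup>2) integrable_on {a..b}"
    using k by (auto intro!: integrable_continuous_real continuous_intros)
  have "0 \<le> integral {a..b} (\<lambda>s. (k s - c)\<^sup>2)"
    by (intro integral_nonneg integrable_continuous_real continuous_intros k) auto
  also have "(\<lambda>s. (k s - c)\<^sup>2) = (\<lambda>s. ((k s)\<^sup>2 - (2 * c) * k s) + c\<^sup>2)"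
    by (auto simp: power2_eq_square algebra_simps)
  also have "integral {a..b} \<dots> = (integral {a..b} (\<lambda>s. (k s)\<^sup>2) - 2 * c * integral {a..b} k) + (b - a) *\<^sub>R c\<^sup>2"
    using ab by (intro integral_unique has_integral_add has_integral_diff has_integral_mult_right
        integrable_integral i) (metis content_real has_integral_const_real)
  finally have "c * integral {a..b} k \<le> integral {a..b} (\<lambda>s. (k s)\<^sup>2)"
    using False by (simp add: c_def power2_eq_square)
  then have "(b - a) * (c * integral {a..b} k) \<le> (b - a) * integral {a..b} (\<lambda>s. (k s)\<^sup>2)"
    using ab by (intro mult_left_mono) auto
  then show ?thesis
    using False by (simp add: c_def power2_eq_square)
qed auto

lemma C1_curve_displacement:
  assumes c: "C1_curve \<gamma> \<gamma>'" and ab: "0 \<le> a" "a \<le> b" "b \<le> 1"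
  shows "(norm (\<gamma> b - \<gamma> a))\<^sup>2 \<le> (b - a) * integral {a..b} (\<lambda>s. (norm (\<gamma>' s))\<^sup>2)"
proof -
  have cont: "continuous_on {a..b} \<gamma>'"
    using C1_curve_deriv_continuous_on[OF c] ab by (auto intro: continuous_on_subset)
  have "norm (\<gamma> b - \<gamma> a) = norm (integral {a..b} \<gamma>')"
    using C1_curve_has_integral[OF c ab] by (simp add: integral_unique)
  also have "\<dots> \<le> integral {a..b} (\<lambda>s. norm (\<gamma>' s))"
    by (intro integral_norm_bound_integral integrable_continuous_real continuous_intros cont) auto
  finally have "(norm (\<gamma> b - \<gamma> a))\<^sup>2 \<le> (integral {a..b} (\<lambda>s. norm (\<gamma>' s)))\<^sup>2"
    by (intro power_mono) auto
  also have "\<dots> \<le> (b - a) * integral {a..b} (\<lambda>s. (norm (\<gamma>' s))\<^sup>2)"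
    by (intro square_integral_le continuous_intros cont ab)
  finally show ?thesis .
qed

locale riemannian =
  fixes M :: "real^'n \<Rightarrow> real^'n^'n"
  assumes M_continuous: "continuous_on UNIV M" and M_pos: "sym_pos_def (M u)"
begin

lemma riem_length_C1_curve:
  assumes "C1_curve \<gamma> \<gamma>'"
  shows "riem_length M \<gamma> = integral {0..1} (\<lambda>s. sqrt (\<gamma>' s \<bullet> (M (\<gamma> s) *v \<gamma>' s)))"
  unfolding riem_length_def
proof (rule integral_cong)
  fix s :: real
  assume "s \<in> {0..1}"
  then have "vector_derivative \<gamma> (at s) = \<gamma>' s"
    using assms by (auto simp: C1_curve_def intro!: vector_derivative_at)
  then show "sqrt (vector_derivative \<gamma> (at s) \<bullet> (M (\<gamma> s) *v vector_derivative \<gamma> (at s))) =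
      sqrt (\<gamma>' s \<bullet> (M (\<gamma> s) *v \<gamma>' s))"
    by simp
qed

lemma continuous_on_speed:
  assumes "C1_curve \<gamma> \<gamma>'"
  shows "continuous_on {0..1} (\<lambda>s. sqrt (\<gamma>' s \<bullet> (M (\<gamma> s) *v \<gamma>' s)))"
  by (intro continuous_on_real_sqrt continuous_on_energy_density[OF M_continuous assms])

lemma riem_length_nonneg: "C1_curve \<gamma> \<gamma>' \<Longrightarrow> 0 \<le> riem_length M \<gamma>"
  by (auto simp: riem_length_C1_curve sym_pos_def_nonneg[OF M_pos]
      intro!: integral_nonneg integrable_continuous_real continuous_on_speed)

lemma riem_lengths_bdd_below:
  "bdd_below {riem_length M \<gamma> |\<gamma>. \<gamma> C1_differentiable_on {0..1} \<and> \<gamma> 0 = x \<and> \<gamma> 1 = y}"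
proof (rule bdd_belowI)
  fix l
  assume "l \<in> {riem_length M \<gamma> |\<gamma>. \<gamma> C1_differentiable_on {0..1} \<and> \<gamma> 0 = x \<and> \<gamma> 1 = y}"
  then obtain \<gamma> \<gamma>' where "l = riem_length M \<gamma>" "C1_curve \<gamma> \<gamma>'"
    by (auto simp: C1_differentiable_on_iff_curve)
  then show "0 \<le> l"
    using riem_length_nonneg by blast
qed

lemma riem_length_square_le_energy:
  assumes "C1_curve \<gamma> \<gamma>'"
  shows "(riem_length M \<gamma>)\<^sup>2 \<le> energy M \<gamma> \<gamma>'"
  using square_integral_le[OF continuous_on_speed[OF assms]]
  by (simp add: riem_length_C1_curve[OF assms] energy_def sym_pos_def_nonneg[OF M_pos])

lemma riem_dist_nonneg: "0 \<le> riem_dist M x y"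
  unfolding riem_dist_def
proof (rule cInf_greatest)
  have "(\<lambda>s. x + s *\<^sub>R (y - x)) C1_differentiable_on {0..1}"
    using C1_curve_line C1_differentiable_on_iff_curve by blast
  then show "{riem_length M \<gamma> |\<gamma>. \<gamma> C1_differentiable_on {0..1} \<and> \<gamma> 0 = x \<and> \<gamma> 1 = y} \<noteq> {}"
    by (auto intro!: exI[of _ "\<lambda>s. x + s *\<^sub>R (y - x)"])
qed (auto simp: C1_differentiable_on_iff_curve intro: riem_length_nonneg)

lemma riem_dist_le_length:
  assumes "C1_curve \<gamma> \<gamma>'" "\<gamma> 0 = x" "\<gamma> 1 = y"
  shows "riem_dist M x y \<le> riem_length M \<gamma>"
  unfolding riem_dist_def
proof (rule cInf_lower)
  show "riem_length M \<gamma> \<in> {riem_length M \<gamma> |\<gamma>. \<gamma> C1_differentiable_on {0..1} \<and> \<gamma> 0 = x \<and> \<gamma> 1 = y}"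
    using assms C1_differentiable_on_iff_curve by blast
qed (rule riem_lengths_bdd_below)

lemma riem_dist_square_le_energy:
  assumes "C1_curve \<gamma> \<gamma>'" "\<gamma> 0 = x" "\<gamma> 1 = y"
  shows "(riem_dist M x y)\<^sup>2 \<le> energy M \<gamma> \<gamma>'"
proof -
  have "(riem_dist M x y)\<^sup>2 \<le> (riem_length M \<gamma>)\<^sup>2"
    by (intro power_mono riem_dist_le_length[OF assms] riem_dist_nonneg)
  also note riem_length_square_le_energy[OF assms(1)]
  finally show ?thesis .
qed

text \<open>Parametrised proportionally to arc length, a curve has energy equal to its squared length. As
  the speed may vanish, a small \<open>\<epsilon>\<close> is added to it; as the derivatives at the end points are
  two-sided, the change of parameter is built on the larger interval \<open>[-1, 2]\<close>.\<close>

lemma reparametrise_energy_le: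
  assumes c: "C1_curve \<gamma> \<gamma>'" and eps: "0 < \<epsilon>"
  obtains \<delta> \<delta>' where "C1_curve \<delta> \<delta>'" "\<delta> 0 = \<gamma> 0" "\<delta> 1 = \<gamma> 1"
    "energy M \<delta> \<delta>' \<le> (riem_length M \<gamma> + \<epsilon>)\<^sup>2"
proof -
  define speed where "speed s = sqrt (\<gamma>' s \<bullet> (M (\<gamma> s) *v \<gamma>' s))" for s
  define L where "L = riem_length M \<gamma> + \<epsilon>"
  have L: "0 < L"
    using riem_length_nonneg[OF c] eps by (simp add: L_def)
  have speed0: "0 \<le> speed s" for s
    by (simp add: speed_def sym_pos_def_nonneg[OF M_pos])
  have speed_cont: "continuous_on {0..1} speed"
    unfolding speed_def using continuous_on_speed[OF c] .
  define clamp where "clamp s = max 0 (min 1 s)" for s :: real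
  define w where "w s = (speed (clamp s) + \<epsilon>) / L" for s
  have w_pos: "0 < w s" for s
    using speed0[of "clamp s"] eps L by (simp add: w_def)
  have w_cont: "continuous_on S w" for S
    unfolding w_def clamp_def using L
    by (intro continuous_intros continuous_on_compose2[OF speed_cont]) auto
  define \<sigma> where "\<sigma> s = integral {-1..s} w - integral {-1..0} w" for s
  have \<sigma>_deriv: "(\<sigma> has_real_derivative w s) (at s)" if "s \<in> {-1<..<2}" for s
  proof -
    have "((\<lambda>s. integral {-1..s} w) has_real_derivative w s) (at s within {-1..2})"
      using that by (intro integral_has_real_derivative w_cont) auto
    then have "((\<lambda>s. integral {-1..s} w) has_real_derivative w s) (at s)"
      using that at_within_Icc_at[of "-1" s 2] by (simp only: greaterThanLessThan_iff)
    then show ?thesis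
      unfolding \<sigma>_def by (auto intro!: derivative_eq_intros)
  qed
  have \<sigma>_cont: "continuous_on {-1..2} \<sigma>"
    unfolding \<sigma>_def by (intro continuous_intros indefinite_integral_continuous_1 integrable_continuous_real w_cont)
  have \<sigma>_mono: "\<sigma> a < \<sigma> b" if "-1 \<le> a" "a < b" "b \<le> 2" for a b
  proof (rule DERIV_pos_imp_increasing_open[OF \<open>a < b\<close>])
    show "\<exists>y. (\<sigma> has_real_derivative y) (at x) \<and> 0 < y" if "a < x" "x < b" for x
      using \<sigma>_deriv[of x] w_pos[of x] that \<open>-1 \<le> a\<close> \<open>b \<le> 2\<close> by force
    show "continuous_on {a..b} \<sigma>"
      using that by (intro continuous_on_subset[OF \<sigma>_cont]) auto
  qed
  have \<sigma>0: "\<sigma> 0 = 0"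
    by (simp add: \<sigma>_def)
  have \<sigma>1: "\<sigma> 1 = 1"
  proof -
    have "integral {-1..0} w + integral {0..1} w = integral {-1..1} w"
      by (intro Henstock_Kurzweil_Integration.integral_combine integrable_continuous_real w_cont) auto
    moreover have "integral {0..1} w = integral {0..1} (\<lambda>s. (speed s + \<epsilon>) / L)"
      by (intro integral_cong) (auto simp: w_def clamp_def)
    moreover have "\<dots> = (integral {0..1} speed + \<epsilon>) / L"
    proof (rule integral_unique)
      have "((\<lambda>s. (speed s + \<epsilon>) / L) has_integral ((integral {0..1} speed + (1 - 0) *\<^sub>R \<epsilon>) / L)) {0..1}"
        using has_integral_const_real[of \<epsilon> 0 1]
        by (intro has_integral_divide has_integral_add integrable_integral
            integrable_continuous_real speed_cont) simp
      then show "((\<lambda>s. (speed s + \<epsilon>) / L) has_integral ((integral {0..1} speed + \<epsilon>) / L)) {0..1}"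
        by simp
    qed
    moreover have "integral {0..1} speed = riem_length M \<gamma>"
      unfolding speed_def by (rule riem_length_C1_curve[OF c, symmetric])
    ultimately show ?thesis
      using L by (simp add: \<sigma>_def L_def)
  qed
  have inj: "inj_on \<sigma> {-1..2}"
    by (rule inj_onI) (metis \<sigma>_mono atLeastAtMost_iff less_irrefl linorder_neqE_linordered_idom)
  define \<tau> where "\<tau> = the_inv_into {-1..2} \<sigma>"
  have \<tau>\<sigma>: "\<tau> (\<sigma> s) = s" if "s \<in> {-1..2}" for s
    unfolding \<tau>_def using that by (rule the_inv_into_f_f[OF inj])
  have range: "\<exists>s\<in>{-1<..<2}. \<sigma> s = t" if "\<sigma> (-1) < t" "t < \<sigma> 2" for t
  proof -
    have "\<exists>s\<ge>-1. s \<le> 2 \<and> \<sigma> s = t"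
      using that by (intro IVT' \<sigma>_cont) auto
    then obtain s where "-1 \<le> s" "s \<le> 2" "\<sigma> s = t"
      by auto
    moreover have "s \<noteq> -1" "s \<noteq> 2"
      using that \<open>\<sigma> s = t\<close> by auto
    ultimately show ?thesis
      by (intro bexI[of _ s]) auto
  qed
  have ends: "\<sigma> (-1) < 0" "1 < \<sigma> 2"
    using \<sigma>_mono[of "-1" 0] \<sigma>_mono[of 1 2] \<sigma>0 \<sigma>1 by auto
  have \<tau>_deriv: "(\<tau> has_real_derivative inverse (w (\<tau> t))) (at t)" if t: "\<sigma> (-1) < t" "t < \<sigma> 2" for t
  proof (rule DERIV_inverse_function[OF _ _ t])
    obtain s where s: "s \<in> {-1<..<2}" "\<sigma> s = t"
      using range[OF t] by auto
    then have st: "\<tau> t = s"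
      using \<tau>\<sigma>[of s] by auto
    show "(\<sigma> has_real_derivative w (\<tau> t)) (at (\<tau> t))"
      using \<sigma>_deriv s st by simp
    show "w (\<tau> t) \<noteq> 0"
      using w_pos[of "\<tau> t"] by simp
    show "\<sigma> (\<tau> y) = y" if "\<sigma> (-1) < y" "y < \<sigma> 2" for y
      using range[OF that] \<tau>\<sigma> by auto
    define r where "r = min (s + 1) (2 - s) / 2"
    have "r \<le> (s + 1) / 2" "r \<le> (2 - s) / 2" and r0: "0 < r"
      using s by (auto simp: r_def)
    then have r: "z \<in> {-1<..<2}" if "\<bar>z - s\<bar> \<le> r" for z
      using that s by auto
    have "isCont \<tau> (\<sigma> s)"
    proof (rule isCont_inverse_function[where d = r and f = \<sigma> and x = s])
      show "\<tau> (\<sigma> z) = z" if "\<bar>z - s\<bar> \<le> r" for z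
        using r[OF that] by (intro \<tau>\<sigma>) auto
      show "isCont \<sigma> z" if "\<bar>z - s\<bar> \<le> r" for z
        using DERIV_isCont[OF \<sigma>_deriv[OF r[OF that]]] .
    qed (rule r0)
    then show "isCont \<tau> t"
      using s by simp
  qed
  have \<tau>0: "\<tau> 0 = 0" and \<tau>1: "\<tau> 1 = 1"
    using \<tau>\<sigma>[of 0] \<tau>\<sigma>[of 1] \<sigma>0 \<sigma>1 by auto
  have \<tau>_in: "\<tau> t \<in> {0..1}" if t: "t \<in> {0..1}" for t
  proof -
    have "\<sigma> (-1) < t" "t < \<sigma> 2"
      using t ends by auto
    then obtain s where s: "s \<in> {-1<..<2}" "\<sigma> s = t"
      using range by blast
    moreover have "0 \<le> s" "s \<le> 1"
      using \<sigma>_mono[of s 0] \<sigma>_mono[of 1 s] s t \<sigma>0 \<sigma>1 by force+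
    ultimately show ?thesis
      using \<tau>\<sigma>[of s] by auto
  qed
  have d: "(\<tau> has_real_derivative inverse (w (\<tau> t))) (at t)" if "t \<in> {0..1}" for t
    using \<tau>_deriv[of t] ends that by auto
  have \<tau>_cont: "continuous_on {0..1} \<tau>"
    using d DERIV_isCont by (intro continuous_at_imp_continuous_on) blast
  define \<delta> where "\<delta> t = \<gamma> (\<tau> t)" for t
  define \<delta>' where "\<delta>' t = inverse (w (\<tau> t)) *\<^sub>R \<gamma>' (\<tau> t)" for t
  have curve: "C1_curve \<delta> \<delta>'"
    unfolding C1_curve_def
  proof (intro conjI ballI)
    show "(\<delta> has_vector_derivative \<delta>' t) (at t)" if t: "t \<in> {0..1}" for t
    proof -
      have "(\<tau> has_vector_derivative inverse (w (\<tau> t))) (at t)"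
        using d[OF t] by (simp add: has_real_derivative_iff_has_vector_derivative)
      moreover have "(\<gamma> has_vector_derivative \<gamma>' (\<tau> t)) (at (\<tau> t))"
        using c \<tau>_in[OF t] by (simp add: C1_curve_def)
      ultimately have "(\<gamma> \<circ> \<tau> has_vector_derivative inverse (w (\<tau> t)) *\<^sub>R \<gamma>' (\<tau> t)) (at t)"
        by (rule vector_diff_chain_at)
      then show ?thesis
        by (simp add: \<delta>_def[abs_def] \<delta>'_def o_def)
    qed
    have "continuous_on {0..1} (\<lambda>t. w (\<tau> t))"
      by (rule continuous_on_compose2[OF w_cont[of UNIV] \<tau>_cont]) auto
    moreover have "continuous_on {0..1} (\<lambda>t. \<gamma>' (\<tau> t))"
      using \<tau>_in by (intro continuous_on_compose2[OF C1_curve_deriv_continuous_on[OF c] \<tau>_cont]) auto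
    ultimately show "continuous_on {0..1} \<delta>'"
      unfolding \<delta>'_def using w_pos by (intro continuous_intros) (auto simp: less_imp_neq[symmetric])
  qed
  have dens: "\<delta>' t \<bullet> (M (\<delta> t) *v \<delta>' t) \<le> L\<^sup>2" if t: "t \<in> {0..1}" for t
  proof -
    let ?s = "\<tau> t"
    have "\<delta>' t \<bullet> (M (\<delta> t) *v \<delta>' t) = (inverse (w ?s) * speed ?s)\<^sup>2"
      by (simp add: \<delta>'_def \<delta>_def speed_def sym_pos_def_nonneg[OF M_pos] matrix_vector_mult_scaleR
        power_mult_distrib) (simp add: power2_eq_square)
    also have "inverse (w ?s) * speed ?s \<le> L"
    proof -
      have "w ?s = (speed ?s + \<epsilon>) / L"
        using \<tau>_in[OF t] by (simp add: w_def clamp_def)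
      then show ?thesis
        using speed0[of ?s] w_pos[of ?s] eps L by (simp add: field_simps)
    qed
    then have "(inverse (w ?s) * speed ?s)\<^sup>2 \<le> L\<^sup>2"
      using speed0[of ?s] w_pos[of ?s] by (intro power_mono) (auto simp: less_imp_le)
    finally show ?thesis .
  qed
  have "energy M \<delta> \<delta>' \<le> integral {0..1} (\<lambda>t::real. L\<^sup>2)"
    unfolding energy_def
    by (intro integral_le integrable_continuous_real continuous_on_energy_density[OF M_continuous curve])
       (use dens in auto)
  then show ?thesis
    using that[OF curve] by (simp add: \<delta>_def \<tau>0 \<tau>1 L_def)
qed

lemma riem_dist_near_minimiser:
  assumes eps: "0 < \<epsilon>"
  obtains \<gamma> \<gamma>' where "C1_curve \<gamma> \<gamma>'" "\<gamma> 0 = x" "\<gamma> 1 = y" "energy M \<gamma> \<gamma>' \<le> (riem_dist M x y)\<^sup>2 + \<epsilon>"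
proof -
  let ?D = "riem_dist M x y"
  have "((\<lambda>e. (?D + 2 * e)\<^sup>2) \<longlongrightarrow> (?D + 2 * 0)\<^sup>2) (at_right 0)"
    by (intro tendsto_intros)
  then have "eventually (\<lambda>e. (?D + 2 * e)\<^sup>2 < ?D\<^sup>2 + \<epsilon>) (at_right 0)"
    by (rule order_tendstoD) (use eps in simp)
  with eventually_at_right_less[of 0] have "eventually (\<lambda>e. 0 < e \<and> (?D + 2 * e)\<^sup>2 < ?D\<^sup>2 + \<epsilon>) (at_right 0)"
    by eventually_elim auto
  then obtain e where e: "0 < e" "(?D + 2 * e)\<^sup>2 < ?D\<^sup>2 + \<epsilon>"
    using eventually_happens'[OF trivial_limit_at_right_real] by blast
  let ?S = "{riem_length M \<gamma> |\<gamma>. \<gamma> C1_differentiable_on {0..1} \<and> \<gamma> 0 = x \<and> \<gamma> 1 = y}"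
  have "(\<lambda>s. x + s *\<^sub>R (y - x)) C1_differentiable_on {0..1}"
    using C1_curve_line C1_differentiable_on_iff_curve by blast
  then have "?S \<noteq> {}"
    by (auto intro!: exI[of _ "\<lambda>s. x + s *\<^sub>R (y - x)"])
  then obtain l where "l \<in> ?S" "l < ?D + e"
    unfolding riem_dist_def using cInf_lessD[of ?S "Inf ?S + e"] e by auto
  then obtain \<gamma> \<gamma>' where g: "C1_curve \<gamma> \<gamma>'" "\<gamma> 0 = x" "\<gamma> 1 = y" "riem_length M \<gamma> < ?D + e"
    by (auto simp: C1_differentiable_on_iff_curve)
  from reparametrise_energy_le[OF g(1) e(1)] obtain \<delta> \<delta>' where
    d: "C1_curve \<delta> \<delta>'" "\<delta> 0 = \<gamma> 0" "\<delta> 1 = \<gamma> 1" "energy M \<delta> \<delta>' \<le> (riem_length M \<gamma> + e)\<^sup>2" .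
  have "(riem_length M \<gamma> + e)\<^sup>2 \<le> (?D + 2 * e)\<^sup>2"
    using g(4) riem_length_nonneg[OF g(1)] e(1) by (intro power_mono) auto
  with d e g show ?thesis
    using that[of \<delta> \<delta>'] by auto
qed

end

section \<open>Second differences of the squared distance\<close>

text \<open>Both arguments of the squared distance will range over a ball on which the metric is uniformly
  elliptic and of class \<open>C\<^sup>1\<^sup>,\<^sup>1\<close>; the latter enters as a bound on second differences.\<close>

locale elliptic_ball = riemannian M for M :: "real^'n \<Rightarrow> real^'n^'n" +
  fixes z :: "real^'n" and R \<alpha> A :: real
  assumes R_pos: "0 < R" and \<alpha>_pos: "0 < \<alpha>" and A_ge_1: "1 \<le> A"
    and M_lower: "x \<in> cball z R \<Longrightarrow> \<alpha> * (norm v)\<^sup>2 \<le> v \<bullet> (M x *v v)"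
    and M_bound: "x \<in> cball z R \<Longrightarrow> norm (M x) \<le> A"
    and M_Lipschitz: "x \<in> cball z R \<Longrightarrow> y \<in> cball z R \<Longrightarrow> norm (M x - M y) \<le> A * norm (x - y)"
    and M_second_difference: "x \<in> cball z R \<Longrightarrow> x + d \<in> cball z R \<Longrightarrow> x - d \<in> cball z R \<Longrightarrow>
      norm (M (x + d) + M (x - d) - 2 *\<^sub>R M x) \<le> A * (norm d)\<^sup>2"
begin

abbreviation D2 :: "real^'n \<Rightarrow> real^'n \<Rightarrow> real" where
  "D2 x y \<equiv> (riem_dist M x y)\<^sup>2"

lemma M_upper: "x \<in> cball z R \<Longrightarrow> v \<bullet> (M x *v w) \<le> A * norm v * norm w"
proof -
  assume x: "x \<in> cball z R"
  have "v \<bullet> (M x *v w) \<le> norm (M x) * norm v * norm w"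
    using inner_matrix_le[of v "M x" w] by linarith
  also have "\<dots> \<le> A * norm v * norm w"
    using M_bound[OF x] by (intro mult_right_mono) auto
  finally show ?thesis .
qed

lemma M_upper_square: "x \<in> cball z R \<Longrightarrow> v \<bullet> (M x *v v) \<le> A * (norm v)\<^sup>2"
  using M_upper[of x v v] by (simp add: power2_eq_square mult.assoc)

lemma integrable_norm_square:
  "C1_curve \<gamma> \<gamma>' \<Longrightarrow> (\<lambda>s. (norm (\<gamma>' s))\<^sup>2) integrable_on {0..1}"
  by (intro integrable_continuous_real continuous_intros C1_curve_deriv_continuous_on)

lemma integrable_energy_density:
  "C1_curve \<gamma> \<gamma>' \<Longrightarrow> (\<lambda>s. \<gamma>' s \<bullet> (M (\<gamma> s) *v \<gamma>' s)) integrable_on {0..1}"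
  by (intro integrable_continuous_real continuous_on_energy_density M_continuous)

text \<open>A curve that stays in the ball up to time \<open>b\<close> spends at least \<open>\<alpha> * distance\<^sup>2\<close> of energy, so a
  curve of small energy cannot reach the boundary of the ball.\<close>

lemma low_energy_curve_stays_near:
  assumes c: "C1_curve \<gamma> \<gamma>'" and x: "\<gamma> 0 \<in> cball z (R / 2)"
    and E: "energy M \<gamma> \<gamma>' \<le> \<alpha> * G\<^sup>2" and G: "0 \<le> G" "G < R / 2" and s: "s \<in> {0..1}"
  shows "norm (\<gamma> s - \<gamma> 0) \<le> G"
proof (rule ccontr)
  define f where "f s = norm (\<gamma> s - \<gamma> 0)" for s
  assume "\<not> ?thesis"
  then have "G < f s"
    by (simp add: f_def)
  then obtain G' where G': "G < G'" "G' < f s" "G' < R / 2"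
    using dense[of G "min (f s) (R / 2)"] G by auto
  have f_cont: "continuous_on {0..1} f"
    unfolding f_def by (intro continuous_intros C1_curve_continuous_on[OF c])
  define S where "S = {t \<in> {0..1}. G' \<le> f t}"
  have "compact S"
  proof -
    have "closed S"
      unfolding S_def by (intro continuous_on_closed_Collect_le f_cont continuous_on_const) auto
    moreover have "bounded S"
      by (rule bounded_subset[of "{0..1}"]) (auto simp: S_def)
    ultimately show ?thesis
      by (simp add: compact_eq_bounded_closed)
  qed
  moreover have "S \<noteq> {}"
    using s G' by (auto simp: S_def)
  ultimately obtain b where b: "b \<in> S" "\<And>t. t \<in> S \<Longrightarrow> b \<le> t"
    using compact_attains_inf by metis
  have b01: "0 \<le> b" "b \<le> 1" "G' \<le> f b"
    using b by (auto simp: S_def)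
  have before: "f t < G'" if "0 \<le> t" "t < b" for t
    using b(2)[of t] that b01 by (force simp: S_def)
  have "f b \<le> G'"
  proof (rule ccontr)
    assume "\<not> f b \<le> G'"
    moreover have "f 0 \<le> G'"
      using G G' by (simp add: f_def)
    ultimately obtain t where t: "0 \<le> t" "t \<le> b" "f t = G'"
      using IVT'[of f 0 G' b] b01 continuous_on_subset[OF f_cont, of "{0..b}"] by auto
    then show False
      using before[of t] \<open>\<not> f b \<le> G'\<close> by (cases "t = b") auto
  qed
  then have le: "f t \<le> G'" if "0 \<le> t" "t \<le> b" for t
    using before[of t] that by (cases "t = b") auto
  have inball: "\<gamma> t \<in> cball z R" if "0 \<le> t" "t \<le> b" for t
  proof -
    have "norm (\<gamma> t - z) \<le> f t + norm (\<gamma> 0 - z)"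
      unfolding f_def by norm
    then show ?thesis
      using le[OF that] x G' by (simp add: dist_norm norm_minus_commute)
  qed
  have c_int: "(\<lambda>s. (norm (\<gamma>' s))\<^sup>2) integrable_on {0..b}"
    using b01 by (intro integrable_on_subinterval[OF integrable_norm_square[OF c]]) auto
  have e_int: "(\<lambda>s. \<gamma>' s \<bullet> (M (\<gamma> s) *v \<gamma>' s)) integrable_on {0..b}"
    using b01 by (intro integrable_on_subinterval[OF integrable_energy_density[OF c]]) auto
  have "\<alpha> * (f b)\<^sup>2 \<le> \<alpha> * ((b - 0) * integral {0..b} (\<lambda>s. (norm (\<gamma>' s))\<^sup>2))"
    unfolding f_def using C1_curve_displacement[OF c, of 0 b] b01 \<alpha>_pos
    by (intro mult_left_mono) auto
  also have "\<dots> \<le> \<alpha> * integral {0..b} (\<lambda>s. (norm (\<gamma>' s))\<^sup>2)"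
    using b01 \<alpha>_pos c_int
    by (intro mult_left_mono mult_left_le_one_le integral_nonneg) auto
  also have "\<dots> = integral {0..b} (\<lambda>s. \<alpha> * (norm (\<gamma>' s))\<^sup>2)"
    by simp
  also have "integral {0..b} (\<lambda>s. \<alpha> * (norm (\<gamma>' s))\<^sup>2) \<le> integral {0..b} (\<lambda>s. \<gamma>' s \<bullet> (M (\<gamma> s) *v \<gamma>' s))"
    using M_lower[OF inball] by (intro integral_le integrable_on_mult_right c_int e_int) auto
  also have "integral {0..b} (\<lambda>s. \<gamma>' s \<bullet> (M (\<gamma> s) *v \<gamma>' s)) \<le> energy M \<gamma> \<gamma>'"
    unfolding energy_def using b01
    by (auto intro!: integral_subset_le e_int integrable_energy_density[OF c] sym_pos_def_nonneg[OF M_pos])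
  finally have "\<alpha> * (f b)\<^sup>2 \<le> \<alpha> * G\<^sup>2"
    using E by simp
  then have "(f b)\<^sup>2 \<le> G\<^sup>2"
    using \<alpha>_pos by simp
  then have "f b \<le> G"
    by (rule power2_le_imp_le) (use G in auto)
  then show False
    using b01 G' by simp
qed

lemma integral_norm_square_le_energy:
  assumes c: "C1_curve \<gamma> \<gamma>'" and inball: "\<And>s. s \<in> {0..1} \<Longrightarrow> \<gamma> s \<in> cball z R"
  shows "\<alpha> * integral {0..1} (\<lambda>s. (norm (\<gamma>' s))\<^sup>2) \<le> energy M \<gamma> \<gamma>'"
proof -
  have "\<alpha> * integral {0..1} (\<lambda>s. (norm (\<gamma>' s))\<^sup>2) = integral {0..1} (\<lambda>s. \<alpha> * (norm (\<gamma>' s))\<^sup>2)"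
    by simp
  also have "\<dots> \<le> energy M \<gamma> \<gamma>'"
    unfolding energy_def using M_lower[OF inball]
    by (intro integral_le integrable_on_mult_right integrable_norm_square[OF c] integrable_energy_density[OF c]) auto
  finally show ?thesis .
qed

lemma D2_upper:
  assumes "x \<in> cball z R" "y \<in> cball z R"
  shows "D2 x y \<le> A * (norm (y - x))\<^sup>2"
proof -
  let ?\<gamma> = "\<lambda>s. x + s *\<^sub>R (y - x)"
  have c: "C1_curve ?\<gamma> (\<lambda>s. y - x)"
    by (rule C1_curve_line)
  have inball: "?\<gamma> s \<in> cball z R" if "s \<in> {0..1}" for s
  proof -
    have "?\<gamma> s \<in> closed_segment x y"
      using that by (auto simp: in_segment algebra_simps intro!: exI[of _ s])
    then show ?thesis
      using closed_segment_subset[of x "cball z R" y] assms by auto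
  qed
  have "D2 x y \<le> energy M ?\<gamma> (\<lambda>s. y - x)"
    by (rule riem_dist_square_le_energy[OF c]) auto
  also have "\<dots> \<le> integral {0..1} (\<lambda>s::real. A * (norm (y - x))\<^sup>2)"
    unfolding energy_def using M_upper_square[OF inball]
    by (intro integral_le integrable_energy_density[OF c]) auto
  finally show ?thesis
    by simp
qed

text \<open>The straight line bounds the energy of a near-minimiser, and this confines the near-minimiser
  to a ball of comparable radius, although competitors are arbitrary curves in the whole space.\<close>

lemma near_minimiser:
  assumes x: "x \<in> cball z (R / 2)" and y: "y \<in> cball z R" and eps: "0 < \<epsilon>"
    and G: "A * (norm (y - x))\<^sup>2 + \<epsilon> \<le> \<alpha> * G\<^sup>2" "0 \<le> G" "G < R / 2"
  obtains \<gamma> \<gamma>' where "C1_curve \<gamma> \<gamma>'" "\<gamma> 0 = x" "\<gamma> 1 = y" "energy M \<gamma> \<gamma>' \<le> D2 x y + \<epsilon>"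
    "integral {0..1} (\<lambda>s. (norm (\<gamma>' s))\<^sup>2) \<le> G\<^sup>2" "\<And>s. s \<in> {0..1} \<Longrightarrow> norm (\<gamma> s - x) \<le> G"
proof -
  from riem_dist_near_minimiser[OF eps] obtain \<gamma> \<gamma>' where
    g: "C1_curve \<gamma> \<gamma>'" "\<gamma> 0 = x" "\<gamma> 1 = y" "energy M \<gamma> \<gamma>' \<le> D2 x y + \<epsilon>" .
  have "x \<in> cball z R"
    using x R_pos by simp
  then have E: "energy M \<gamma> \<gamma>' \<le> \<alpha> * G\<^sup>2"
    using D2_upper[of x y] y G(1) g(4) by linarith
  have near: "norm (\<gamma> s - x) \<le> G" if "s \<in> {0..1}" for s
    using low_energy_curve_stays_near[OF g(1) _ E G(2,3) that] x g(2) by simp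
  have "\<gamma> s \<in> cball z R" if "s \<in> {0..1}" for s
    using near[OF that] x G norm_triangle_ineq[of "\<gamma> s - x" "x - z"]
    by (simp add: dist_norm norm_minus_commute)
  then have "\<alpha> * integral {0..1} (\<lambda>s. (norm (\<gamma>' s))\<^sup>2) \<le> \<alpha> * G\<^sup>2"
    using integral_norm_square_le_energy[OF g(1)] E by force
  then have "integral {0..1} (\<lambda>s. (norm (\<gamma>' s))\<^sup>2) \<le> G\<^sup>2"
    using \<alpha>_pos by simp
  then show ?thesis
    using that g near by blast
qed

lemma D2_lower:
  assumes x: "x \<in> cball z (R / 2)" and D: "D2 x y \<le> \<alpha> * G\<^sup>2" and G: "0 \<le> G" "G < R / 2"
  shows "norm (y - x) \<le> G"
proof (rule dense_ge_bounded[OF G(2)])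
  fix G'
  assume G': "G < G'" "G' < R / 2"
  then have "\<alpha> * G\<^sup>2 < \<alpha> * G'\<^sup>2"
    using \<alpha>_pos G by (simp add: power_strict_mono)
  then have pos: "0 < \<alpha> * G'\<^sup>2 - D2 x y"
    using D by simp
  from riem_dist_near_minimiser[OF pos] obtain \<gamma> \<gamma>' where
    g: "C1_curve \<gamma> \<gamma>'" "\<gamma> 0 = x" "\<gamma> 1 = y" "energy M \<gamma> \<gamma>' \<le> D2 x y + (\<alpha> * G'\<^sup>2 - D2 x y)" .
  then show "norm (y - x) \<le> G'"
    using low_energy_curve_stays_near[OF g(1), of G' 1] x G G' by auto
qed

definition K_first :: real where
  "K_first = 1 + 4 * A\<^sup>2 / \<alpha> + 4 * A / \<alpha> + 4 * A + A * R\<^sup>2"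

text \<open>Dragging the end point of a near-minimiser from \<open>p\<close> to \<open>q\<close> along \<open>s \<mapsto> s * (q - p)\<close> changes the
  energy by the first-variation term of the flat metric frozen at \<open>p\<close>, up to the stated remainder:
  the metric varies by \<open>O(|p - x|)\<close> along the curve.\<close>

lemma first_variation_upper:
  assumes x: "x \<in> cball z (R / 4)" and p: "p \<in> cball z R"
    and t: "norm (q - p) \<le> 1" "norm (q - p) \<le> R / 4"
    and d: "A * (norm (p - x))\<^sup>2 + (norm (q - p))\<^sup>2 < \<alpha> * (R / 4)\<^sup>2"
  shows "D2 x q - D2 x p \<le> 2 * ((q - p) \<bullet> (M p *v (p - x)))
           + K_first * (norm (q - p) * (norm (p - x))\<^sup>2 + (norm (q - p))\<^sup>2)"
proof (cases "q = p")
  case False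
  define \<tau> where "\<tau> = q - p"
  define t where "t = norm \<tau>"
  define d where "d = norm (p - x)"
  have t0: "0 < t" and t1: "t \<le> 1" and tR: "t \<le> R / 4"
    using False assms by (auto simp: t_def \<tau>_def)
  define G where "G = sqrt ((A * d\<^sup>2 + t\<^sup>2) / \<alpha>)"
  have G2: "\<alpha> * G\<^sup>2 = A * d\<^sup>2 + t\<^sup>2" and G0: "0 \<le> G"
    using \<alpha>_pos A_ge_1 by (auto simp: G_def)
  have "\<alpha> * G\<^sup>2 < \<alpha> * (R / 4)\<^sup>2"
    using assms(5) unfolding G2 by (simp add: d_def t_def \<tau>_def)
  then have GR: "G < R / 4"
    using \<alpha>_pos R_pos by (intro power_less_imp_less_base[of G 2 "R / 4"]) auto
  have x2: "x \<in> cball z (R / 2)"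
    using x R_pos by simp
  have "0 < t\<^sup>2" "A * (norm (p - x))\<^sup>2 + t\<^sup>2 \<le> \<alpha> * G\<^sup>2" "G < R / 2"
    using t0 G2 GR R_pos by (simp_all add: d_def)
  from near_minimiser[OF x2 p this(1,2) G0 this(3)] obtain \<gamma> u where
    g: "C1_curve \<gamma> u" "\<gamma> 0 = x" "\<gamma> 1 = p" "energy M \<gamma> u \<le> D2 x p + t\<^sup>2"
    "integral {0..1} (\<lambda>s. (norm (u s))\<^sup>2) \<le> G\<^sup>2" and near: "\<And>s. s \<in> {0..1} \<Longrightarrow> norm (\<gamma> s - x) \<le> G"
    by blast
  define \<delta> where "\<delta> s = \<gamma> s + s *\<^sub>R \<tau>" for s
  have curve: "C1_curve \<delta> (\<lambda>s. u s + \<tau>)"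
    using C1_curve_add[OF g(1) C1_curve_line[of 0 \<tau>]] by (simp add: \<delta>_def[abs_def])
  have "D2 x q \<le> energy M \<delta> (\<lambda>s. u s + \<tau>)"
    using g by (intro riem_dist_square_le_energy[OF curve]) (auto simp: \<delta>_def \<tau>_def)
  also have "\<dots> \<le> energy M \<gamma> u + (2 * (\<tau> \<bullet> (M p *v (p - x))) + ((2 * A * t + A * t\<^sup>2) *
      integral {0..1} (\<lambda>s. (norm (u s))\<^sup>2) + (1 - 0) *\<^sub>R (A * t * (G + d)\<^sup>2 + 2 * A * t\<^sup>2)))"
    (is "_ \<le> ?I")
  proof -
    have "((\<lambda>s. \<tau> \<bullet> (M p *v u s)) has_integral \<tau> \<bullet> (M p *v (p - x))) {0..1}"
    proof -
      have "bounded_linear (\<lambda>v. \<tau> \<bullet> (M p *v v))"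
        by (rule bounded_linear_compose[OF bounded_linear_inner_right matrix_vector_mul_bounded_linear])
      moreover have "(u has_integral (p - x)) {0..1}"
        using C1_curve_has_integral[OF g(1), of 0 1] g by simp
      ultimately show ?thesis
        using has_integral_linear[of u "p - x" "{0..1}"] by (simp add: o_def)
    qed
    then have bound: "((\<lambda>s. u s \<bullet> (M (\<gamma> s) *v u s) + (2 * (\<tau> \<bullet> (M p *v u s)) + ((2 * A * t + A * t\<^sup>2) * (norm (u s))\<^sup>2
        + (A * t * (G + d)\<^sup>2 + 2 * A * t\<^sup>2)))) has_integral ?I) {0..1}"
      unfolding energy_def
      by (intro has_integral_add has_integral_mult_right integrable_integral integrable_norm_square[OF g(1)]
          integrable_energy_density[OF g(1)]) (use has_integral_const_real[of _ 0 1] in auto)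
    have "((\<lambda>s. (u s + \<tau>) \<bullet> (M (\<delta> s) *v (u s + \<tau>))) has_integral energy M \<delta> (\<lambda>s. u s + \<tau>)) {0..1}"
      unfolding energy_def by (intro integrable_integral integrable_energy_density[OF curve])
    then show ?thesis
    proof (rule has_integral_le[OF _ bound])
      fix s :: real
      assume s: "s \<in> {0..1}"
      define v where "v = u s"
      have st: "norm (s *\<^sub>R \<tau>) \<le> t"
        using s by (simp add: t_def mult_left_le_one_le)
      have ga: "norm (\<gamma> s - z) \<le> G + R / 4"
        using near[OF s] x norm_triangle_ineq[of "\<gamma> s - x" "x - z"] by (simp add: dist_norm norm_minus_commute)
      then have a: "\<gamma> s \<in> cball z R"
        using GR R_pos by (simp add: dist_norm norm_minus_commute)
      have c: "\<delta> s \<in> cball z R"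
        using ga st tR GR R_pos norm_triangle_ineq[of "\<gamma> s - z" "s *\<^sub>R \<tau>"]
        by (simp add: \<delta>_def dist_norm norm_minus_commute algebra_simps)
      have ca: "norm (\<delta> s - \<gamma> s) \<le> t"
        using st by (simp add: \<delta>_def)
      have "norm (a + b - p) \<le> norm (a - x) + norm b + norm (p - x)" for a b :: "real^'n"
        by norm
      then have "norm (\<delta> s - p) \<le> norm (\<gamma> s - x) + norm (s *\<^sub>R \<tau>) + norm (p - x)"
        unfolding \<delta>_def .
      then have cp: "norm (\<delta> s - p) \<le> t + (G + d)"
        using near[OF s] st by (simp add: d_def)
      have "(v + \<tau>) \<bullet> (M (\<delta> s) *v (v + \<tau>))
          = v \<bullet> (M (\<delta> s) *v v) + 2 * (\<tau> \<bullet> (M (\<delta> s) *v v)) + \<tau> \<bullet> (M (\<delta> s) *v \<tau>)"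
        by (rule quadratic_form_add[OF M_pos])
      moreover have "v \<bullet> (M (\<delta> s) *v v) - v \<bullet> (M (\<gamma> s) *v v) \<le> A * t * (norm v)\<^sup>2"
      proof -
        have "v \<bullet> (M (\<delta> s) *v v) - v \<bullet> (M (\<gamma> s) *v v) \<le> norm (M (\<delta> s) - M (\<gamma> s)) * norm v * norm v"
          using inner_matrix_diff_le[of v "M (\<delta> s)" v "M (\<gamma> s)"] by linarith
        also have "\<dots> \<le> (A * t) * norm v * norm v"
          by (intro mult_right_mono order_trans[OF M_Lipschitz[OF c a]] mult_left_mono ca)
             (use A_ge_1 in auto)
        finally show ?thesis
          by (simp add: power2_eq_square mult_ac)
      qed
      moreover have "2 * (\<tau> \<bullet> (M (\<delta> s) *v v)) - 2 * (\<tau> \<bullet> (M p *v v))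
          \<le> A * t * ((G + d)\<^sup>2 + (norm v)\<^sup>2) + A * t\<^sup>2 * (1 + (norm v)\<^sup>2)"
      proof -
        have "\<tau> \<bullet> (M (\<delta> s) *v v) - \<tau> \<bullet> (M p *v v) \<le> norm (M (\<delta> s) - M p) * norm \<tau> * norm v"
          using inner_matrix_diff_le[of \<tau> "M (\<delta> s)" v "M p"] by linarith
        also have "\<dots> \<le> (A * (t + (G + d))) * t * norm v"
          unfolding t_def[symmetric]
          by (intro mult_right_mono order_trans[OF M_Lipschitz[OF c p]] mult_left_mono cp)
             (use A_ge_1 t0 in auto)
        finally have "2 * (\<tau> \<bullet> (M (\<delta> s) *v v)) - 2 * (\<tau> \<bullet> (M p *v v)) \<le>
            A * t * (2 * (G + d) * norm v) + A * t\<^sup>2 * (2 * 1 * norm v)"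
          by (simp add: power2_eq_square algebra_simps)
        also have "\<dots> \<le> A * t * ((G + d)\<^sup>2 + (norm v)\<^sup>2) + A * t\<^sup>2 * (1\<^sup>2 + (norm v)\<^sup>2)"
          using t0 A_ge_1 sum_squares_bound[of "G + d" "norm v"] sum_squares_bound[of 1 "norm v"]
          by (intro add_mono mult_left_mono) auto
        finally show ?thesis
          by simp
      qed
      moreover have "\<tau> \<bullet> (M (\<delta> s) *v \<tau>) \<le> A * t\<^sup>2"
        using M_upper_square[OF c] by (simp add: t_def)
      ultimately show "(u s + \<tau>) \<bullet> (M (\<delta> s) *v (u s + \<tau>)) \<le> u s \<bullet> (M (\<gamma> s) *v u s) + (2 * (\<tau> \<bullet> (M p *v u s)) +
          ((2 * A * t + A * t\<^sup>2) * (norm (u s))\<^sup>2 + (A * t * (G + d)\<^sup>2 + 2 * A * t\<^sup>2)))"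
        unfolding v_def[symmetric] by (simp add: algebra_simps)
    qed
  qed
  also have "\<dots> \<le> (D2 x p + t\<^sup>2) + (2 * (\<tau> \<bullet> (M p *v (p - x))) + ((2 * A * t + A * t\<^sup>2) * G\<^sup>2
      + (A * t * (2 * G\<^sup>2 + 2 * d\<^sup>2) + 2 * A * t\<^sup>2)))"
  proof -
    have "(2 * A * t + A * t\<^sup>2) * integral {0..1} (\<lambda>s. (norm (u s))\<^sup>2) \<le> (2 * A * t + A * t\<^sup>2) * G\<^sup>2"
      using g(5) t0 A_ge_1 by (intro mult_left_mono) auto
    moreover have "A * t * (G + d)\<^sup>2 \<le> A * t * (2 * G\<^sup>2 + 2 * d\<^sup>2)"
      using sum_squares_bound[of G d] t0 A_ge_1 by (intro mult_left_mono) (auto simp: power2_sum)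
    ultimately show ?thesis
      using g(4) by simp
  qed
  also have "\<dots> \<le> D2 x p + 2 * (\<tau> \<bullet> (M p *v (p - x))) + K_first * (t * d\<^sup>2 + t\<^sup>2)"
  proof -
    have G2': "G\<^sup>2 = A * d\<^sup>2 / \<alpha> + t\<^sup>2 / \<alpha>"
      using G2 \<alpha>_pos by (simp add: field_simps)
    have "4 * A * t * G\<^sup>2 = (4 * A\<^sup>2 / \<alpha>) * (t * d\<^sup>2) + (4 * A / \<alpha>) * (t\<^sup>2 * t)"
      unfolding G2' by (simp add: field_simps power2_eq_square)
    also have "\<dots> \<le> (4 * A\<^sup>2 / \<alpha>) * (t * d\<^sup>2) + (4 * A / \<alpha>) * t\<^sup>2"
      using t0 t1 A_ge_1 \<alpha>_pos by (intro add_left_mono mult_left_mono) (auto simp: mult_left_le)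
    finally have 1: "4 * A * t * G\<^sup>2 \<le> (4 * A\<^sup>2 / \<alpha>) * (t * d\<^sup>2) + (4 * A / \<alpha>) * t\<^sup>2" .
    have "G\<^sup>2 \<le> R\<^sup>2"
      using G0 GR R_pos by (intro power_mono) auto
    then have 2: "A * t\<^sup>2 * G\<^sup>2 \<le> A * R\<^sup>2 * t\<^sup>2"
      using A_ge_1 mult_left_mono[of "G\<^sup>2" "R\<^sup>2" "A * t\<^sup>2"] by (simp add: mult_ac)
    have "0 \<le> (4 * A\<^sup>2 / \<alpha>) * t\<^sup>2" "0 \<le> (4 * A / \<alpha>) * (t * d\<^sup>2)" "0 \<le> 2 * A * (t * d\<^sup>2)" "0 \<le> t * d\<^sup>2"
      "0 \<le> 2 * A * t\<^sup>2" "0 \<le> A * R\<^sup>2 * (t * d\<^sup>2)"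
      using t0 A_ge_1 \<alpha>_pos by auto
    with 1 2 show ?thesis
      unfolding K_first_def by (simp add: algebra_simps)
  qed
  finally show ?thesis
    by (simp add: \<tau>_def t_def d_def)
qed simp

definition K_energy :: real where
  "K_energy = A * (R + 4)"

text \<open>If the curve \<open>\<gamma>\<close> and its perturbations by \<open>\<plusminus>\<eta>\<close> stay within \<open>\<rho>\<close> of \<open>z\<close>, the metric varies by
  \<open>O(\<rho>)\<close> along them. Every term of the second difference of the energy other than the flat one
  \<open>2 |\<eta>'|\<^sup>2\<close> then carries a factor \<open>\<rho>\<close>: the mixed term \<open>|\<eta>| |\<eta>'| |\<gamma>'|\<close> because \<open>|\<gamma>'|\<close> has size \<open>\<rho>\<close> in
  the mean, which is used through \<open>2 \<rho> |\<eta>'| |\<eta>| |\<gamma>'| \<le> \<rho>\<^sup>2 |\<eta>'|\<^sup>2 + |\<eta>|\<^sup>2 |\<gamma>'|\<^sup>2\<close>.\<close>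

lemma energy_second_difference:
  assumes g: "C1_curve \<gamma> u" and e: "C1_curve \<eta> w" and \<rho>: "0 < \<rho>" "\<rho> \<le> R"
    and mid: "\<And>s. s \<in> {0..1} \<Longrightarrow> \<gamma> s \<in> cball z \<rho>"
    and plus: "\<And>s. s \<in> {0..1} \<Longrightarrow> \<gamma> s + \<eta> s \<in> cball z \<rho>"
    and minus: "\<And>s. s \<in> {0..1} \<Longrightarrow> \<gamma> s - \<eta> s \<in> cball z \<rho>"
    and u: "integral {0..1} (\<lambda>s. (norm (u s))\<^sup>2) \<le> \<rho>\<^sup>2"
    and H: "\<And>s. s \<in> {0..1} \<Longrightarrow> (norm (\<eta> s))\<^sup>2 \<le> H"
  shows "\<bar>energy M (\<lambda>s. \<gamma> s + \<eta> s) (\<lambda>s. u s + w s) + energy M (\<lambda>s. \<gamma> s - \<eta> s) (\<lambda>s. u s - w s)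
      - 2 * energy M \<gamma> u - 2 * integral {0..1} (\<lambda>s. w s \<bullet> (M z *v w s))\<bar>
    \<le> K_energy * \<rho> * (integral {0..1} (\<lambda>s. (norm (w s))\<^sup>2) + H)"
proof -
  have gp: "C1_curve (\<lambda>s. \<gamma> s + \<eta> s) (\<lambda>s. u s + w s)"
    by (rule C1_curve_add[OF g e])
  have gm: "C1_curve (\<lambda>s. \<gamma> s - \<eta> s) (\<lambda>s. u s - w s)"
    using C1_curve_add[OF g C1_curve_scale[OF e, of "-1"]] by simp
  have w_cont: "continuous_on {0..1} w"
    by (rule C1_curve_deriv_continuous_on[OF e])
  have wi: "(\<lambda>s. w s \<bullet> (M z *v w s)) integrable_on {0..1}"
    by (intro integrable_continuous_real continuous_intros continuous_on_matrix_vector_mult w_cont)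
  define f where "f s = (u s + w s) \<bullet> (M (\<gamma> s + \<eta> s) *v (u s + w s))
      + (u s - w s) \<bullet> (M (\<gamma> s - \<eta> s) *v (u s - w s)) - 2 * (u s \<bullet> (M (\<gamma> s) *v u s)) - 2 * (w s \<bullet> (M z *v w s))" for s
  define k where "k s = (4 * A * \<rho>) * (norm (w s))\<^sup>2 + (A + 2 * A / \<rho>) * H * (norm (u s))\<^sup>2" for s
  let ?W = "integral {0..1} (\<lambda>s. (norm (w s))\<^sup>2)"
  let ?U = "integral {0..1} (\<lambda>s. (norm (u s))\<^sup>2)"
  have f: "(f has_integral (energy M (\<lambda>s. \<gamma> s + \<eta> s) (\<lambda>s. u s + w s) + energy M (\<lambda>s. \<gamma> s - \<eta> s) (\<lambda>s. u s - w s)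
      - 2 * energy M \<gamma> u - 2 * integral {0..1} (\<lambda>s. w s \<bullet> (M z *v w s)))) {0..1}"
    unfolding f_def energy_def
    by (intro has_integral_add has_integral_diff has_integral_mult_right integrable_integral wi
        integrable_energy_density[OF gp] integrable_energy_density[OF gm] integrable_energy_density[OF g])
  have k: "(k has_integral ((4 * A * \<rho>) * ?W + (A + 2 * A / \<rho>) * H * ?U)) {0..1}"
    unfolding k_def
    by (intro has_integral_add has_integral_mult_right integrable_integral
        integrable_norm_square[OF g] integrable_norm_square[OF e])
  have z: "z \<in> cball z R"
    using R_pos by simp
  have H0: "0 \<le> H"
    using H[of 0] by (auto intro: order_trans[OF zero_le_power2])
  have "norm (f s) \<le> k s" if s: "s \<in> {0..1}" for s
  proof -
    let ?c = "\<gamma> s" and ?h = "\<eta> s" and ?v = "u s" and ?w = "w s"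
    let ?P = "M (?c + ?h)" and ?N = "M (?c - ?h)"
    have sub: "cball z \<rho> \<subseteq> cball z R"
      using \<rho> by auto
    have cR: "?c \<in> cball z R" "?c + ?h \<in> cball z R" "?c - ?h \<in> cball z R"
      using mid[OF s] plus[OF s] minus[OF s] sub by blast+
    have triangle: "\<bar>a + 2 * b + (c + d)\<bar> \<le> a' + 2 * b' + 2 * c'"
      if "\<bar>a\<bar> \<le> a'" "\<bar>b\<bar> \<le> b'" "\<bar>c\<bar> \<le> c'" "\<bar>d\<bar> \<le> c'" for a b c d a' b' c' :: real
      using that by linarith
    have "f s = ?v \<bullet> ((?P + ?N - 2 *\<^sub>R M ?c) *v ?v) + 2 * (?w \<bullet> (?P *v ?v) - ?w \<bullet> (?N *v ?v))
        + ((?w \<bullet> (?P *v ?w) - ?w \<bullet> (M z *v ?w)) + (?w \<bullet> (?N *v ?w) - ?w \<bullet> (M z *v ?w)))"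
      unfolding f_def quadratic_form_add[OF M_pos] quadratic_form_diff[OF M_pos]
      by (simp add: matrix_vector_mult_add_rdistrib matrix_vector_mult_diff_rdistrib
          scaleR_matrix_vector_assoc[symmetric] inner_simps)
    moreover have "\<bar>?v \<bullet> ((?P + ?N - 2 *\<^sub>R M ?c) *v ?v)\<bar> \<le> A * (norm ?h)\<^sup>2 * (norm ?v)\<^sup>2"
    proof -
      have "\<bar>?v \<bullet> ((?P + ?N - 2 *\<^sub>R M ?c) *v ?v)\<bar> \<le> norm (?P + ?N - 2 *\<^sub>R M ?c) * norm ?v * norm ?v"
        by (rule inner_matrix_le)
      also have "\<dots> \<le> A * (norm ?h)\<^sup>2 * norm ?v * norm ?v"
        using M_second_difference[OF cR] by (intro mult_right_mono) auto
      finally show ?thesis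
        by (simp add: power2_eq_square mult_ac)
    qed
    moreover have "\<bar>?w \<bullet> (?P *v ?v) - ?w \<bullet> (?N *v ?v)\<bar> \<le> A * (2 * norm ?h) * norm ?w * norm ?v"
    proof -
      have "norm (?P - ?N) \<le> A * norm ((?c + ?h) - (?c - ?h))"
        by (rule M_Lipschitz[OF cR(2,3)])
      also have "(?c + ?h) - (?c - ?h) = 2 *\<^sub>R ?h"
        by (simp add: scaleR_2)
      finally have "norm (?P - ?N) * norm ?w * norm ?v \<le> A * (2 * norm ?h) * norm ?w * norm ?v"
        by (intro mult_right_mono) auto
      with inner_matrix_diff_le[of ?w ?P ?v ?N] show ?thesis
        by linarith
    qed
    moreover have "\<bar>?w \<bullet> (M x *v ?w) - ?w \<bullet> (M z *v ?w)\<bar> \<le> A * \<rho> * (norm ?w)\<^sup>2" if x: "x \<in> cball z \<rho>" for x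
    proof -
      have "norm (M x - M z) \<le> A * norm (x - z)"
        using x sub by (intro M_Lipschitz z) auto
      also have "\<dots> \<le> A * \<rho>"
        using x A_ge_1 by (intro mult_left_mono) (auto simp: dist_norm norm_minus_commute)
      finally have "norm (M x - M z) * norm ?w * norm ?w \<le> A * \<rho> * norm ?w * norm ?w"
        by (intro mult_right_mono) auto
      with inner_matrix_diff_le[of ?w "M x" ?w "M z"] show ?thesis
        by (simp add: power2_eq_square mult_ac)
    qed
    note this[OF plus[OF s]] this[OF minus[OF s]]
    ultimately have "\<bar>f s\<bar> \<le> A * (norm ?h)\<^sup>2 * (norm ?v)\<^sup>2 + 2 * (A * (2 * norm ?h) * norm ?w * norm ?v)
        + 2 * (A * \<rho> * (norm ?w)\<^sup>2)"
      by (simp only: triangle)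
    also have "2 * (A * (2 * norm ?h) * norm ?w * norm ?v) \<le>
        (2 * A / \<rho>) * (\<rho>\<^sup>2 * (norm ?w)\<^sup>2 + (norm ?h)\<^sup>2 * (norm ?v)\<^sup>2)"
    proof -
      have "2 * (\<rho> * norm ?w) * (norm ?h * norm ?v) \<le> \<rho>\<^sup>2 * (norm ?w)\<^sup>2 + (norm ?h)\<^sup>2 * (norm ?v)\<^sup>2"
        using sum_squares_bound[of "\<rho> * norm ?w" "norm ?h * norm ?v"] by (simp add: power_mult_distrib)
      then have "(2 * A / \<rho>) * (2 * (\<rho> * norm ?w) * (norm ?h * norm ?v)) \<le>
        (2 * A / \<rho>) * (\<rho>\<^sup>2 * (norm ?w)\<^sup>2 + (norm ?h)\<^sup>2 * (norm ?v)\<^sup>2)"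
        using A_ge_1 \<rho> by (intro mult_left_mono) auto
      then show ?thesis
        using \<rho> by (simp add: mult_ac)
    qed
    also have "A * (norm ?h)\<^sup>2 * (norm ?v)\<^sup>2 + (2 * A / \<rho>) * (\<rho>\<^sup>2 * (norm ?w)\<^sup>2 + (norm ?h)\<^sup>2 * (norm ?v)\<^sup>2)
        + 2 * (A * \<rho> * (norm ?w)\<^sup>2) = (4 * A * \<rho>) * (norm ?w)\<^sup>2 + (A + 2 * A / \<rho>) * (norm ?h)\<^sup>2 * (norm ?v)\<^sup>2"
      using \<rho> by (simp add: field_simps power2_eq_square)
    also have "\<dots> \<le> k s"
      unfolding k_def using H[OF s] A_ge_1 \<rho>
      by (intro add_left_mono mult_right_mono mult_left_mono) auto
    finally show ?thesis
      by simp
  qed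
  then have "norm (integral {0..1} f) \<le> integral {0..1} k"
    using f k by (intro integral_norm_bound_integral) (auto simp: has_integral_integrable)
  also have "\<dots> = (4 * A * \<rho>) * ?W + (A + 2 * A / \<rho>) * H * ?U"
    using k by (rule integral_unique)
  also have "\<dots> \<le> (4 * A * \<rho>) * ?W + (A + 2 * A / \<rho>) * H * \<rho>\<^sup>2"
    using u A_ge_1 \<rho> H0 by (intro add_left_mono mult_left_mono mult_nonneg_nonneg) auto
  also have "\<dots> = A * \<rho> * (4 * ?W + (\<rho> + 2) * H)"
    using \<rho> by (simp add: field_simps power2_eq_square)
  also have "\<dots> \<le> A * \<rho> * ((R + 4) * ?W + (R + 4) * H)"
    using \<rho> A_ge_1 H0 R_pos integral_nonneg[OF integrable_norm_square[OF e]]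
    by (intro mult_left_mono add_mono mult_right_mono) auto
  finally show ?thesis
    using integral_unique[OF f] by (simp add: K_energy_def algebra_simps)
qed

text \<open>Near-minimisers between points of the ball of radius \<open>r\<close>, moved by a field of length at most
  \<open>r\<close>, remain in the ball of radius \<open>reach * r\<close>; the factor 5 leaves room for the defect of
  minimality beside the energy of a segment of length \<open>2 * r\<close>.\<close>

definition reach :: real where
  "reach = sqrt (5 * A / \<alpha>) + 2"

definition K_second :: real where
  "K_second = K_energy * (6 * A / \<alpha> + 3)"

lemma K_energy_pos: "0 < K_energy" and K_second_pos: "0 < K_second" and reach_ge: "2 \<le> reach"
  using A_ge_1 R_pos \<alpha>_pos by (auto simp: K_energy_def K_second_def reach_def intro!: mult_pos_pos add_pos_pos)

lemma near_minimiser_scale: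
  assumes r: "0 < r" "reach * r \<le> R / 2" and xy: "x \<in> cball z r" "y \<in> cball z r"
    and eps: "0 < \<epsilon>" "\<epsilon> \<le> A * r\<^sup>2"
  obtains \<gamma> u where "C1_curve \<gamma> u" "\<gamma> 0 = x" "\<gamma> 1 = y" "energy M \<gamma> u \<le> D2 x y + \<epsilon>"
    "integral {0..1} (\<lambda>s. (norm (u s))\<^sup>2) \<le> (reach * r)\<^sup>2" "\<And>s. s \<in> {0..1} \<Longrightarrow> norm (\<gamma> s - z) \<le> (reach - 1) * r"
proof -
  define G where "G = sqrt (5 * A / \<alpha>) * r"
  have gr: "reach * r = G + 2 * r"
    by (simp add: reach_def G_def algebra_simps)
  have G: "0 \<le> G" "\<alpha> * G\<^sup>2 = 5 * A * r\<^sup>2" "G < R / 2"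
    using A_ge_1 \<alpha>_pos r gr by (auto simp: G_def power_mult_distrib)
  have rR: "r \<le> R / 2"
    using gr r G(1) by linarith
  have x: "x \<in> cball z (R / 2)" and y: "y \<in> cball z R"
    using xy rR R_pos by auto
  have "norm (y - x) \<le> 2 * r"
    using xy norm_triangle_ineq4[of "y - z" "x - z"] by (simp add: dist_norm norm_minus_commute)
  then have "A * (norm (y - x))\<^sup>2 \<le> A * (2 * r)\<^sup>2"
    using A_ge_1 by (intro mult_left_mono power_mono) auto
  then have "A * (norm (y - x))\<^sup>2 + \<epsilon> \<le> \<alpha> * G\<^sup>2"
    using eps G(2) by (simp add: power_mult_distrib)
  from near_minimiser[OF x y eps(1) this G(1,3)] obtain \<gamma> u where
    c: "C1_curve \<gamma> u" "\<gamma> 0 = x" "\<gamma> 1 = y" "energy M \<gamma> u \<le> D2 x y + \<epsilon>"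
    "integral {0..1} (\<lambda>s. (norm (u s))\<^sup>2) \<le> G\<^sup>2" "\<And>s. s \<in> {0..1} \<Longrightarrow> norm (\<gamma> s - x) \<le> G"
    by blast
  have "G\<^sup>2 \<le> (reach * r)\<^sup>2"
    using G r gr by (intro power_mono) auto
  moreover have "norm (\<gamma> s - z) \<le> (reach - 1) * r" if "s \<in> {0..1}" for s
    using c(6)[OF that] xy gr norm_triangle_ineq[of "\<gamma> s - x" "x - z"]
    by (simp add: dist_norm norm_minus_commute algebra_simps)
  ultimately show ?thesis
    using that[OF c(1-4) order_trans[OF c(5)]] by blast
qed

lemma half_difference_in_cball:
  fixes x d :: "real^'n"
  assumes "x + d \<in> cball z r" "x - d \<in> cball z r"
  shows "norm d \<le> r" "x \<in> cball z r"
proof -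
  have "2 *\<^sub>R d = (x + d - z) - (x - d - z)"
    by (simp add: scaleR_2)
  then have "2 * norm d = norm ((x + d - z) - (x - d - z))"
    by (metis norm_scaleR abs_numeral)
  also have "\<dots> \<le> 2 * r"
    using norm_triangle_ineq4[of "x + d - z" "x - d - z"] assms
    by (simp add: dist_norm norm_minus_commute)
  finally show "norm d \<le> r"
    by simp
  have "x = (1 / 2) *\<^sub>R (x + d) + (1 / 2) *\<^sub>R (x - d)"
    by (simp add: scaleR_right_diff_distrib scaleR_right_distrib flip: scaleR_left_distrib)
  also have "\<dots> \<in> cball z r"
    by (rule convexD[OF convex_cball assms]) auto
  finally show "x \<in> cball z r" .
qed

lemma norm_diff_square_le: "(norm (a - b :: real^'n))\<^sup>2 \<le> 2 * ((norm a)\<^sup>2 + (norm b)\<^sup>2)"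
proof -
  have "(norm (a - b))\<^sup>2 \<le> (norm a + norm b)\<^sup>2"
    by (intro power_mono norm_triangle_ineq4) auto
  also have "\<dots> \<le> 2 * ((norm a)\<^sup>2 + (norm b)\<^sup>2)"
    using sum_squares_bound[of "norm a" "norm b"] by (simp add: power2_sum)
  finally show ?thesis .
qed

text \<open>The midpoint of two near-minimisers is a competitor for the midpoints of their ends, and a
  near-minimiser moved by plus and minus a linear field yields two competitors.  As
  \<open>energy_second_difference\<close> is an equality up to \<open>O(\<rho>)\<close>, the squared distance has the second
  differences of the flat squared distance \<open>|y - x|\<^sup>2\<close>, frozen at \<open>z\<close>, up to \<open>O(\<rho>)\<close>.\<close>

lemma D2_second_difference_upper:
  assumes r: "0 < r" "reach * r \<le> R / 2"
    and x: "x + \<delta> \<in> cball z r" "x - \<delta> \<in> cball z r" and y: "y + \<eta> \<in> cball z r" "y - \<eta> \<in> cball z r"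
  shows "D2 (x + \<delta>) (y + \<eta>) + D2 (x - \<delta>) (y - \<eta>) - 2 * D2 x y
    \<le> 2 * ((\<eta> - \<delta>) \<bullet> (M z *v (\<eta> - \<delta>))) + K_second * (reach * r) * ((norm \<delta>)\<^sup>2 + (norm \<eta>)\<^sup>2)"
proof (rule field_le_epsilon)
  fix e :: real
  assume "0 < e"
  define \<epsilon> where "\<epsilon> = min (e / 2) (A * r\<^sup>2)"
  have eps: "0 < \<epsilon>" "\<epsilon> \<le> A * r\<^sup>2" "2 * \<epsilon> \<le> e"
    using \<open>0 < e\<close> A_ge_1 r by (auto simp: \<epsilon>_def)
  note hx = half_difference_in_cball[OF x] and hy = half_difference_in_cball[OF y]
  from near_minimiser_scale[OF r hx(2) hy(2) eps(1,2)] obtain \<gamma> u where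
    c: "C1_curve \<gamma> u" "\<gamma> 0 = x" "\<gamma> 1 = y" "energy M \<gamma> u \<le> D2 x y + \<epsilon>"
    "integral {0..1} (\<lambda>s. (norm (u s))\<^sup>2) \<le> (reach * r)\<^sup>2" "\<And>s. s \<in> {0..1} \<Longrightarrow> norm (\<gamma> s - z) \<le> (reach - 1) * r"
    by blast
  define \<xi> where "\<xi> s = \<delta> + s *\<^sub>R (\<eta> - \<delta>)" for s
  define w where "w = \<eta> - \<delta>"
  have l: "C1_curve \<xi> (\<lambda>s. w)"
    unfolding \<xi>_def w_def by (rule C1_curve_line)
  define m where "m = max (norm \<delta>) (norm \<eta>)"
  have lm: "norm (\<xi> s) \<le> m" if s: "s \<in> {0..1}" for s
  proof -
    have "\<xi> s = (1 - s) *\<^sub>R \<delta> + s *\<^sub>R \<eta>"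
      by (simp add: \<xi>_def algebra_simps)
    then have "norm (\<xi> s) \<le> (1 - s) * norm \<delta> + s * norm \<eta>"
      using s norm_triangle_ineq[of "(1 - s) *\<^sub>R \<delta>" "s *\<^sub>R \<eta>"] by simp
    also have "\<dots> \<le> (1 - s) * m + s * m"
      using s by (intro add_mono mult_left_mono) (auto simp: m_def)
    finally show ?thesis
      by (simp add: algebra_simps)
  qed
  have mr: "m \<le> r"
    using hx(1) hy(1) by (simp add: m_def)
  have H: "(norm (\<xi> s))\<^sup>2 \<le> (norm \<delta>)\<^sup>2 + (norm \<eta>)\<^sup>2" if s: "s \<in> {0..1}" for s
  proof -
    have "(norm (\<xi> s))\<^sup>2 \<le> m\<^sup>2"
      using lm[OF s] by (intro power_mono) auto
    also have "\<dots> \<le> (norm \<delta>)\<^sup>2 + (norm \<eta>)\<^sup>2"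
      by (auto simp: m_def max_def)
    finally show ?thesis .
  qed
  have gr: "0 < reach * r" "reach * r \<le> R" "(reach - 1) * r + r \<le> reach * r"
    using r reach_ge R_pos by (auto simp: algebra_simps)
  have 1: "\<gamma> s \<in> cball z (reach * r)" if "s \<in> {0..1}" for s
    using c(6)[OF that] gr r by (simp add: dist_norm norm_minus_commute)
  have 2: "\<gamma> s + \<xi> s \<in> cball z (reach * r)" if "s \<in> {0..1}" for s
    using c(6)[OF that] gr lm[OF that] mr norm_triangle_ineq[of "\<gamma> s - z" "\<xi> s"]
    by (simp add: dist_norm norm_minus_commute algebra_simps)
  have 3: "\<gamma> s - \<xi> s \<in> cball z (reach * r)" if "s \<in> {0..1}" for s
    using c(6)[OF that] gr lm[OF that] mr norm_triangle_ineq4[of "\<gamma> s - z" "\<xi> s"]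
    by (simp add: dist_norm norm_minus_commute algebra_simps)
  have cp: "C1_curve (\<lambda>s. \<gamma> s + \<xi> s) (\<lambda>s. u s + w)"
    by (rule C1_curve_add[OF c(1) l])
  have cm: "C1_curve (\<lambda>s. \<gamma> s - \<xi> s) (\<lambda>s. u s - w)"
    using C1_curve_add[OF c(1) C1_curve_scale[OF l, of "-1"]] by simp
  have "D2 (x + \<delta>) (y + \<eta>) \<le> energy M (\<lambda>s. \<gamma> s + \<xi> s) (\<lambda>s. u s + w)"
    using c by (intro riem_dist_square_le_energy[OF cp]) (auto simp: \<xi>_def)
  moreover have "D2 (x - \<delta>) (y - \<eta>) \<le> energy M (\<lambda>s. \<gamma> s - \<xi> s) (\<lambda>s. u s - w)"
    using c by (intro riem_dist_square_le_energy[OF cm]) (auto simp: \<xi>_def)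
  moreover note energy_second_difference[OF c(1) l gr(1,2) 1 2 3 c(5) H]
  ultimately have "D2 (x + \<delta>) (y + \<eta>) + D2 (x - \<delta>) (y - \<eta>) - 2 * D2 x y \<le> 2 * (w \<bullet> (M z *v w))
      + K_energy * (reach * r) * ((norm w)\<^sup>2 + ((norm \<delta>)\<^sup>2 + (norm \<eta>)\<^sup>2)) + 2 * \<epsilon>"
    using c(4) by simp
  also have "\<dots> \<le> 2 * (w \<bullet> (M z *v w)) + K_energy * (reach * r) * (2 * ((norm \<delta>)\<^sup>2 + (norm \<eta>)\<^sup>2) + ((norm \<delta>)\<^sup>2 + (norm \<eta>)\<^sup>2)) + e"
    using K_energy_pos gr eps norm_diff_square_le[of \<eta> \<delta>]
    by (intro add_mono mult_left_mono) (auto simp: w_def)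
  also have "K_energy * (reach * r) * (2 * ((norm \<delta>)\<^sup>2 + (norm \<eta>)\<^sup>2) + ((norm \<delta>)\<^sup>2 + (norm \<eta>)\<^sup>2))
      = K_energy * 3 * ((reach * r) * ((norm \<delta>)\<^sup>2 + (norm \<eta>)\<^sup>2))"
    by (simp add: algebra_simps)
  also have "\<dots> \<le> K_second * ((reach * r) * ((norm \<delta>)\<^sup>2 + (norm \<eta>)\<^sup>2))"
    using K_energy_pos A_ge_1 \<alpha>_pos gr unfolding K_second_def by (intro mult_right_mono mult_left_mono) auto
  finally show "D2 (x + \<delta>) (y + \<eta>) + D2 (x - \<delta>) (y - \<eta>) - 2 * D2 x y
    \<le> 2 * ((\<eta> - \<delta>) \<bullet> (M z *v (\<eta> - \<delta>))) + K_second * (reach * r) * ((norm \<delta>)\<^sup>2 + (norm \<eta>)\<^sup>2) + e"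
    by (simp add: w_def mult.assoc)
qed

text \<open>Jensen's inequality for a quadratic form: among the fields with given mean, the constant one has
  the least energy.\<close>

lemma integral_quadratic_form_ge:
  assumes B: "sym_pos_def B" and w: "continuous_on {0..1} w" "(w has_integral v) {0..1::real}"
  shows "v \<bullet> (B *v v) \<le> integral {0..1} (\<lambda>s. w s \<bullet> (B *v w s))"
proof -
  have i: "(\<lambda>s. w s \<bullet> (B *v w s)) integrable_on {0..1}"
    by (intro integrable_continuous_real continuous_intros continuous_on_matrix_vector_mult w)
  have "((\<lambda>s. v \<bullet> (B *v w s)) has_integral v \<bullet> (B *v v)) {0..1}"
    using has_integral_linear[OF w(2)
        bounded_linear_compose[OF bounded_linear_inner_right matrix_vector_mul_bounded_linear]]
    by (simp add: o_def)
  then have "((\<lambda>s. w s \<bullet> (B *v w s) - 2 * (v \<bullet> (B *v w s)) + v \<bullet> (B *v v)) has_integral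
      (integral {0..1} (\<lambda>s. w s \<bullet> (B *v w s)) - 2 * (v \<bullet> (B *v v)) + (1 - 0) *\<^sub>R (v \<bullet> (B *v v)))) {0..1}"
    by (intro has_integral_add has_integral_diff has_integral_mult_right integrable_integral i)
       (use has_integral_const_real[of _ 0 1] in auto)
  moreover have "0 \<le> w s \<bullet> (B *v w s) - 2 * (v \<bullet> (B *v w s)) + v \<bullet> (B *v v)" for s
    using sym_pos_def_nonneg[OF B, of "w s - v"] by (simp add: quadratic_form_diff[OF B])
  ultimately have "0 \<le> integral {0..1} (\<lambda>s. w s \<bullet> (B *v w s)) - 2 * (v \<bullet> (B *v v)) + (1 - 0) *\<^sub>R (v \<bullet> (B *v v))"
    by (rule has_integral_nonneg) 
  then show ?thesis
    by simp
qed

lemma D2_second_difference_lower: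
  assumes r: "0 < r" "reach * r \<le> R / 2" "K_second * (reach * r) \<le> \<alpha>"
    and x: "x + \<delta> \<in> cball z r" "x - \<delta> \<in> cball z r" and y: "y + \<eta> \<in> cball z r" "y - \<eta> \<in> cball z r"
  shows "2 * ((\<eta> - \<delta>) \<bullet> (M z *v (\<eta> - \<delta>))) - K_second * (reach * r) * ((norm \<delta>)\<^sup>2 + (norm \<eta>)\<^sup>2)
    \<le> D2 (x + \<delta>) (y + \<eta>) + D2 (x - \<delta>) (y - \<eta>) - 2 * D2 x y"
proof (rule field_le_epsilon)
  fix e :: real
  assume "0 < e"
  define \<epsilon> where "\<epsilon> = min (e / 2) (A * r\<^sup>2)"
  have eps: "0 < \<epsilon>" "\<epsilon> \<le> A * r\<^sup>2" "2 * \<epsilon> \<le> e"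
    using \<open>0 < e\<close> A_ge_1 r by (auto simp: \<epsilon>_def)
  from near_minimiser_scale[OF r(1,2) x(1) y(1) eps(1,2)] obtain \<gamma>1 u1 where
    c1: "C1_curve \<gamma>1 u1" "\<gamma>1 0 = x + \<delta>" "\<gamma>1 1 = y + \<eta>" "energy M \<gamma>1 u1 \<le> D2 (x + \<delta>) (y + \<eta>) + \<epsilon>"
    "integral {0..1} (\<lambda>s. (norm (u1 s))\<^sup>2) \<le> (reach * r)\<^sup>2" "\<And>s. s \<in> {0..1} \<Longrightarrow> norm (\<gamma>1 s - z) \<le> (reach - 1) * r"
    by blast
  from near_minimiser_scale[OF r(1,2) x(2) y(2) eps(1,2)] obtain \<gamma>2 u2 where
    c2: "C1_curve \<gamma>2 u2" "\<gamma>2 0 = x - \<delta>" "\<gamma>2 1 = y - \<eta>" "energy M \<gamma>2 u2 \<le> D2 (x - \<delta>) (y - \<eta>) + \<epsilon>"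
    "integral {0..1} (\<lambda>s. (norm (u2 s))\<^sup>2) \<le> (reach * r)\<^sup>2" "\<And>s. s \<in> {0..1} \<Longrightarrow> norm (\<gamma>2 s - z) \<le> (reach - 1) * r"
    by blast
  define \<gamma> where "\<gamma> s = (1 / 2) *\<^sub>R \<gamma>1 s + (1 / 2) *\<^sub>R \<gamma>2 s" for s
  define u where "u s = (1 / 2) *\<^sub>R u1 s + (1 / 2) *\<^sub>R u2 s" for s
  define \<xi> where "\<xi> s = (1 / 2) *\<^sub>R \<gamma>1 s + (- 1 / 2) *\<^sub>R \<gamma>2 s" for s
  define w where "w s = (1 / 2) *\<^sub>R u1 s + (- 1 / 2) *\<^sub>R u2 s" for s
  have c: "C1_curve \<gamma> u" and l: "C1_curve \<xi> w"
    unfolding \<gamma>_def u_def \<xi>_def w_def by (intro C1_curve_add C1_curve_scale c1 c2)+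
  have half: "(1 / 2) *\<^sub>R a + (1 / 2) *\<^sub>R b + ((1 / 2) *\<^sub>R a + (- 1 / 2) *\<^sub>R b) = a"
    "(1 / 2) *\<^sub>R a + (1 / 2) *\<^sub>R b - ((1 / 2) *\<^sub>R a + (- 1 / 2) *\<^sub>R b) = b" for a b :: "real^'n"
    by (vector, simp)+
  have sums: "\<gamma> s + \<xi> s = \<gamma>1 s" "\<gamma> s - \<xi> s = \<gamma>2 s" "u s + w s = u1 s" "u s - w s = u2 s" for s
    unfolding \<gamma>_def \<xi>_def u_def w_def by (rule half)+
  have ends: "\<gamma> 0 = x" "\<gamma> 1 = y" "\<xi> 0 = \<delta>" "\<xi> 1 = \<eta>"
    unfolding \<gamma>_def \<xi>_def c1(2,3) c2(2,3) by (vector, simp add: field_simps)+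
  have gr: "0 < reach * r" "reach * r \<le> R" "(reach - 1) * r + r \<le> reach * r"
    using r reach_ge R_pos by (auto simp: algebra_simps)
  have 2: "\<gamma> s + \<xi> s \<in> cball z (reach * r)" if "s \<in> {0..1}" for s
    using c1(6)[OF that] gr r by (simp add: sums dist_norm norm_minus_commute)
  have 3: "\<gamma> s - \<xi> s \<in> cball z (reach * r)" if "s \<in> {0..1}" for s
    using c2(6)[OF that] gr r by (simp add: sums dist_norm norm_minus_commute)
  have 1: "\<gamma> s \<in> cball z (reach * r)" if "s \<in> {0..1}" for s
    using half_difference_in_cball(2)[OF 2[OF that] 3[OF that]] .
  let ?W = "integral {0..1} (\<lambda>s. (norm (w s))\<^sup>2)"
  have u: "integral {0..1} (\<lambda>s. (norm (u s))\<^sup>2) \<le> (reach * r)\<^sup>2"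
  proof -
    have "(norm (u s))\<^sup>2 \<le> (1 / 2) * (norm (u1 s))\<^sup>2 + (1 / 2) * (norm (u2 s))\<^sup>2" for s
      using norm_diff_square_le[of "(1 / 2) *\<^sub>R u1 s" "- (1 / 2) *\<^sub>R u2 s"]
      by (simp add: u_def power_divide)
    then have "integral {0..1} (\<lambda>s. (norm (u s))\<^sup>2) \<le>
        integral {0..1} (\<lambda>s. (1 / 2) * (norm (u1 s))\<^sup>2 + (1 / 2) * (norm (u2 s))\<^sup>2)"
      by (intro integral_le integrable_add integrable_on_mult_right integrable_norm_square[OF c]
          integrable_norm_square[OF c1(1)] integrable_norm_square[OF c2(1)]) auto
    also have "\<dots> = (1 / 2) * integral {0..1} (\<lambda>s. (norm (u1 s))\<^sup>2) + (1 / 2) * integral {0..1} (\<lambda>s. (norm (u2 s))\<^sup>2)"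
      by (intro integral_unique has_integral_add has_integral_mult_right integrable_integral
          integrable_norm_square[OF c1(1)] integrable_norm_square[OF c2(1)])
    finally show ?thesis
      using c1(5) c2(5) by linarith
  qed
  have H: "(norm (\<xi> s))\<^sup>2 \<le> 2 * (norm \<delta>)\<^sup>2 + 2 * ?W" if s: "s \<in> {0..1}" for s
  proof -
    have "(norm (\<xi> s - \<xi> 0))\<^sup>2 \<le> (s - 0) * integral {0..s} (\<lambda>s. (norm (w s))\<^sup>2)"
      using s by (intro C1_curve_displacement[OF l]) auto
    also have "\<dots> \<le> 1 * ?W"
      using s by (intro mult_mono integral_subset_le integral_nonneg integrable_norm_square[OF l]
          integrable_on_subinterval[OF integrable_norm_square[OF l]]) auto
    finally show ?thesis
      using norm_diff_square_le[of "\<xi> 0" "\<xi> 0 - \<xi> s"] ends(3) by (simp add: norm_minus_commute)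
  qed
  let ?J = "integral {0..1} (\<lambda>s. w s \<bullet> (M z *v w s))"
  let ?Y = "(\<eta> - \<delta>) \<bullet> (M z *v (\<eta> - \<delta>))"
  have z: "z \<in> cball z R"
    using R_pos by simp
  have w_cont: "continuous_on {0..1} w"
    by (rule C1_curve_deriv_continuous_on[OF l])
  have YJ: "?Y \<le> ?J"
    using C1_curve_has_integral[OF l, of 0 1] ends
    by (intro integral_quadratic_form_ge[OF M_pos w_cont]) auto
  have WJ: "\<alpha> * ?W \<le> ?J"
  proof -
    have "\<alpha> * ?W = integral {0..1} (\<lambda>s. \<alpha> * (norm (w s))\<^sup>2)"
      by simp
    also have "\<dots> \<le> ?J"
      using M_lower[OF z]
      by (intro integral_le integrable_on_mult_right integrable_norm_square[OF l] integrable_continuous_real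
          continuous_intros continuous_on_matrix_vector_mult w_cont) auto
    finally show ?thesis .
  qed
  have Y: "?Y \<le> 2 * A * ((norm \<delta>)\<^sup>2 + (norm \<eta>)\<^sup>2)"
    using M_upper_square[OF z, of "\<eta> - \<delta>"] mult_left_mono[OF norm_diff_square_le[of \<eta> \<delta>], of A] A_ge_1
    by (simp add: algebra_simps)
  have E: "2 * ?J - K_energy * (reach * r) * (?W + (2 * (norm \<delta>)\<^sup>2 + 2 * ?W))
      \<le> energy M \<gamma>1 u1 + energy M \<gamma>2 u2 - 2 * energy M \<gamma> u"
    using energy_second_difference[OF c l gr(1,2) 1 2 3 u H] by (simp add: sums abs_le_iff)
  have D: "D2 x y \<le> energy M \<gamma> u"
    by (rule riem_dist_square_le_energy[OF c ends(1,2)])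
  have coef: "3 * (K_energy * (reach * r)) / \<alpha> \<le> 2"
  proof -
    have "K_energy * 3 \<le> K_second"
      using K_energy_pos A_ge_1 \<alpha>_pos unfolding K_second_def by (intro mult_left_mono) auto
    then have "K_energy * 3 * (reach * r) \<le> K_second * (reach * r)"
      using gr by (intro mult_right_mono) auto
    then have "3 * (K_energy * (reach * r)) \<le> 2 * \<alpha>"
      using r(3) \<alpha>_pos by simp
    then show ?thesis
      using \<alpha>_pos by (simp add: field_simps)
  qed
  define k where "k = K_energy * (reach * r)"
  have k: "0 \<le> k" "0 \<le> 2 - 3 * k / \<alpha>"
    using K_energy_pos gr coef by (auto simp: k_def)
  have "k * (3 * ?W) \<le> (3 * k / \<alpha>) * ?J"
    using mult_left_mono[OF WJ, of "3 * k / \<alpha>"] k \<alpha>_pos by (simp add: field_simps)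
  moreover have "(2 - 3 * k / \<alpha>) * ?Y \<le> (2 - 3 * k / \<alpha>) * ?J"
    by (intro mult_left_mono YJ k)
  moreover have "(3 * k / \<alpha>) * ?Y \<le> (3 * k / \<alpha>) * (2 * A * ((norm \<delta>)\<^sup>2 + (norm \<eta>)\<^sup>2))"
    using k \<alpha>_pos by (intro mult_left_mono Y) auto
  moreover have "k * (2 * (norm \<delta>)\<^sup>2) \<le> 3 * k * ((norm \<delta>)\<^sup>2 + (norm \<eta>)\<^sup>2)"
    using k mult_nonneg_nonneg[of k "(norm \<delta>)\<^sup>2"] mult_nonneg_nonneg[of k "(norm \<eta>)\<^sup>2"]
    by (simp add: algebra_simps)
  moreover have "K_second * (reach * r) * ((norm \<delta>)\<^sup>2 + (norm \<eta>)\<^sup>2)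
      = (3 * k / \<alpha>) * (2 * A * ((norm \<delta>)\<^sup>2 + (norm \<eta>)\<^sup>2)) + 3 * k * ((norm \<delta>)\<^sup>2 + (norm \<eta>)\<^sup>2)"
    using \<alpha>_pos by (simp add: K_second_def k_def field_simps)
  ultimately show "2 * ?Y - K_second * (reach * r) * ((norm \<delta>)\<^sup>2 + (norm \<eta>)\<^sup>2)
    \<le> D2 (x + \<delta>) (y + \<eta>) + D2 (x - \<delta>) (y - \<eta>) - 2 * D2 x y + e"
    using E D c1(4) c2(4) eps(3) unfolding k_def[symmetric] by (simp add: algebra_simps)
qed

lemma midpoint_decomposition:
  fixes a b :: "real^'n"
  shows "(1 / 2) *\<^sub>R (a + b) + (1 / 2) *\<^sub>R (b - a) = b" "(1 / 2) *\<^sub>R (a + b) - (1 / 2) *\<^sub>R (b - a) = a"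
  by (vector, simp add: field_simps)+

text \<open>With \<open>x\<close> fixed, the flat part of the second difference is at least twice the error term.\<close>

lemma D2_midpoint_convex:
  assumes r: "0 < r" "reach * r \<le> R / 2" "K_second * (reach * r) \<le> \<alpha>"
    and x: "x \<in> cball z r" and p: "p \<in> cball z r" and q: "q \<in> cball z r"
  shows "2 * D2 x ((1 / 2) *\<^sub>R (p + q)) + \<alpha> / 4 * (norm (q - p))\<^sup>2 \<le> D2 x p + D2 x q"
proof -
  let ?\<eta> = "(1 / 2) *\<^sub>R (q - p)"
  have z: "z \<in> cball z R"
    using R_pos by simp
  have "2 * (?\<eta> \<bullet> (M z *v ?\<eta>)) - K_second * (reach * r) * (norm ?\<eta>)\<^sup>2 \<le> D2 x q + D2 x p - 2 * D2 x ((1 / 2) *\<^sub>R (p + q))"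
    using D2_second_difference_lower[OF r, of x 0 "(1 / 2) *\<^sub>R (p + q)" ?\<eta>] x p q
    by (simp add: midpoint_decomposition)
  moreover have "\<alpha> * (norm ?\<eta>)\<^sup>2 \<le> ?\<eta> \<bullet> (M z *v ?\<eta>)"
    by (rule M_lower[OF z])
  moreover have "K_second * (reach * r) * (norm ?\<eta>)\<^sup>2 \<le> \<alpha> * (norm ?\<eta>)\<^sup>2"
    by (intro mult_right_mono r) auto
  moreover have "\<alpha> * (norm ?\<eta>)\<^sup>2 = \<alpha> / 4 * (norm (q - p))\<^sup>2"
    by (simp add: power2_eq_square)
  ultimately show ?thesis
    by linarith
qed

text \<open>The four pairs formed from \<open>x\<close>, \<open>x'\<close> and \<open>p\<close>, \<open>p'\<close> have a common midpoint. Hence the mixed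
  difference is a difference of two second differences, and the flat parts leave only the
  bilinear term.\<close>

lemma D2_cross_difference:
  assumes r: "0 < r" "reach * r \<le> R / 2" "K_second * (reach * r) \<le> \<alpha>"
    and x: "x \<in> cball z r" "x' \<in> cball z r" and p: "p \<in> cball z r" "p' \<in> cball z r"
  shows "D2 x p' + D2 x' p - D2 x p - D2 x' p'
    \<le> 2 * A * norm (x' - x) * norm (p' - p) + K_second * (reach * r) / 2 * ((norm (x' - x))\<^sup>2 + (norm (p' - p))\<^sup>2)"
proof -
  let ?d = "(1 / 2) *\<^sub>R (x' - x)" and ?h = "(1 / 2) *\<^sub>R (p' - p)"
  let ?x = "(1 / 2) *\<^sub>R (x + x')" and ?p = "(1 / 2) *\<^sub>R (p + p')"
  have z: "z \<in> cball z R"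
    using R_pos by simp
  have "D2 x p' + D2 x' p - 2 * D2 ?x ?p
    \<le> 2 * ((?h + ?d) \<bullet> (M z *v (?h + ?d))) + K_second * (reach * r) * ((norm ?d)\<^sup>2 + (norm ?h)\<^sup>2)"
    using D2_second_difference_upper[OF r(1,2), of ?x "- ?d" ?p ?h] x p
    by (simp only: diff_minus_eq_add add_uminus_conv_diff midpoint_decomposition norm_minus_cancel)
  moreover have "2 * ((?h - ?d) \<bullet> (M z *v (?h - ?d))) - K_second * (reach * r) * ((norm ?d)\<^sup>2 + (norm ?h)\<^sup>2)
    \<le> D2 x' p' + D2 x p - 2 * D2 ?x ?p"
    using D2_second_difference_lower[OF r, of ?x ?d ?p ?h] x p by (simp only: midpoint_decomposition)
  moreover have "(?h + ?d) \<bullet> (M z *v (?h + ?d)) - (?h - ?d) \<bullet> (M z *v (?h - ?d)) = 4 * (?d \<bullet> (M z *v ?h))"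
    by (simp only: quadratic_form_add[OF M_pos] quadratic_form_diff[OF M_pos])
  moreover have "4 * (?d \<bullet> (M z *v ?h)) \<le> A * norm (x' - x) * norm (p' - p)"
    using M_upper[OF z, of ?d ?h] by simp
  moreover have "K_second * (reach * r) * ((norm ?d)\<^sup>2 + (norm ?h)\<^sup>2)
      = K_second * (reach * r) / 2 * ((norm (x' - x))\<^sup>2 + (norm (p' - p))\<^sup>2) / 2"
    by (simp add: power_mult_distrib power_divide add_divide_distrib)
  ultimately show ?thesis
    by linarith
qed

end

section \<open>The projection onto a hypersurface\<close>

text \<open>What the analysis of the scheme needs to know about \<open>P\<^sub>K\<close> near a point, both on the boundary and
  in the interior. The equation for \<open>\<phi> (P x)\<close> says that \<open>P\<close> maps into \<open>{\<phi> \<le> 0}\<close>, and onto \<open>{\<phi> = 0}\<close>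
  whenever it moves the point.\<close>

locale regular_projection =
  fixes P :: "real^'n \<Rightarrow> real^'n" and \<phi> :: "real^'n \<Rightarrow> real" and n b :: "real^'n \<Rightarrow> real^'n"
    and z :: "real^'n" and R A :: real
  assumes R_pos: "0 < R" and A_ge_1: "1 \<le> A"
    and P_Lipschitz: "x \<in> cball z R \<Longrightarrow> y \<in> cball z R \<Longrightarrow> norm (P x - P y) \<le> A * norm (x - y)"
    and \<phi>_P: "x \<in> cball z R \<Longrightarrow> \<phi> (P x) = min (\<phi> x) 0"
    and P_displacement: "x \<in> cball z R \<Longrightarrow>
      norm (P x - x + max (\<phi> x) 0 *\<^sub>R b x) \<le> A * (max (\<phi> x) 0)\<^sup>2"
    and \<phi>_Taylor: "x \<in> cball z R \<Longrightarrow> y \<in> cball z R \<Longrightarrow>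
      \<bar>\<phi> y - \<phi> x - n x \<bullet> (y - x)\<bar> \<le> A * (norm (y - x))\<^sup>2"
    and n_bound: "x \<in> cball z R \<Longrightarrow> norm (n x) \<le> A"
    and b_bound: "x \<in> cball z R \<Longrightarrow> norm (b x) \<le> A"
    and b_Lipschitz: "x \<in> cball z R \<Longrightarrow> y \<in> cball z R \<Longrightarrow> norm (b x - b y) \<le> A * norm (x - y)"

lemma eventually_linear_less: "0 < d \<Longrightarrow> eventually (\<lambda>s. c * s < d) (at_right (0::real))"
proof -
  assume "0 < d"
  have "((\<lambda>s. c * s) \<longlongrightarrow> c * 0) (at_right 0)"
    by (intro tendsto_intros)
  then show ?thesis
    by (rule order_tendstoD) (use \<open>0 < d\<close> in simp)
qed

locale hypersurface_ball = elliptic_ball M z R \<alpha> A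
  for M :: "real^'n \<Rightarrow> real^'n^'n" and z R \<alpha> A +
  fixes K :: "(real^'n) set" and \<phi> :: "real^'n \<Rightarrow> real" and n :: "real^'n \<Rightarrow> real^'n" and \<nu> :: "real^'n"
  assumes \<phi>_z: "\<phi> z = 0"
    and \<phi>_deriv: "x \<in> cball z R \<Longrightarrow> (\<phi> has_derivative (\<lambda>v. n x \<bullet> v)) (at x)"
    and \<phi>_Taylor: "x \<in> cball z R \<Longrightarrow> y \<in> cball z R \<Longrightarrow>
      \<bar>\<phi> y - \<phi> x - n x \<bullet> (y - x)\<bar> \<le> A * (norm (y - x))\<^sup>2"
    and n_bound: "x \<in> cball z R \<Longrightarrow> norm (n x) \<le> A"
    and n_Lipschitz: "x \<in> cball z R \<Longrightarrow> y \<in> cball z R \<Longrightarrow> norm (n x - n y) \<le> A * norm (x - y)"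
    and \<nu>_unit: "norm \<nu> = 1" and n_\<nu>: "x \<in> cball z R \<Longrightarrow> \<alpha> \<le> n x \<bullet> \<nu>"
    and K_iff: "x \<in> cball z R \<Longrightarrow> x \<in> K \<longleftrightarrow> \<phi> x \<le> 0"
    and frontier_iff: "x \<in> cball z R \<Longrightarrow> x \<in> frontier K \<longleftrightarrow> \<phi> x = 0"
begin

lemma z_in: "z \<in> cball z R"
  using R_pos by simp

lemma \<phi>_Lipschitz:
  assumes "x \<in> cball z R" "y \<in> cball z R"
  shows "\<bar>\<phi> x - \<phi> y\<bar> \<le> A * norm (x - y)"
proof -
  have "norm (\<phi> x - \<phi> y) \<le> A * norm (x - y)"
  proof (rule differentiable_bound[of "cball z R" \<phi> "\<lambda>x v. n x \<bullet> v"])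
    show "onorm (\<lambda>v. n u \<bullet> v) \<le> A" if u: "u \<in> cball z R" for u
    proof (rule onorm_bound)
      show "norm (n u \<bullet> v) \<le> A * norm v" for v
        using Cauchy_Schwarz_ineq2[of "n u" v] mult_right_mono[OF n_bound[OF u], of "norm v"] by simp
    qed (use A_ge_1 in simp)
    show "(\<phi> has_derivative (\<lambda>v. n u \<bullet> v)) (at u within cball z R)" if "u \<in> cball z R" for u
      by (rule has_derivative_at_withinI[OF \<phi>_deriv[OF that]])
  qed (use assms in auto)
  then show ?thesis
    by simp
qed

text \<open>Along the direction \<open>\<nu>\<close> the function \<open>\<phi>\<close> grows at least at rate \<open>\<alpha>\<close>, so it vanishes at distance at
  most \<open>|\<phi> y| / \<alpha>\<close>. This replaces a parametrisation of the hypersurface.\<close>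

lemma nearby_zero:
  assumes y: "norm (y - z) + \<bar>\<phi> y\<bar> / \<alpha> \<le> R"
  obtains y' where "y' \<in> cball z R" "\<phi> y' = 0" "norm (y' - y) \<le> \<bar>\<phi> y\<bar> / \<alpha>"
proof -
  define L where "L = \<bar>\<phi> y\<bar> / \<alpha>"
  have L: "0 \<le> L" "\<alpha> * L = \<bar>\<phi> y\<bar>"
    using \<alpha>_pos by (auto simp: L_def)
  define f where "f s = \<phi> (y + s *\<^sub>R \<nu>)" for s
  have inb: "y + s *\<^sub>R \<nu> \<in> cball z R" if "\<bar>s\<bar> \<le> L" for s
    using norm_triangle_ineq[of "y - z" "s *\<^sub>R \<nu>"] that y
    by (simp add: \<nu>_unit L_def dist_norm norm_minus_commute algebra_simps)
  have f': "(f has_real_derivative n (y + s *\<^sub>R \<nu>) \<bullet> \<nu>) (at s)" if "\<bar>s\<bar> \<le> L" for s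
  proof -
    have "((\<lambda>s. y + s *\<^sub>R \<nu>) has_derivative (\<lambda>h. h *\<^sub>R \<nu>)) (at s)"
      by (auto intro!: derivative_eq_intros)
    from has_derivative_compose[OF this \<phi>_deriv[OF inb[OF that]]]
    have "((\<lambda>s. \<phi> (y + s *\<^sub>R \<nu>)) has_derivative (\<lambda>h. n (y + s *\<^sub>R \<nu>) \<bullet> (h *\<^sub>R \<nu>))) (at s)" .
    moreover have "(\<lambda>h. n (y + s *\<^sub>R \<nu>) \<bullet> (h *\<^sub>R \<nu>)) = (*) (n (y + s *\<^sub>R \<nu>) \<bullet> \<nu>)"
      by (auto simp: fun_eq_iff)
    ultimately show ?thesis
      by (simp only: f_def[abs_def] has_field_derivative_def)
  qed
  have mono: "f s - \<alpha> * s \<le> f t - \<alpha> * t" if "-L \<le> s" "s \<le> t" "t \<le> L" for s t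
  proof (rule DERIV_nonneg_imp_nondecreasing[OF that(2)])
    fix x
    assume "s \<le> x" "x \<le> t"
    then have x: "\<bar>x\<bar> \<le> L"
      using that by auto
    show "\<exists>y. ((\<lambda>x. f x - \<alpha> * x) has_real_derivative y) (at x) \<and> 0 \<le> y"
      using n_\<nu>[OF inb[OF x]]
      by (intro exI[of _ "n (y + x *\<^sub>R \<nu>) \<bullet> \<nu> - \<alpha>"]) (auto intro!: derivative_eq_intros f'[OF x])
  qed
  have "f 0 = \<phi> y"
    by (simp add: f_def)
  then have "f (- L) \<le> 0" "0 \<le> f L"
    using mono[of "-L" 0] mono[of 0 L] L by auto
  moreover have "continuous_on {-L..L} f"
    by (intro continuous_at_imp_continuous_on ballI DERIV_isCont[OF f']) auto
  ultimately obtain s where s: "-L \<le> s" "s \<le> L" "f s = 0"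
    using IVT'[of f "-L" 0 L] L by auto
  then have "\<bar>s\<bar> \<le> L"
    by auto
  then show ?thesis
    using that[of "y + s *\<^sub>R \<nu>"] inb s by (auto simp: f_def \<nu>_unit L_def)
qed

definition K_Lip :: real where
  "K_Lip = 4 * A + 4 * K_first"

text \<open>One radius for which all the smallness conditions below hold. Some concern the ball of radius
  \<open>2 * s\<close>, because points of the frontier constructed from points of the ball of radius \<open>s\<close> may
  leave it.\<close>

definition tiny :: "real \<Rightarrow> bool" where
  "tiny s \<longleftrightarrow> 0 < s \<and> A * (4 * s)\<^sup>2 + (4 * s)\<^sup>2 < \<alpha> * (R / 4)\<^sup>2 \<and> 4 * s \<le> R / 4 \<and> 4 * s \<le> 1 \<and>
     A * s \<le> \<alpha> \<and> 8 * K_Lip * A * s \<le> \<alpha>\<^sup>2 \<and> reach * (2 * s) \<le> R / 2 \<and> 4 * (K_second * (reach * s)) \<le> \<alpha>"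

lemma K_first_pos: "0 < K_first" and K_Lip_pos: "0 < K_Lip"
proof -
  show 1: "0 < K_first"
    unfolding K_first_def using A_ge_1 \<alpha>_pos R_pos by (intro add_pos_nonneg) auto
  then show "0 < K_Lip"
    unfolding K_Lip_def using A_ge_1 by simp
qed

lemma eventually_tiny: "eventually tiny (at_right 0)"
proof -
  have "eventually (\<lambda>s. (16 * A + 16) * s < \<alpha> * (R / 4)\<^sup>2) (at_right 0)"
    by (rule eventually_linear_less) (use \<alpha>_pos R_pos in auto)
  moreover have "eventually (\<lambda>s. 4 * s < R / 4) (at_right 0)" "eventually (\<lambda>s::real. 4 * s < 1) (at_right 0)"
    "eventually (\<lambda>s. A * s < \<alpha>) (at_right 0)" "eventually (\<lambda>s. 8 * K_Lip * A * s < \<alpha>\<^sup>2) (at_right 0)"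
    "eventually (\<lambda>s. 2 * reach * s < R / 2) (at_right 0)" "eventually (\<lambda>s. 4 * K_second * reach * s < \<alpha>) (at_right 0)"
    by (rule eventually_linear_less; use \<alpha>_pos R_pos in simp)+
  ultimately show ?thesis
    using eventually_at_right_less[of 0]
  proof eventually_elim
    case (elim s)
    have "s * s \<le> s * 1"
      using elim by (intro mult_left_mono) auto
    then have "(16 * A + 16) * (s * s) \<le> (16 * A + 16) * s"
      using A_ge_1 by (intro mult_left_mono) auto
    then have "A * (4 * s)\<^sup>2 + (4 * s)\<^sup>2 < \<alpha> * (R / 4)\<^sup>2"
      using elim by (simp add: power2_eq_square algebra_simps)
    then show ?case
      using elim unfolding tiny_def by (auto simp: mult_ac)
  qed
qed

lemma norm_diff_in_cball: "x \<in> cball z s \<Longrightarrow> y \<in> cball z s \<Longrightarrow> norm (x - y) \<le> 2 * s"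
  for x y :: "real^'n"
  using norm_triangle_ineq4[of "x - z" "y - z"] by (simp add: dist_norm norm_minus_commute)

lemma tiny_in: "tiny s \<Longrightarrow> x \<in> cball z (2 * s) \<Longrightarrow> x \<in> cball z R"
  unfolding tiny_def using R_pos by auto

lemma tiny_in1: "tiny s \<Longrightarrow> x \<in> cball z s \<Longrightarrow> x \<in> cball z (2 * s)"
  unfolding tiny_def by auto

lemma tiny_first_variation:
  assumes s: "tiny s" and x: "x \<in> cball z (2 * s)" and p: "p \<in> cball z (2 * s)" and q: "q \<in> cball z (2 * s)"
  shows "D2 x q - D2 x p \<le> 2 * ((q - p) \<bullet> (M p *v (p - x)))
           + K_first * (norm (q - p) * (norm (p - x))\<^sup>2 + (norm (q - p))\<^sup>2)"
proof (rule first_variation_upper)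
  have d: "norm (q - p) \<le> 4 * s" "norm (p - x) \<le> 4 * s"
    using norm_diff_in_cball[OF q p] norm_diff_in_cball[OF p x] by auto
  then show "norm (q - p) \<le> 1" "norm (q - p) \<le> R / 4"
    using s by (auto simp: tiny_def)
  have "A * (norm (p - x))\<^sup>2 + (norm (q - p))\<^sup>2 \<le> A * (4 * s)\<^sup>2 + (4 * s)\<^sup>2"
    using d A_ge_1 by (intro add_mono mult_left_mono power_mono) auto
  then show "A * (norm (p - x))\<^sup>2 + (norm (q - p))\<^sup>2 < \<alpha> * (R / 4)\<^sup>2"
    using s by (simp add: tiny_def)
  show "x \<in> cball z (R / 4)" "p \<in> cball z R"
    using s x tiny_in[OF s p] by (auto simp: tiny_def)
qed

lemma tiny_D2_Lipschitz:
  assumes s: "tiny s" and x: "x \<in> cball z (2 * s)" and p: "p \<in> cball z (2 * s)" and q: "q \<in> cball z (2 * s)"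
  shows "D2 x q - D2 x p \<le> 2 * s * K_Lip * norm (q - p)"
proof -
  define t where "t = norm (q - p)"
  have d: "t \<le> 4 * s" "norm (p - x) \<le> 4 * s" and s0: "0 < s" "4 * s \<le> 1" and t0: "0 \<le> t"
    using norm_diff_in_cball[OF q p] norm_diff_in_cball[OF p x] s by (auto simp: tiny_def t_def)
  have "(q - p) \<bullet> (M p *v (p - x)) \<le> A * t * norm (p - x)"
    using M_upper[OF tiny_in[OF s p]] by (simp add: t_def)
  also have "\<dots> \<le> A * t * (4 * s)"
    using d t0 A_ge_1 by (intro mult_left_mono) auto
  finally have 1: "2 * ((q - p) \<bullet> (M p *v (p - x))) \<le> 8 * A * s * t"
    by (simp add: mult_ac)
  have "t * (norm (p - x))\<^sup>2 + t\<^sup>2 \<le> t * (4 * s) + t * (4 * s)"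
  proof (intro add_mono)
    have "(norm (p - x))\<^sup>2 \<le> (4 * s) * 1"
      unfolding power2_eq_square using d s0 by (intro mult_mono) auto
    then show "t * (norm (p - x))\<^sup>2 \<le> t * (4 * s)"
      using t0 by (intro mult_left_mono) auto
    show "t\<^sup>2 \<le> t * (4 * s)"
      unfolding power2_eq_square using d t0 by (intro mult_left_mono) auto
  qed
  from mult_left_mono[OF this, of K_first]
  have "K_first * (t * (norm (p - x))\<^sup>2 + t\<^sup>2) \<le> 8 * K_first * s * t"
    using K_first_pos by simp
  with 1 tiny_first_variation[OF assms] show ?thesis
    unfolding t_def[symmetric] K_Lip_def by (simp add: algebra_simps)
qed

lemma nearest_D2:
  assumes "nearest_frontier_point M K x p"
  shows "p \<in> frontier K" "q \<in> frontier K \<Longrightarrow> D2 x p \<le> D2 x q"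
  using assms by (auto simp: nearest_frontier_point_def intro!: power_mono riem_dist_nonneg)

lemma nearest_frontier_pointI:
  assumes "p \<in> frontier K" "\<And>q. q \<in> frontier K \<Longrightarrow> D2 x p \<le> D2 x q"
  shows "nearest_frontier_point M K x p"
  unfolding nearest_frontier_point_def
  using assms power2_le_imp_le[OF _ riem_dist_nonneg] by blast

text \<open>The point \<open>z\<close> itself lies on the frontier, so a nearest point is not farther than \<open>z\<close>.\<close>

definition spread :: real where
  "spread = 1 + sqrt (A / \<alpha>)"

lemma spread_ge: "1 \<le> spread"
  using A_ge_1 \<alpha>_pos by (simp add: spread_def)

lemma not_farther_than_z:
  assumes s: "tiny s" and x: "spread * norm (x - z) \<le> s" and q: "D2 x q \<le> D2 x z"
  shows "q \<in> cball z s"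
proof -
  define G where "G = sqrt (A / \<alpha>) * norm (x - z)"
  have G0: "0 \<le> G" and Gs: "norm (x - z) + G \<le> s"
    using x A_ge_1 \<alpha>_pos by (auto simp: G_def spread_def algebra_simps)
  have sR: "s \<le> R / 16"
    using s by (auto simp: tiny_def)
  have "norm (x - z) \<le> s"
    using G0 Gs by linarith
  then have xR: "x \<in> cball z (R / 2)"
    using sR R_pos by (simp add: dist_norm norm_minus_commute)
  then have "D2 x z \<le> A * (norm (z - x))\<^sup>2"
    using R_pos by (intro D2_upper) auto
  also have "\<dots> = \<alpha> * G\<^sup>2"
    using \<alpha>_pos A_ge_1 by (simp add: G_def power_mult_distrib norm_minus_commute)
  finally have "D2 x q \<le> \<alpha> * G\<^sup>2"
    using q by simp
  then have "norm (q - x) \<le> G"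
    using G0 Gs sR R_pos norm_ge_zero[of "x - z"] by (intro D2_lower[OF xR]) linarith+
  then show ?thesis
    using Gs norm_triangle_ineq[of "q - x" "x - z"] by (simp add: dist_norm norm_minus_commute)
qed

lemma z_frontier: "z \<in> frontier K"
  using frontier_iff[OF z_in] \<phi>_z by simp

lemma nearest_in_cball:
  assumes "tiny s" "spread * norm (x - z) \<le> s" "nearest_frontier_point M K x p"
  shows "p \<in> cball z s"
  using not_farther_than_z[OF assms(1,2)] nearest_D2(2)[OF assms(3) z_frontier] .

lemma nearest_exists:
  assumes s: "tiny s" and x: "spread * norm (x - z) \<le> s"
  obtains p where "nearest_frontier_point M K x p"
proof -
  have s0: "0 < s"
    using s by (simp add: tiny_def)
  have "norm (x - z) \<le> spread * norm (x - z)"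
    using spread_ge mult_right_mono[of 1 spread "norm (x - z)"] by simp
  then have x2: "x \<in> cball z (2 * s)"
    using x s0 by (simp add: dist_norm norm_minus_commute)
  define S where "S = frontier K \<inter> cball z s"
  have "compact S"
    unfolding S_def by (intro closed_Int_compact frontier_closed compact_cball)
  moreover have zS: "z \<in> S"
    using z_frontier s0 by (simp add: S_def)
  moreover have "continuous_on S (D2 x)"
  proof (rule continuous_on_subset)
    have "\<bar>D2 x q - D2 x p\<bar> \<le> 2 * s * K_Lip * norm (q - p)" if "p \<in> cball z s" "q \<in> cball z s" for p q
      using tiny_D2_Lipschitz[OF s x2 tiny_in1[OF s that(1)] tiny_in1[OF s that(2)]]
        tiny_D2_Lipschitz[OF s x2 tiny_in1[OF s that(2)] tiny_in1[OF s that(1)]]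
      by (simp add: abs_le_iff norm_minus_commute)
    then have "(2 * s * K_Lip)-lipschitz_on (cball z s) (D2 x)"
      using s0 K_Lip_pos by (intro lipschitz_onI) (auto simp: dist_norm abs_minus_commute norm_minus_commute)
    then show "continuous_on (cball z s) (D2 x)"
      by (rule lipschitz_on_continuous_on)
  qed (simp add: S_def)
  ultimately obtain p where p: "p \<in> S" "\<And>q. q \<in> S \<Longrightarrow> D2 x p \<le> D2 x q"
    using continuous_attains_inf[of S "D2 x"] by blast
  have "D2 x p \<le> D2 x q" if q: "q \<in> frontier K" for q
  proof (rule ccontr)
    assume "\<not> D2 x p \<le> D2 x q"
    then have "D2 x q \<le> D2 x z"
      using p(2)[OF zS] by simp
    then have "q \<in> S"
      using not_farther_than_z[OF s x] q by (simp add: S_def)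
    then show False
      using p \<open>\<not> D2 x p \<le> D2 x q\<close> by auto
  qed
  then show ?thesis
    using that p(1) nearest_frontier_pointI by (auto simp: S_def)
qed

text \<open>The frontier is not convex, but the midpoint of \<open>p\<close> and \<open>q\<close> is within \<open>O(|q - p|\<^sup>2)\<close> of it. As
  the squared distance has Lipschitz constant \<open>O(s)\<close> near \<open>z\<close>, replacing the midpoint by a point of
  the frontier costs \<open>O(s |q - p|\<^sup>2)\<close>, less than the gain from convexity.\<close>

lemma nearest_quadratic_growth:
  assumes s: "tiny s" and x: "x \<in> cball z s" and p: "nearest_frontier_point M K x p" "p \<in> cball z s"
    and q: "q \<in> frontier K" "q \<in> cball z s"
  shows "\<alpha> / 8 * (norm (q - p))\<^sup>2 \<le> D2 x q - D2 x p"
proof -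
  define y where "y = (1 / 2) *\<^sub>R (p + q)"
  define \<delta> where "\<delta> = (1 / 2) *\<^sub>R (q - p)"
  have yq: "y + \<delta> = q" and yp: "y - \<delta> = p"
    unfolding y_def \<delta>_def by (rule midpoint_decomposition)+
  have s0: "0 < s"
    using s by (simp add: tiny_def)
  note R1 = tiny_in[OF s tiny_in1[OF s]]
  have y: "y \<in> cball z s"
    using half_difference_in_cball(2)[of y \<delta> s] p(2) q(2) by (simp add: yq yp)
  have "\<delta> = q - y" "- \<delta> = p - y"
    using yq yp by (auto simp: algebra_simps)
  then have "\<bar>\<phi> q - \<phi> y - n y \<bullet> \<delta>\<bar> \<le> A * (norm \<delta>)\<^sup>2" "\<bar>\<phi> p - \<phi> y + n y \<bullet> \<delta>\<bar> \<le> A * (norm \<delta>)\<^sup>2"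
    using \<phi>_Taylor[OF R1[OF y] R1[OF q(2)]] \<phi>_Taylor[OF R1[OF y] R1[OF p(2)]]
    by (metis, metis diff_minus_eq_add inner_minus_right norm_minus_cancel)
  moreover have "\<phi> q = 0" "\<phi> p = 0"
    using frontier_iff[OF R1[OF q(2)]] frontier_iff[OF R1[OF p(2)]] q nearest_D2(1)[OF p(1)] by auto
  ultimately have \<phi>y: "\<bar>\<phi> y\<bar> \<le> A * (norm \<delta>)\<^sup>2"
    by auto
  have \<delta>: "norm \<delta> \<le> s"
    using norm_diff_in_cball[OF q(2) p(2)] by (simp add: \<delta>_def)
  have "A * (norm \<delta>)\<^sup>2 \<le> (A * s) * s"
    using \<delta> A_ge_1 s0 by (simp add: power2_eq_square mult.assoc mult_mono)
  also have "\<dots> \<le> \<alpha> * s"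
    using s by (intro mult_right_mono) (auto simp: tiny_def)
  finally have "\<bar>\<phi> y\<bar> / \<alpha> \<le> s"
    using \<phi>y \<alpha>_pos by (simp add: field_simps)
  moreover have "2 * s \<le> R"
    using s R_pos by (simp add: tiny_def)
  ultimately have "norm (y - z) + \<bar>\<phi> y\<bar> / \<alpha> \<le> R" and ys: "norm (y - z) + \<bar>\<phi> y\<bar> / \<alpha> \<le> 2 * s"
    using y by (auto simp: dist_norm norm_minus_commute)
  from nearby_zero[OF this(1)] obtain y' where
    y': "y' \<in> cball z R" "\<phi> y' = 0" "norm (y' - y) \<le> \<bar>\<phi> y\<bar> / \<alpha>" .
  have y's: "y' \<in> cball z (2 * s)"
    using ys y'(3) norm_triangle_ineq[of "y' - y" "y - z"] by (simp add: dist_norm norm_minus_commute)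
  have "D2 x p \<le> D2 x y'"
    using y' frontier_iff by (intro nearest_D2(2)[OF p(1)]) auto
  also have "\<dots> \<le> D2 x y + 2 * s * K_Lip * norm (y' - y)"
    using tiny_D2_Lipschitz[OF s tiny_in1[OF s x] tiny_in1[OF s y] y's] by simp
  also have "2 * s * K_Lip * norm (y' - y) \<le> 2 * s * K_Lip * (A * (norm \<delta>)\<^sup>2 / \<alpha>)"
    using y'(3) divide_right_mono[OF \<phi>y, of \<alpha>] \<alpha>_pos s0 K_Lip_pos by (intro mult_left_mono) auto
  also have "\<dots> = (8 * K_Lip * A * s) * (norm \<delta>)\<^sup>2 / (4 * \<alpha>)"
    by simp
  also have "\<dots> \<le> \<alpha>\<^sup>2 * (norm \<delta>)\<^sup>2 / (4 * \<alpha>)"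
    using s \<alpha>_pos by (intro divide_right_mono mult_right_mono) (auto simp: tiny_def)
  also have "\<dots> = \<alpha> / 16 * (norm (q - p))\<^sup>2"
    using \<alpha>_pos by (simp add: \<delta>_def power_divide power2_eq_square)
  finally have "D2 x p \<le> D2 x y + \<alpha> / 16 * (norm (q - p))\<^sup>2"
    by simp
  moreover have "2 * D2 x y + \<alpha> / 4 * (norm (q - p))\<^sup>2 \<le> D2 x p + D2 x q"
    unfolding y_def
  proof (rule D2_midpoint_convex[OF s0 _ _ x p(2) q(2)])
    have "0 \<le> reach * s" "0 \<le> K_second * (reach * s)"
      using reach_ge K_second_pos s0 by auto
    then show "reach * s \<le> R / 2" "K_second * (reach * s) \<le> \<alpha>"
      using s by (auto simp: tiny_def)
  qed
  ultimately show ?thesis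
    by simp
qed

text \<open>Quadratic growth at both nearest points bounds \<open>|p' - p|\<^sup>2\<close> by the mixed difference of the squared
  distance, which is at most of order \<open>|x' - x| |p' - p|\<close> up to a small multiple of the squares.\<close>

lemma nearest_Lipschitz:
  assumes s: "tiny s" and x: "x \<in> cball z s" "x' \<in> cball z s"
    and p: "nearest_frontier_point M K x p" "p \<in> cball z s"
    and p': "nearest_frontier_point M K x' p'" "p' \<in> cball z s"
  shows "norm (p' - p) \<le> (16 * A / \<alpha> + 1) * norm (x' - x)"
proof -
  define X where "X = norm (x' - x)"
  define Q where "Q = norm (p' - p)"
  have s0: "0 < s"
    using s by (simp add: tiny_def)
  have gs: "0 \<le> reach * s" "0 \<le> K_second * (reach * s)"
    using reach_ge K_second_pos s0 by auto
  have "\<alpha> / 8 * Q\<^sup>2 \<le> D2 x p' - D2 x p" "\<alpha> / 8 * Q\<^sup>2 \<le> D2 x' p - D2 x' p'"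
    using nearest_quadratic_growth[OF s x(1) p nearest_D2(1)[OF p'(1)] p'(2)]
      nearest_quadratic_growth[OF s x(2) p' nearest_D2(1)[OF p(1)] p(2)]
    by (simp_all add: Q_def norm_minus_commute)
  moreover have "D2 x p' + D2 x' p - D2 x p - D2 x' p' \<le> 2 * A * X * Q + K_second * (reach * s) / 2 * (X\<^sup>2 + Q\<^sup>2)"
    unfolding X_def Q_def
  proof (rule D2_cross_difference[OF s0 _ _ x p(2) p'(2)])
    show "reach * s \<le> R / 2" "K_second * (reach * s) \<le> \<alpha>"
      using gs s by (auto simp: tiny_def)
  qed
  moreover have "K_second * (reach * s) / 2 * (X\<^sup>2 + Q\<^sup>2) \<le> \<alpha> / 8 * (X\<^sup>2 + Q\<^sup>2)"
  proof (rule mult_right_mono)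
    have "4 * (K_second * (reach * s)) \<le> \<alpha>"
      using s by (simp add: tiny_def)
    then show "K_second * (reach * s) / 2 \<le> \<alpha> / 8"
      by linarith
  qed simp
  ultimately have "\<alpha> / 8 * Q\<^sup>2 + \<alpha> / 8 * Q\<^sup>2 \<le> 2 * A * X * Q + \<alpha> / 8 * (X\<^sup>2 + Q\<^sup>2)"
    by linarith
  then have main: "\<alpha> / 8 * Q\<^sup>2 \<le> 2 * A * X * Q + \<alpha> / 8 * X\<^sup>2"
    by (simp add: distrib_left)
  have X0: "0 \<le> X"
    by (simp add: X_def)
  have "Q \<le> (16 * A / \<alpha> + 1) * X"
  proof (cases "Q \<le> X")
    case True
    then show ?thesis
      using X0 A_ge_1 \<alpha>_pos by (simp add: distrib_right add_increasing)
  next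
    case False
    then have "X\<^sup>2 \<le> X * Q" "0 < Q"
      using X0 by (auto simp: power2_eq_square mult_left_mono)
    then have "\<alpha> / 8 * X\<^sup>2 \<le> \<alpha> / 8 * (X * Q)"
      using \<alpha>_pos by (intro mult_left_mono) auto
    then have "Q * (\<alpha> / 8 * Q) \<le> Q * (2 * A * X + \<alpha> / 8 * X)"
      using main by (simp add: power2_eq_square algebra_simps)
    then have "\<alpha> / 8 * Q \<le> 2 * A * X + \<alpha> / 8 * X"
      using \<open>0 < Q\<close> mult_le_cancel_left_pos by blast
    then show ?thesis
      using \<alpha>_pos by (simp add: field_simps)
  qed
  then show ?thesis
    by (simp add: X_def Q_def)
qed

definition C_tan :: real where
  "C_tan = A\<^sup>2 / \<alpha> + 3 * K_first"

text \<open>For a frontier point \<open>p\<close> nearest to \<open>x\<close>, first variation along the frontier shows that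
  \<open>M p (p - x)\<close> is a multiple of the normal \<open>n p\<close> up to \<open>O(|p - x|\<^sup>2)\<close>.  The test point is at
  distance \<open>|p - x|\<^sup>2\<close> from \<open>p\<close>, so that the second-order terms have the size of the error.\<close>

lemma nearest_tangential:
  assumes s: "tiny s" and x: "x \<in> cball z s" and p: "nearest_frontier_point M K x p" "p \<in> cball z (s / 2)"
    and d: "p \<noteq> x" "norm (p - x) \<le> s" and \<tau>: "norm \<tau> = 1" "n p \<bullet> \<tau> = 0"
  shows "- (\<tau> \<bullet> (M p *v (p - x))) \<le> C_tan * (norm (p - x))\<^sup>2"
proof -
  define d where "d = norm (p - x)"
  define t where "t = d\<^sup>2"
  have s0: "0 < s" and s4: "4 * s \<le> 1" and AS: "A * s \<le> \<alpha>" and sR: "4 * s \<le> R / 4"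
    using s by (auto simp: tiny_def)
  have d0: "0 < d" "d \<le> s"
    using d by (auto simp: d_def)
  have t0: "0 < t"
    using d0 by (simp add: t_def)
  have "t \<le> s * (1 / 4)"
    unfolding t_def power2_eq_square using d0 s4 s0 by (intro mult_mono) auto
  then have t4: "4 * t \<le> s"
    by simp
  have ps: "p \<in> cball z s"
    using p(2) s0 by auto
  note R1 = tiny_in[OF s tiny_in1[OF s]]
  define y where "y = p + t *\<^sub>R \<tau>"
  have y: "y \<in> cball z s"
    using p(2) t4 t0 s0 \<tau>(1) norm_triangle_ineq[of "p - z" "t *\<^sub>R \<tau>"]
    by (simp add: y_def dist_norm norm_minus_commute algebra_simps)
  have \<phi>p: "\<phi> p = 0"
    using frontier_iff[OF R1[OF ps]] nearest_D2(1)[OF p(1)] by simp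
  have \<phi>y: "\<bar>\<phi> y\<bar> \<le> A * t\<^sup>2"
    using \<phi>_Taylor[OF R1[OF ps] R1[OF y]] \<phi>p \<tau> by (simp add: y_def)
  have At: "A * t\<^sup>2 / \<alpha> \<le> t"
  proof -
    have "A * t \<le> A * s"
      using t4 t0 A_ge_1 by (intro mult_left_mono) auto
    then have "(A * t) * t \<le> \<alpha> * t"
      using AS t0 by (intro mult_right_mono) auto
    then show ?thesis
      using \<alpha>_pos by (simp add: field_simps power2_eq_square)
  qed
  have \<phi>y': "\<bar>\<phi> y\<bar> / \<alpha> \<le> A * t\<^sup>2 / \<alpha>"
    using \<phi>y \<alpha>_pos by (intro divide_right_mono) auto
  then have "norm (y - z) + \<bar>\<phi> y\<bar> / \<alpha> \<le> 2 * s"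
    using y At t4 t0 by (simp add: dist_norm norm_minus_commute)
  moreover have "2 * s \<le> R"
    using sR R_pos s0 by linarith
  ultimately have "norm (y - z) + \<bar>\<phi> y\<bar> / \<alpha> \<le> R"
    by linarith
  from nearby_zero[OF this] obtain q where
    q: "q \<in> cball z R" "\<phi> q = 0" "norm (q - y) \<le> \<bar>\<phi> y\<bar> / \<alpha>" .
  have qy: "norm (q - y) \<le> A * t\<^sup>2 / \<alpha>"
    using q(3) \<phi>y' by linarith
  have qs: "q \<in> cball z (2 * s)"
    using y qy At t4 t0 norm_triangle_ineq[of "q - y" "y - z"] by (simp add: dist_norm norm_minus_commute)
  have qp: "norm (q - p) \<le> 2 * t"
    using qy At t0 \<tau>(1) norm_triangle_ineq[of "q - y" "t *\<^sub>R \<tau>"] by (simp add: y_def algebra_simps)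
  let ?w = "M p *v (p - x)"
  have w: "norm ?w \<le> A * d"
  proof -
    have "norm ?w \<le> norm (M p) * norm (p - x)"
      by (rule norm_matrix_vector_le)
    also have "\<dots> \<le> A * d"
      unfolding d_def using M_bound[OF R1[OF ps]] by (intro mult_right_mono) auto
    finally show ?thesis .
  qed
  have "0 \<le> D2 x q - D2 x p"
    using nearest_D2(2)[OF p(1)] frontier_iff[OF q(1)] q(2) by simp
  also have "\<dots> \<le> 2 * ((q - p) \<bullet> ?w) + K_first * (norm (q - p) * d\<^sup>2 + (norm (q - p))\<^sup>2)"
    unfolding d_def by (rule tiny_first_variation[OF s tiny_in1[OF s x] tiny_in1[OF s ps] qs])
  also have "(q - p) \<bullet> ?w = (q - y) \<bullet> ?w + t * (\<tau> \<bullet> ?w)"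
    by (simp add: y_def inner_simps)
  also have "(q - y) \<bullet> ?w \<le> (A * t\<^sup>2 / \<alpha>) * (A * d)"
  proof -
    have "(q - y) \<bullet> ?w \<le> norm (q - y) * norm ?w"
      by (rule norm_cauchy_schwarz)
    also have "\<dots> \<le> (A * t\<^sup>2 / \<alpha>) * (A * d)"
      by (rule mult_mono[OF qy w]) (use A_ge_1 \<alpha>_pos in auto)
    finally show ?thesis .
  qed
  also have "norm (q - p) * d\<^sup>2 + (norm (q - p))\<^sup>2 \<le> (2 * t) * d\<^sup>2 + (2 * t)\<^sup>2"
    using qp by (intro add_mono mult_right_mono power_mono) auto
  finally have "0 \<le> 2 * ((A * t\<^sup>2 / \<alpha>) * (A * d) + t * (\<tau> \<bullet> ?w)) + K_first * ((2 * t) * d\<^sup>2 + (2 * t)\<^sup>2)"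
    using K_first_pos by (simp add: mult_left_mono)
  also have "\<dots> = (2 * t) * ((A\<^sup>2 / \<alpha>) * (d * t) + \<tau> \<bullet> ?w + 3 * K_first * t)"
    unfolding t_def by (simp add: power2_eq_square field_simps)
  finally have "0 \<le> (A\<^sup>2 / \<alpha>) * (d * t) + \<tau> \<bullet> ?w + 3 * K_first * t"
    using t0 by (simp add: zero_le_mult_iff)
  moreover have "(A\<^sup>2 / \<alpha>) * (d * t) \<le> (A\<^sup>2 / \<alpha>) * (1 * t)"
    using d0 s4 t0 \<alpha>_pos A_ge_1 by (intro mult_left_mono mult_right_mono) auto
  ultimately show ?thesis
    unfolding C_tan_def t_def d_def by (simp add: algebra_simps)
qed

text \<open>The gradient of \<open>\<phi>\<close> with respect to the metric.\<close>

definition N :: "real^'n \<Rightarrow> real^'n" where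
  "N x = (SOME v. M x *v v = n x)"

text \<open>Scaled such that \<open>\<phi>\<close> has derivative 1 along it.\<close>

definition b :: "real^'n \<Rightarrow> real^'n" where
  "b x = N x /\<^sub>R (n x \<bullet> N x)"

lemma M_N: "M x *v N x = n x"
proof -
  have "invertible (M x)"
    unfolding invertible_left_inverse matrix_left_invertible_ker
  proof (intro allI impI)
    fix v
    assume "M x *v v = 0"
    then show "v = 0"
      using M_pos[of x] unfolding sym_pos_def_def by (metis inner_zero_right less_irrefl)
  qed
  then obtain B where "M x ** B = mat 1"
    by (auto simp: invertible_def)
  then have "M x *v (B *v n x) = n x"
    by (simp add: matrix_vector_mul_assoc)
  then show ?thesis
    unfolding N_def by (rule someI)
qed

lemma M_lower_norm:
  assumes "x \<in> cball z R"
  shows "\<alpha> * norm v \<le> norm (M x *v v)"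
proof (cases "v = 0")
  case False
  have "\<alpha> * (norm v)\<^sup>2 \<le> norm v * norm (M x *v v)"
    using M_lower[OF assms, of v] norm_cauchy_schwarz[of v "M x *v v"] by linarith
  then show ?thesis
    using False by (simp add: power2_eq_square mult_ac)
qed simp

definition \<beta> :: real where
  "\<beta> = \<alpha> ^ 3 / A\<^sup>2"

lemma N_estimates:
  assumes x: "x \<in> cball z R"
  shows "norm (N x) \<le> A / \<alpha>" "\<beta> \<le> n x \<bullet> N x"
proof -
  show "norm (N x) \<le> A / \<alpha>"
    using M_lower_norm[OF x, of "N x"] n_bound[OF x] \<alpha>_pos by (simp add: M_N field_simps)
  have "\<alpha> \<le> norm (n x)"
    using n_\<nu>[OF x] norm_cauchy_schwarz[of "n x" \<nu>] by (simp add: \<nu>_unit)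
  also have "\<dots> \<le> A * norm (N x)"
    using norm_matrix_vector_le[of "M x" "N x"] mult_right_mono[OF M_bound[OF x], of "norm (N x)"]
    by (simp add: M_N)
  finally have "\<alpha> / A \<le> norm (N x)"
    using A_ge_1 by (simp add: field_simps)
  then have "\<alpha> * (\<alpha> / A)\<^sup>2 \<le> \<alpha> * (norm (N x))\<^sup>2"
    using \<alpha>_pos A_ge_1 by (intro mult_left_mono power_mono) auto
  also have "\<dots> \<le> n x \<bullet> N x"
    using M_lower[OF x, of "N x"] by (simp add: M_N inner_commute)
  finally show "\<beta> \<le> n x \<bullet> N x"
    by (simp add: \<beta>_def power_divide power2_eq_square power3_eq_cube)
qed

lemma \<beta>_pos: "0 < \<beta>"
  using \<alpha>_pos A_ge_1 by (simp add: \<beta>_def)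

lemma N_Lipschitz:
  assumes x: "x \<in> cball z R" and y: "y \<in> cball z R"
  shows "norm (N x - N y) \<le> (A + A * (A / \<alpha>)) / \<alpha> * norm (x - y)"
proof -
  have "\<alpha> * norm (N x - N y) \<le> norm (M x *v (N x - N y))"
    by (rule M_lower_norm[OF x])
  also have "M x *v (N x - N y) = (n x - n y) - (M x - M y) *v N y"
    using M_N[of x] M_N[of y] by (simp add: matrix_vector_mult_diff_distrib matrix_vector_mult_diff_rdistrib)
  also have "norm \<dots> \<le> norm (n x - n y) + norm ((M x - M y) *v N y)"
    by (rule norm_triangle_ineq4)
  also have "norm ((M x - M y) *v N y) \<le> norm (M x - M y) * norm (N y)"
    by (rule norm_matrix_vector_le)
  also have "\<dots> \<le> (A * norm (x - y)) * (A / \<alpha>)"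
    using M_Lipschitz[OF x y] N_estimates(1)[OF y] A_ge_1 by (intro mult_mono) auto
  also have "norm (n x - n y) \<le> A * norm (x - y)"
    by (rule n_Lipschitz[OF x y])
  finally show ?thesis
    using \<alpha>_pos by (simp add: field_simps)
qed

lemma b_estimates:
  obtains B where "0 \<le> B" "\<And>x. x \<in> cball z R \<Longrightarrow> norm (b x) \<le> B"
    "\<And>x y. x \<in> cball z R \<Longrightarrow> y \<in> cball z R \<Longrightarrow> norm (b x - b y) \<le> B * norm (x - y)"
proof -
  define L where "L = (A + A * (A / \<alpha>)) / \<alpha>"
  define L' where "L' = A * (A / \<alpha>) + A * L"
  define B where "B = max (A / \<alpha> / \<beta>) (L / \<beta> + (A / \<alpha>) * (L' / (\<beta> * \<beta>)))"
  have L0: "0 \<le> L" "0 \<le> L'" "0 \<le> A"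
    using A_ge_1 \<alpha>_pos by (auto simp: L_def L'_def)
  have bd: "norm (b x) \<le> A / \<alpha> / \<beta>" if x: "x \<in> cball z R" for x
  proof -
    have "norm (b x) = norm (N x) / (n x \<bullet> N x)"
      using N_estimates(2)[OF x] \<beta>_pos by (simp add: b_def divide_inverse mult.commute)
    also have "\<dots> \<le> (A / \<alpha>) / \<beta>"
      using N_estimates[OF x] \<beta>_pos L0 \<alpha>_pos by (intro frac_le) auto
    finally show ?thesis .
  qed
  have Lip: "norm (b x - b y) \<le> (L / \<beta> + (A / \<alpha>) * (L' / (\<beta> * \<beta>))) * norm (x - y)"
    if x: "x \<in> cball z R" and y: "y \<in> cball z R" for x y
  proof -
    let ?u = "n x \<bullet> N x" and ?v = "n y \<bullet> N y"
    note u = N_estimates(2)[OF x] and v = N_estimates(2)[OF y]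
    have uv: "0 < ?u" "0 < ?v"
      using u v \<beta>_pos by auto
    have "\<bar>?v - ?u\<bar> = \<bar>(n y - n x) \<bullet> N y + n x \<bullet> (N y - N x)\<bar>"
      by (simp add: inner_simps)
    also have "\<dots> \<le> norm (n y - n x) * norm (N y) + norm (n x) * norm (N y - N x)"
      using Cauchy_Schwarz_ineq2[of "n y - n x" "N y"] Cauchy_Schwarz_ineq2[of "n x" "N y - N x"] by linarith
    also have "\<dots> \<le> (A * norm (y - x)) * (A / \<alpha>) + A * (L * norm (y - x))"
      using n_Lipschitz[OF y x] N_estimates(1)[OF y] n_bound[OF x] N_Lipschitz[OF y x] L0
      by (intro add_mono mult_mono) (auto simp: L_def)
    also have "\<dots> = L' * norm (x - y)"
      by (simp add: L'_def algebra_simps norm_minus_commute)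
    finally have vu: "\<bar>?v - ?u\<bar> \<le> L' * norm (x - y)" .
    have "b x - b y = (1 / ?u) *\<^sub>R (N x - N y) + ((?v - ?u) / (?u * ?v)) *\<^sub>R N y"
    proof -
      have "(?v - ?u) / (?u * ?v) = 1 / ?u - 1 / ?v"
        using uv by (simp add: field_simps)
      then show ?thesis
        by (simp add: b_def divide_inverse scaleR_diff_left scaleR_diff_right)
    qed
    then have "norm (b x - b y) \<le> norm ((1 / ?u) *\<^sub>R (N x - N y)) + norm (((?v - ?u) / (?u * ?v)) *\<^sub>R N y)"
      using norm_triangle_ineq by metis
    also have "\<dots> = norm (N x - N y) / ?u + (\<bar>?v - ?u\<bar> / (?u * ?v)) * norm (N y)"
      using uv by (simp add: abs_mult)
    also have "\<dots> \<le> (L * norm (x - y)) / \<beta> + ((L' * norm (x - y)) / (\<beta> * \<beta>)) * (A / \<alpha>)"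
      using N_Lipschitz[OF x y] N_estimates(1)[OF y] vu u v uv \<beta>_pos L0 \<alpha>_pos
      by (intro add_mono mult_mono frac_le) (auto simp: L_def intro!: mult_mono divide_nonneg_nonneg)
    finally show ?thesis
      by (simp add: field_simps)
  qed
  have "B \<ge> 0"
    using L0 \<alpha>_pos \<beta>_pos by (simp add: B_def le_max_iff_disj)
  moreover have "norm (b x) \<le> B" if "x \<in> cball z R" for x
    using bd[OF that] by (simp add: B_def)
  moreover have "norm (b x - b y) \<le> B * norm (x - y)" if "x \<in> cball z R" "y \<in> cball z R" for x y
    by (rule order_trans[OF Lip[OF that] mult_right_mono]) (auto simp: B_def)
  ultimately show ?thesis
    using that by blast
qed

text \<open>The tangential estimate leaves \<open>p - x = \<mu> * N p\<close> up to \<open>O(|p - x|\<^sup>2)\<close>, and the Taylor expansion of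
  \<open>\<phi>\<close> at \<open>p\<close> identifies the factor \<open>\<mu>\<close>.\<close>

lemma nearest_displacement:
  assumes s: "tiny s" and x: "x \<in> cball z s" and p: "nearest_frontier_point M K x p" "p \<in> cball z (s / 2)"
    and d: "norm (p - x) \<le> s"
    and B: "0 \<le> B" "\<And>x. x \<in> cball z R \<Longrightarrow> norm (b x) \<le> B"
      "\<And>x y. x \<in> cball z R \<Longrightarrow> y \<in> cball z R \<Longrightarrow> norm (b x - b y) \<le> B * norm (x - y)"
  shows "norm (p - x + \<phi> x *\<^sub>R b x) \<le> (C_tan / \<alpha> + (A + A * C_tan / \<alpha>) * B + A * B) * (norm (p - x))\<^sup>2"
proof (cases "p = x")
  case True
  then have "\<phi> x = 0"
    using nearest_D2(1)[OF p(1)] frontier_iff[OF tiny_in[OF s tiny_in1[OF s x]]] by simp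
  then show ?thesis
    using True by simp
next
  case False
  define d where "d = norm (p - x)"
  have ps: "p \<in> cball z s"
    using p(2) s by (auto simp: tiny_def)
  note R1 = tiny_in[OF s tiny_in1[OF s]]
  note pR = R1[OF ps] and xR = R1[OF x]
  have C0: "0 \<le> C_tan"
    using K_first_pos \<alpha>_pos by (simp add: C_tan_def)
  let ?w = "M p *v (p - x)"
  have "\<alpha> \<le> norm (n p)"
    using n_\<nu>[OF pR] norm_cauchy_schwarz[of "n p" \<nu>] by (simp add: \<nu>_unit)
  then have np: "n p \<noteq> 0"
    using \<alpha>_pos by auto
  define \<mu> where "\<mu> = (?w \<bullet> n p) / (n p \<bullet> n p)"
  define e where "e = ?w - \<mu> *\<^sub>R n p"
  have en: "n p \<bullet> e = 0"
    using np by (simp add: e_def \<mu>_def inner_simps inner_commute)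
  have e: "norm e \<le> C_tan * d\<^sup>2"
  proof (cases "e = 0")
    case True
    then show ?thesis
      using C0 by simp
  next
    case ne: False
    define \<tau> where "\<tau> = (- 1 / norm e) *\<^sub>R e"
    have "norm \<tau> = 1" "n p \<bullet> \<tau> = 0"
      using ne en by (auto simp: \<tau>_def)
    from nearest_tangential[OF s x p False assms(5) this]
    have "- (\<tau> \<bullet> ?w) \<le> C_tan * d\<^sup>2"
      by (simp add: d_def)
    moreover have "e \<bullet> ?w = (norm e)\<^sup>2"
    proof -
      have "?w = e + \<mu> *\<^sub>R n p"
        by (simp add: e_def)
      then show ?thesis
        using en by (simp add: inner_simps power2_norm_eq_inner inner_commute)
    qed
    then have "- (\<tau> \<bullet> ?w) = norm e"
      using ne by (simp add: \<tau>_def power2_eq_square)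
    ultimately show ?thesis
      by simp
  qed
  have "M p *v (p - x - \<mu> *\<^sub>R N p) = e"
    by (simp add: e_def matrix_vector_mult_diff_distrib matrix_vector_mult_scaleR M_N)
  then have pe: "norm (p - x - \<mu> *\<^sub>R N p) \<le> C_tan * d\<^sup>2 / \<alpha>"
    using M_lower_norm[OF pR, of "p - x - \<mu> *\<^sub>R N p"] e \<alpha>_pos by (simp add: field_simps)
  have \<phi>p: "\<phi> p = 0"
    using frontier_iff[OF pR] nearest_D2(1)[OF p(1)] by simp
  have "\<bar>\<phi> x + n p \<bullet> (p - x)\<bar> \<le> A * d\<^sup>2"
    using \<phi>_Taylor[OF pR xR] \<phi>p by (simp add: d_def inner_simps norm_minus_commute)
  moreover have "\<bar>n p \<bullet> (p - x) - \<mu> * (n p \<bullet> N p)\<bar> \<le> A * (C_tan * d\<^sup>2 / \<alpha>)"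
  proof -
    have "n p \<bullet> (p - x) - \<mu> * (n p \<bullet> N p) = n p \<bullet> (p - x - \<mu> *\<^sub>R N p)"
      by (simp add: inner_simps)
    also have "\<bar>\<dots>\<bar> \<le> norm (n p) * norm (p - x - \<mu> *\<^sub>R N p)"
      by (rule Cauchy_Schwarz_ineq2)
    also have "\<dots> \<le> A * (C_tan * d\<^sup>2 / \<alpha>)"
      using n_bound[OF pR] pe A_ge_1 by (intro mult_mono) auto
    finally show ?thesis .
  qed
  ultimately have \<mu>: "\<bar>\<phi> x + \<mu> * (n p \<bullet> N p)\<bar> \<le> A * d\<^sup>2 + A * (C_tan * d\<^sup>2 / \<alpha>)"
    by linarith
  have bN: "(n p \<bullet> N p) *\<^sub>R b p = N p"
    using N_estimates(2)[OF pR] \<beta>_pos by (simp add: b_def)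
  have \<mu>N: "\<mu> *\<^sub>R N p = (\<mu> * (n p \<bullet> N p)) *\<^sub>R b p"
    by (simp only: scaleR_scaleR[symmetric] bN)
  have "v + c *\<^sub>R a = (v - m *\<^sub>R a') + (c + m) *\<^sub>R a' + c *\<^sub>R (a - a')"
    for v a a' :: "real^'n" and c m :: real
    by (simp add: scaleR_left_distrib scaleR_diff_right)
  then have decomposition: "p - x + \<phi> x *\<^sub>R b x = (p - x - \<mu> *\<^sub>R N p) + (\<phi> x + \<mu> * (n p \<bullet> N p)) *\<^sub>R b p + \<phi> x *\<^sub>R (b x - b p)"
    unfolding \<mu>N .
  have "norm (p - x + \<phi> x *\<^sub>R b x) \<le> norm (p - x - \<mu> *\<^sub>R N p) + \<bar>\<phi> x + \<mu> * (n p \<bullet> N p)\<bar> * norm (b p) + \<bar>\<phi> x\<bar> * norm (b x - b p)"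
    using norm_triangle_ineq[of "p - x - \<mu> *\<^sub>R N p + (\<phi> x + \<mu> * (n p \<bullet> N p)) *\<^sub>R b p" "\<phi> x *\<^sub>R (b x - b p)"]
      norm_triangle_ineq[of "p - x - \<mu> *\<^sub>R N p" "(\<phi> x + \<mu> * (n p \<bullet> N p)) *\<^sub>R b p"]
    unfolding decomposition norm_scaleR by linarith
  also have "\<dots> \<le> C_tan * d\<^sup>2 / \<alpha> + (A * d\<^sup>2 + A * (C_tan * d\<^sup>2 / \<alpha>)) * B + (A * d) * (B * d)"
  proof -
    have A0: "0 \<le> A" and d0: "0 \<le> d"
      using A_ge_1 by (simp_all add: d_def)
    have nn: "0 \<le> A * d\<^sup>2 + A * (C_tan * d\<^sup>2 / \<alpha>)" "0 \<le> A * d"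
      by (intro add_nonneg_nonneg mult_nonneg_nonneg divide_nonneg_nonneg zero_le_power2 A0 d0 C0
          less_imp_le[OF \<alpha>_pos])+
    have "\<bar>\<phi> x\<bar> \<le> A * d"
      using \<phi>_Lipschitz[OF xR pR] \<phi>p by (simp add: d_def norm_minus_commute)
    moreover have "norm (b x - b p) \<le> B * d"
      using B(3)[OF xR pR] by (simp add: d_def norm_minus_commute)
    ultimately have "\<bar>\<phi> x\<bar> * norm (b x - b p) \<le> (A * d) * (B * d)"
      using nn by (intro mult_mono) auto
    moreover have "\<bar>\<phi> x + \<mu> * (n p \<bullet> N p)\<bar> * norm (b p) \<le> (A * d\<^sup>2 + A * (C_tan * d\<^sup>2 / \<alpha>)) * B"
      by (rule mult_mono[OF \<mu> B(2)[OF pR] nn(1)]) simp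
    ultimately show ?thesis
      using pe by linarith
  qed
  also have "\<dots> = (C_tan / \<alpha> + (A + A * C_tan / \<alpha>) * B + A * B) * d\<^sup>2"
    by (simp add: algebra_simps power2_eq_square)
  finally show ?thesis
    by (simp add: d_def)
qed

lemma nearest_distance_le:
  assumes s: "tiny s" and x: "x \<in> cball z s" and p: "nearest_frontier_point M K x p"
    and small: "norm (x - z) + \<bar>\<phi> x\<bar> / \<alpha> \<le> R" "sqrt (A / \<alpha>) / \<alpha> * \<bar>\<phi> x\<bar> < R / 2"
  shows "norm (p - x) \<le> sqrt (A / \<alpha>) / \<alpha> * \<bar>\<phi> x\<bar>"
proof (rule D2_lower)
  show x2: "x \<in> cball z (R / 2)"
    using s x by (auto simp: tiny_def)
  from nearby_zero[OF small(1)] obtain y where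
    y: "y \<in> cball z R" "\<phi> y = 0" "norm (y - x) \<le> \<bar>\<phi> x\<bar> / \<alpha>" .
  have "D2 x p \<le> D2 x y"
    using nearest_D2(2)[OF p] frontier_iff[OF y(1)] y(2) by simp
  also have "\<dots> \<le> A * (norm (y - x))\<^sup>2"
    using x2 R_pos y(1) by (intro D2_upper) auto
  also have "\<dots> \<le> A * (\<bar>\<phi> x\<bar> / \<alpha>)\<^sup>2"
    using y(3) A_ge_1 by (intro mult_left_mono power_mono) auto
  also have "\<dots> = \<alpha> * (sqrt (A / \<alpha>) / \<alpha> * \<bar>\<phi> x\<bar>)\<^sup>2"
    using \<alpha>_pos A_ge_1 by (simp add: power_mult_distrib power_divide)
  finally show "D2 x p \<le> \<alpha> * (sqrt (A / \<alpha>) / \<alpha> * \<bar>\<phi> x\<bar>)\<^sup>2" .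
qed (use small \<alpha>_pos A_ge_1 in auto)

text \<open>For two points of which one lies in \<open>K\<close> and the other does not, the segment between them meets the
  frontier in a point that is its own nearest point; so the Lipschitz estimate for nearest points
  extends to \<open>P\<^sub>K\<close>.\<close>

lemma regular_projection_at_frontier:
  obtains r A' where "cball z r \<subseteq> proj_dom M K" "regular_projection (proj M K) \<phi> n b z r A'"
proof -
  obtain B where B: "0 \<le> B" "\<And>x. x \<in> cball z R \<Longrightarrow> norm (b x) \<le> B"
    "\<And>x y. x \<in> cball z R \<Longrightarrow> y \<in> cball z R \<Longrightarrow> norm (b x - b y) \<le> B * norm (x - y)"
    using b_estimates by blast
  define c where "c = sqrt (A / \<alpha>) / \<alpha>"
  have c0: "0 \<le> c"
    using A_ge_1 \<alpha>_pos by (simp add: c_def)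
  have "eventually (\<lambda>s. tiny s \<and> (1 + A / \<alpha>) * s < R \<and> c * A * s < R / 2) (at_right 0)"
    using eventually_tiny by (intro eventually_conj eventually_linear_less) (use R_pos in auto)
  then obtain s where s: "tiny s" "(1 + A / \<alpha>) * s < R" "c * A * s < R / 2"
    using eventually_happens'[OF trivial_limit_at_right_real] by blast
  have s0: "0 < s"
    using s by (simp add: tiny_def)
  \<comment> \<open>Nearest points of points of the ball of radius \<open>r\<close> then lie in that of radius \<open>spread * r = s / 4\<close>.\<close>
  define r where "r = s / (4 * spread)"
  have r0: "0 < r" and kr: "spread * r = s / 4" and rs: "r \<le> s / 4"
  proof -
    show "0 < r" and kr: "spread * r = s / 4"
      using s0 spread_ge by (auto simp: r_def)
    then have "1 * r \<le> spread * r"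
      using spread_ge by (intro mult_right_mono) auto
    with kr show "r \<le> s / 4"
      by linarith
  qed
  have xs: "x \<in> cball z s" and kx: "spread * norm (x - z) \<le> s" and xR: "x \<in> cball z R" if x: "x \<in> cball z r" for x
  proof -
    show "x \<in> cball z s"
      using x rs s0 by auto
    then show "x \<in> cball z R"
      using tiny_in[OF s(1) tiny_in1[OF s(1)]] by blast
    have "spread * norm (x - z) \<le> spread * r"
      using x spread_ge by (intro mult_left_mono) (auto simp: dist_norm norm_minus_commute)
    then show "spread * norm (x - z) \<le> s"
      using kr s0 by simp
  qed
  have close: "norm (p - x) \<le> c * \<bar>\<phi> x\<bar>" "p \<in> cball z s"
    if x: "x \<in> cball z r" and p: "nearest_frontier_point M K x p" for x p
  proof -
    show "p \<in> cball z s"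
      by (rule nearest_in_cball[OF s(1) kx[OF x] p])
    have nx: "norm (x - z) \<le> s"
      using xs[OF x] by (simp add: dist_norm norm_minus_commute)
    have \<phi>x: "\<bar>\<phi> x\<bar> \<le> A * s"
    proof -
      have "\<bar>\<phi> x\<bar> \<le> A * norm (x - z)"
        using \<phi>_Lipschitz[OF xR[OF x] z_in] \<phi>_z by simp
      also have "\<dots> \<le> A * s"
        using A_ge_1 by (intro mult_left_mono nx) auto
      finally show ?thesis .
    qed
    have "norm (x - z) + \<bar>\<phi> x\<bar> / \<alpha> \<le> s + A * s / \<alpha>"
      using nx \<phi>x \<alpha>_pos by (intro add_mono divide_right_mono) auto
    also have "\<dots> = (1 + A / \<alpha>) * s"
      by (simp add: algebra_simps)
    finally have 1: "norm (x - z) + \<bar>\<phi> x\<bar> / \<alpha> \<le> R"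
      using s(2) by simp
    have "c * \<bar>\<phi> x\<bar> \<le> c * (A * s)"
      by (intro mult_left_mono \<phi>x c0)
    then have 2: "sqrt (A / \<alpha>) / \<alpha> * \<bar>\<phi> x\<bar> < R / 2"
      using s(3) by (simp add: c_def[symmetric] mult.assoc)
    show "norm (p - x) \<le> c * \<bar>\<phi> x\<bar>"
      unfolding c_def by (rule nearest_distance_le[OF s(1) xs[OF x] p 1 2])
  qed
  define L where "L = 16 * A / \<alpha> + 1"
  have L1: "1 \<le> L"
    using A_ge_1 \<alpha>_pos by (simp add: L_def)
  have Lip: "norm (p' - p) \<le> L * norm (x' - x)"
    if "x \<in> cball z r" "x' \<in> cball z r" "nearest_frontier_point M K x p" "nearest_frontier_point M K x' p'"
    for x x' p p'
    unfolding L_def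
    by (rule nearest_Lipschitz[OF s(1) xs[OF that(1)] xs[OF that(2)] that(3) close(2)[OF that(1,3)]
        that(4) close(2)[OF that(2,4)]])
  have unique: "\<exists>!p. nearest_frontier_point M K x p" if x: "x \<in> cball z r" for x
  proof -
    obtain p where "nearest_frontier_point M K x p"
      using nearest_exists[OF s(1) kx[OF x]] .
    moreover have "q = p" if "nearest_frontier_point M K x p" "nearest_frontier_point M K x q" for p q
      using Lip[OF x x that] by simp
    ultimately show ?thesis
      by blast
  qed
  have in_half: "p \<in> cball z (s / 2)" "norm (p - x) \<le> s"
    if x: "x \<in> cball z r" and p: "nearest_frontier_point M K x p" for x p
  proof -
    have t4: "tiny (s / 4)"
    proof -
      have "A * s\<^sup>2 + s\<^sup>2 \<le> A * (4 * s)\<^sup>2 + (4 * s)\<^sup>2"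
        using s0 A_ge_1 by (intro add_mono mult_left_mono power_mono) auto
      moreover have "A * (4 * s)\<^sup>2 + (4 * s)\<^sup>2 < \<alpha> * (R / 4)\<^sup>2" "4 * s \<le> R / 4" "4 * s \<le> 1" "A * s \<le> \<alpha>"
        "8 * K_Lip * A * s \<le> \<alpha>\<^sup>2" "reach * (2 * s) \<le> R / 2" "4 * (K_second * (reach * s)) \<le> \<alpha>"
        using s(1) unfolding tiny_def by blast+
      moreover have "0 \<le> A * s" "0 \<le> 8 * K_Lip * A * s" "0 \<le> reach * (2 * s)" "0 \<le> 4 * (K_second * (reach * s))"
        using s0 A_ge_1 K_Lip_pos K_second_pos reach_ge by auto
      ultimately have "0 < s / 4" "A * s\<^sup>2 + s\<^sup>2 < \<alpha> * (R / 4)\<^sup>2" "s \<le> R / 4" "s \<le> 1" "A * (s / 4) \<le> \<alpha>"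
        "8 * K_Lip * A * (s / 4) \<le> \<alpha>\<^sup>2" "reach * (2 * (s / 4)) \<le> R / 2" "4 * (K_second * (reach * (s / 4))) \<le> \<alpha>"
        using s0 by linarith+
      moreover have "4 * (s / 4) = s"
        by simp
      ultimately show ?thesis
        by (simp only: tiny_def)
    qed
    have "spread * norm (x - z) \<le> spread * r"
      using x spread_ge by (intro mult_left_mono) (auto simp: dist_norm norm_minus_commute)
    then have ps: "p \<in> cball z (s / 4)"
      using kr by (intro nearest_in_cball[OF t4 _ p]) simp
    then show "p \<in> cball z (s / 2)"
      using s0 by auto
    have "x \<in> cball z (s / 4)"
      using x rs by auto
    from norm_diff_in_cball[OF ps this] show "norm (p - x) \<le> s"
      using s0 by simp
  qed
  let ?P = "proj M K"
  have P_nearest: "nearest_frontier_point M K x (?P x)" if "x \<in> cball z r" "x \<notin> K" for x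
    using theI'[OF unique[OF that(1)]] that(2) by (simp add: proj_def)
  have P_K: "?P x = x" if "x \<in> K" for x
    using that by (simp add: proj_def)
  have mixed: "norm (?P x - y) \<le> 2 * L * norm (x - y)"
    if x: "x \<in> cball z r" "x \<notin> K" and y: "y \<in> cball z r" "y \<in> K" for x y
  proof -
    have "closed_segment x y \<inter> frontier K \<noteq> {}"
    proof (rule connected_Int_frontier)
      show "closed_segment x y \<inter> K \<noteq> {}" "closed_segment x y - K \<noteq> {}"
        using x(2) y(2) ends_in_segment[of x y] by blast+
    qed simp
    then obtain u where u: "u \<in> closed_segment x y" "u \<in> frontier K"
      by blast
    have ur: "u \<in> cball z r"
      using closed_segment_subset[of x "cball z r" y] x y u by auto
    have "D2 u u \<le> 0"
      using D2_upper[OF xR[OF ur] xR[OF ur]] by simp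
    then have "nearest_frontier_point M K u u"
      using u(2) by (intro nearest_frontier_pointI) auto
    from Lip[OF ur x(1) this P_nearest[OF x]]
    have "norm (?P x - u) \<le> L * norm (x - u)" .
    also have "\<dots> \<le> L * norm (x - y)"
      using segment_bound(1)[OF u(1)] L1 by (intro mult_left_mono) (auto simp: norm_minus_commute)
    finally have "norm (?P x - u) \<le> L * norm (x - y)" .
    moreover have "norm (u - y) \<le> norm (x - y)"
      using segment_bound(2)[OF u(1)] by (simp add: norm_minus_commute)
    moreover have "norm (x - y) \<le> L * norm (x - y)"
      using L1 mult_right_mono[of 1 L "norm (x - y)"] by simp
    ultimately show ?thesis
      using norm_triangle_ineq[of "?P x - u" "u - y"] by simp
  qed
  define C where "C = C_tan / \<alpha> + (A + A * C_tan / \<alpha>) * B + A * B"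
  have C0: "0 \<le> C"
    using K_first_pos \<alpha>_pos A_ge_1 B(1) by (auto simp: C_def C_tan_def intro!: add_nonneg_nonneg mult_nonneg_nonneg)
  define A' where "A' = 2 * L + C * c\<^sup>2 + A + B"
  have A': "2 * L \<le> A'" "C * c\<^sup>2 \<le> A'" "A \<le> A'" "B \<le> A'" "1 \<le> A'"
    using L1 mult_nonneg_nonneg[OF C0 zero_le_power2[of c]] A_ge_1 B(1) unfolding A'_def by linarith+
  show ?thesis
  proof (rule that)
    show "cball z r \<subseteq> proj_dom M K"
      unfolding proj_dom_def using unique by blast
    show "regular_projection ?P \<phi> n b z r A'"
    proof
      show "0 < r" "1 \<le> A'"
        by (rule r0 A')+
    next
      fix x y
      assume xy: "x \<in> cball z r" "y \<in> cball z r"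
      have "norm (?P x - ?P y) \<le> 2 * L * norm (x - y)"
      proof -
        consider "x \<in> K" "y \<in> K" | "x \<in> K" "y \<notin> K" | "x \<notin> K" "y \<in> K" | "x \<notin> K" "y \<notin> K"
          by blast
        then show ?thesis
        proof cases
          case 1
          have "1 * norm (x - y) \<le> 2 * L * norm (x - y)"
            using L1 by (intro mult_right_mono) auto
          then show ?thesis
            by (simp only: P_K[OF 1(1)] P_K[OF 1(2)] mult_1)
        next
          case 2
          show ?thesis
            using mixed[OF xy(2) 2(2) xy(1) 2(1)]
            unfolding P_K[OF 2(1)] norm_minus_commute[of x "?P y"] norm_minus_commute[of x y] .
        next
          case 3
          show ?thesis
            using mixed[OF xy(1) 3(1) xy(2) 3(2)] by (simp only: P_K[OF 3(2)])
        next
          case 4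
          have "norm (?P x - ?P y) \<le> L * norm (x - y)"
            by (rule Lip[OF xy(2,1) P_nearest[OF xy(2) 4(2)] P_nearest[OF xy(1) 4(1)]])
          also have "\<dots> \<le> 2 * L * norm (x - y)"
            using L1 by (intro mult_right_mono) auto
          finally show ?thesis .
        qed
      qed
      also have "\<dots> \<le> A' * norm (x - y)"
        by (intro mult_right_mono A') auto
      finally show "norm (?P x - ?P y) \<le> A' * norm (x - y)" .
    next
      fix x
      assume x: "x \<in> cball z r"
      show "\<phi> (?P x) = min (\<phi> x) 0"
      proof (cases "x \<in> K")
        case True
        then show ?thesis
          using K_iff[OF xR[OF x]] by (simp add: P_K)
      next
        case False
        note p = P_nearest[OF x False]
        have "?P x \<in> cball z R"
          using tiny_in[OF s(1) tiny_in1[OF s(1) close(2)[OF x p]]] .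
        then have "\<phi> (?P x) = 0"
          using frontier_iff nearest_D2(1)[OF p] by blast
        then show ?thesis
          using False K_iff[OF xR[OF x]] by simp
      qed
    next
      fix x
      assume x: "x \<in> cball z r"
      show "norm (?P x - x + max (\<phi> x) 0 *\<^sub>R b x) \<le> A' * (max (\<phi> x) 0)\<^sup>2"
      proof (cases "x \<in> K")
        case True
        then show ?thesis
          using K_iff[OF xR[OF x]] by (simp add: P_K max_def)
      next
        case False
        then have \<phi>x: "0 < \<phi> x"
          using K_iff[OF xR[OF x]] by simp
        note p = P_nearest[OF x False]
        have "norm (?P x - x + \<phi> x *\<^sub>R b x) \<le> C * (norm (?P x - x))\<^sup>2"
          unfolding C_def by (rule nearest_displacement[OF s(1) xs[OF x] p in_half[OF x p] B])
        also have "\<dots> \<le> C * (c * \<bar>\<phi> x\<bar>)\<^sup>2"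
          using close(1)[OF x p] by (intro mult_left_mono power_mono C0) auto
        also have "\<dots> = C * c\<^sup>2 * (\<phi> x)\<^sup>2"
          by (simp add: power_mult_distrib)
        also have "\<dots> \<le> A' * (\<phi> x)\<^sup>2"
          by (intro mult_right_mono A') auto
        finally show ?thesis
          using \<phi>x by (simp add: max_def)
      qed
    next
      fix x y
      assume xy: "x \<in> cball z r" "y \<in> cball z r"
      show "\<bar>\<phi> y - \<phi> x - n x \<bullet> (y - x)\<bar> \<le> A' * (norm (y - x))\<^sup>2"
        using \<phi>_Taylor[OF xy[THEN xR]] mult_right_mono[OF A'(3), of "(norm (y - x))\<^sup>2"] by simp
      show "norm (b x - b y) \<le> A' * norm (x - y)"
        using B(3)[OF xy[THEN xR]] mult_right_mono[OF A'(4), of "norm (x - y)"] by simp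
    next
      fix x
      assume x: "x \<in> cball z r"
      show "norm (n x) \<le> A'" "norm (b x) \<le> A'"
        using n_bound[OF xR[OF x]] B(2)[OF xR[OF x]] A' by simp_all
    qed
  qed
qed

end

section \<open>One step of the scheme near the boundary\<close>

context regular_projection
begin

definition K_normal :: "real \<Rightarrow> real" where
  "K_normal D = 4 * A * (D + 1)\<^sup>2"

definition K_tangential :: "real \<Rightarrow> real" where
  "K_tangential D = 2 * A * (K_normal D)\<^sup>2 + D + 3 * K_normal D * A * D + 2 * K_normal D * A"

lemma K_normal_nonneg: "0 \<le> K_normal D"
  using A_ge_1 by (simp add: K_normal_def)

lemma K_normal_ge: "0 \<le> D \<Longrightarrow> 2 * A * D + 2 * A * D\<^sup>2 \<le> K_normal D" "0 \<le> D \<Longrightarrow> 4 * (A * D\<^sup>2) \<le> K_normal D"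
  "0 \<le> D \<Longrightarrow> 3 * (A * D\<^sup>2) + A * D \<le> K_normal D"
proof -
  assume D: "0 \<le> D"
  have "0 \<le> A * D" "0 \<le> A * D\<^sup>2"
    using A_ge_1 D by auto
  moreover have "K_normal D = 4 * (A * D\<^sup>2) + 8 * (A * D) + 4 * A"
    by (simp add: K_normal_def power2_sum algebra_simps)
  ultimately show "2 * A * D + 2 * A * D\<^sup>2 \<le> K_normal D" "4 * (A * D\<^sup>2) \<le> K_normal D" "3 * (A * D\<^sup>2) + A * D \<le> K_normal D"
    using A_ge_1 by (simp_all add: algebra_simps)
qed

lemma \<phi>_increment:
  assumes "x \<in> cball z R" "y \<in> cball z R"
  shows "\<bar>\<phi> y - \<phi> x\<bar> \<le> A * norm (y - x) + A * (norm (y - x))\<^sup>2"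
proof -
  have "\<bar>n x \<bullet> (y - x)\<bar> \<le> norm (n x) * norm (y - x)"
    by (rule Cauchy_Schwarz_ineq2)
  also have "\<dots> \<le> A * norm (y - x)"
    by (intro mult_right_mono n_bound assms) auto
  finally show ?thesis
    using \<phi>_Taylor[OF assms] by linarith
qed

lemma fixed_point_of_P: "x \<in> cball z R \<Longrightarrow> \<phi> x \<le> 0 \<Longrightarrow> P x = x"
  using P_displacement[of x] by (simp add: max_def)

end

text \<open>Three consecutive positions \<open>u0\<close>, \<open>u1\<close>, \<open>u2\<close> at mutual distance \<open>O(h)\<close>, with \<open>a\<close> the argument of the
  projection and \<open>f\<close> the value of the force. All expansions are taken at \<open>u1\<close>.\<close>

locale projection_step = regular_projection P \<phi> n b z R A
  for P :: "real^'n \<Rightarrow> real^'n" and \<phi> n b z R A +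
  fixes e h D :: real and u0 u1 u2 f a p :: "real^'n"
  assumes e: "0 \<le> e" "e \<le> 1" and h: "0 < h" "h \<le> 1"
    and V0: "norm (u1 - u0) \<le> D * h" and V1: "norm (u2 - u1) \<le> D * h"
    and f: "norm f \<le> D"
    and a_def: "a = (2 *\<^sub>R u1 - (1 - e) *\<^sub>R u0 + h\<^sup>2 *\<^sub>R f) /\<^sub>R (1 + e)" and p_def: "p = P a"
    and u2: "u2 = - (e *\<^sub>R u0) + (1 + e) *\<^sub>R p"
    and u1: "u1 \<in> cball z (R / 2)" and D_small: "2 * D * h \<le> R / 2"
begin

lemma D_nonneg: "0 \<le> D"
  using f norm_ge_zero[of f] by linarith

lemma a_combination: "(1 + e) *\<^sub>R (a - u1) = (1 - e) *\<^sub>R (u1 - u0) + h\<^sup>2 *\<^sub>R f"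
proof -
  have "(1 + e) *\<^sub>R a = 2 *\<^sub>R u1 - (1 - e) *\<^sub>R u0 + h\<^sup>2 *\<^sub>R f"
    using e by (simp add: a_def)
  then show ?thesis
    by (simp add: algebra_simps scaleR_2)
qed

lemma p_combination: "(1 + e) *\<^sub>R (p - u1) = (u2 - u1) + e *\<^sub>R (u0 - u1)"
  unfolding u2 by (simp add: algebra_simps)

lemma norm_combination_le:
  assumes "(1 + e) *\<^sub>R v = w" "norm w \<le> c" "0 \<le> c"
  shows "norm v \<le> c"
proof -
  have "norm v \<le> (1 + e) * norm v"
    using e mult_right_mono[of 1 "1 + e" "norm v"] by simp
  also have "\<dots> = norm w"
    using e by (simp add: assms(1)[symmetric])
  finally show ?thesis
    using assms by linarith
qed

lemma near_u1: "norm (a - u1) \<le> 2 * D * h" "norm (p - u1) \<le> 2 * D * h" "norm (u0 - u1) \<le> 2 * D * h"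
  "norm (u2 - u1) \<le> 2 * D * h"
proof -
  have Dh: "0 \<le> D * h" "0 \<le> 2 * D * h"
    using D_nonneg h by auto
  show "norm (u0 - u1) \<le> 2 * D * h" "norm (u2 - u1) \<le> 2 * D * h"
    using V0 V1 Dh norm_minus_commute[of u0 u1] by linarith+
  have "norm ((1 - e) *\<^sub>R (u1 - u0) + h\<^sup>2 *\<^sub>R f) \<le> (1 - e) * norm (u1 - u0) + h\<^sup>2 * norm f"
    using e norm_triangle_ineq[of "(1 - e) *\<^sub>R (u1 - u0)" "h\<^sup>2 *\<^sub>R f"] by simp
  also have "\<dots> \<le> 1 * (D * h) + h * D"
  proof (intro add_mono mult_mono)
    show "h\<^sup>2 \<le> h"
      using h by (simp add: power2_eq_square mult_left_le)
  qed (use e V0 f Dh h in auto)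
  finally have "norm ((1 - e) *\<^sub>R (u1 - u0) + h\<^sup>2 *\<^sub>R f) \<le> 2 * D * h"
    by simp
  then show "norm (a - u1) \<le> 2 * D * h"
    by (rule norm_combination_le[OF a_combination _ Dh(2)])
  have "norm (u2 - u1 + e *\<^sub>R (u0 - u1)) \<le> norm (u2 - u1) + e * norm (u0 - u1)"
    using e norm_triangle_ineq[of "u2 - u1" "e *\<^sub>R (u0 - u1)"] by simp
  also have "e * norm (u0 - u1) \<le> 1 * (D * h)"
    using e V0 by (intro mult_mono) (auto simp: norm_minus_commute)
  finally have "norm (u2 - u1 + e *\<^sub>R (u0 - u1)) \<le> 2 * D * h"
    using V1 by simp
  then show "norm (p - u1) \<le> 2 * D * h"
    by (rule norm_combination_le[OF p_combination _ Dh(2)])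
qed

lemma u1_in: "u1 \<in> cball z R"
  using u1 R_pos by auto

lemma in_ball: "norm (y - u1) \<le> 2 * D * h \<Longrightarrow> y \<in> cball z R"
  using u1 D_small norm_triangle_ineq[of "y - u1" "u1 - z"] by (simp add: dist_norm norm_minus_commute)

abbreviation E :: real where "E \<equiv> K_normal (2 * D)"

abbreviation \<kappa> :: real where "\<kappa> \<equiv> max (\<phi> a) 0"

lemma \<phi>_p: "\<phi> p = \<phi> a - \<kappa>"
  using \<phi>_P[OF in_ball[OF near_u1(1)]] by (simp add: p_def min_def max_def)

definition err :: "real^'n \<Rightarrow> real" where
  "err y = \<phi> y - \<phi> u1 - n u1 \<bullet> (y - u1)"

lemma err_le:
  assumes "norm (y - u1) \<le> 2 * D * h"
  shows "\<bar>err y\<bar> \<le> A * (2 * D)\<^sup>2 * h\<^sup>2"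
proof -
  have "\<bar>err y\<bar> \<le> A * (norm (y - u1))\<^sup>2"
    unfolding err_def by (rule \<phi>_Taylor[OF u1_in in_ball[OF assms]])
  also have "\<dots> \<le> A * (2 * D * h)\<^sup>2"
    using assms A_ge_1 by (intro mult_left_mono power_mono) auto
  finally show ?thesis
    by (simp add: power_mult_distrib mult_ac)
qed

text \<open>As \<open>(1 + e) p = u2 + e u0\<close>, the constant and linear terms of the expansions cancel.\<close>

lemma defect_p: "\<bar>\<phi> u2 + e * \<phi> u0 - (1 + e) * \<phi> p\<bar> \<le> E * h\<^sup>2"
proof -
  define T where "T = A * (2 * D)\<^sup>2 * h\<^sup>2"
  have T0: "0 \<le> T"
    using A_ge_1 by (simp add: T_def)
  have "(1 + e) * (n u1 \<bullet> (p - u1)) = n u1 \<bullet> (u2 - u1) + e * (n u1 \<bullet> (u0 - u1))"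
    using arg_cong[OF p_combination, of "\<lambda>v. n u1 \<bullet> v"] by (simp only: inner_simps) 
  then have "\<phi> u2 + e * \<phi> u0 - (1 + e) * \<phi> p = err u2 + e * err u0 - (1 + e) * err p"
    by (simp add: err_def algebra_simps)
  moreover have "\<bar>err u2\<bar> \<le> T" "\<bar>err u0\<bar> \<le> T" "\<bar>err p\<bar> \<le> T"
    unfolding T_def by (intro err_le near_u1)+
  moreover from this have "\<bar>e * err u0\<bar> \<le> 1 * T" "\<bar>(1 + e) * err p\<bar> \<le> 2 * T"
    unfolding abs_mult using e T0 by (intro mult_mono; simp)+
  ultimately have "\<bar>\<phi> u2 + e * \<phi> u0 - (1 + e) * \<phi> p\<bar> \<le> 4 * T"
    by linarith
  also have "\<dots> = 4 * (A * (2 * D)\<^sup>2) * h\<^sup>2"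
    by (simp add: T_def)
  also have "\<dots> \<le> E * h\<^sup>2"
    using D_nonneg by (intro mult_right_mono K_normal_ge) auto
  finally show ?thesis .
qed

lemma defect_a: "\<bar>(1 + e) * \<phi> a - (2 * \<phi> u1 - (1 - e) * \<phi> u0)\<bar> \<le> E * h\<^sup>2"
proof -
  define T where "T = A * (2 * D)\<^sup>2 * h\<^sup>2"
  have T0: "0 \<le> T"
    using A_ge_1 by (simp add: T_def)
  have "(1 + e) * (n u1 \<bullet> (a - u1)) = (1 - e) * (n u1 \<bullet> (u1 - u0)) + h\<^sup>2 * (n u1 \<bullet> f)"
    using arg_cong[OF a_combination, of "\<lambda>v. n u1 \<bullet> v"] by (simp only: inner_simps)
  then have "(1 + e) * \<phi> a - (2 * \<phi> u1 - (1 - e) * \<phi> u0) = (1 + e) * err a + (1 - e) * err u0 + h\<^sup>2 * (n u1 \<bullet> f)"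
    by (simp add: err_def algebra_simps)
  moreover have "\<bar>err a\<bar> \<le> T" "\<bar>err u0\<bar> \<le> T"
    unfolding T_def by (intro err_le near_u1)+
  moreover from this have "\<bar>(1 + e) * err a\<bar> \<le> 2 * T" "\<bar>(1 - e) * err u0\<bar> \<le> 1 * T"
    unfolding abs_mult using e T0 by (intro mult_mono; simp)+
  moreover have "\<bar>h\<^sup>2 * (n u1 \<bullet> f)\<bar> \<le> h\<^sup>2 * (A * (2 * D))"
  proof -
    have "\<bar>n u1 \<bullet> f\<bar> \<le> norm (n u1) * norm f"
      by (rule Cauchy_Schwarz_ineq2)
    also have "\<dots> \<le> A * (2 * D)"
      using n_bound[OF u1_in] f D_nonneg A_ge_1 by (intro mult_mono) auto
    finally show ?thesis
      unfolding abs_mult by (intro mult_mono) auto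
  qed
  ultimately have "\<bar>(1 + e) * \<phi> a - (2 * \<phi> u1 - (1 - e) * \<phi> u0)\<bar> \<le> 3 * T + h\<^sup>2 * (A * (2 * D))"
    by linarith
  also have "\<dots> = (3 * (A * (2 * D)\<^sup>2) + A * (2 * D)) * h\<^sup>2"
    by (simp add: T_def algebra_simps)
  also have "\<dots> \<le> E * h\<^sup>2"
    using D_nonneg by (intro mult_right_mono K_normal_ge) auto
  finally show ?thesis .
qed

text \<open>In the normal coordinate the scheme is the one-dimensional scheme with the push \<open>(1 + e) \<kappa>\<close>.\<close>

lemma normal_second_difference: "\<bar>\<phi> u2 - 2 * \<phi> u1 + \<phi> u0 + (1 + e) * \<kappa>\<bar> \<le> 2 * E * h\<^sup>2"
proof -
  have "\<phi> u2 - 2 * \<phi> u1 + \<phi> u0 + (1 + e) * \<kappa>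
      = (\<phi> u2 + e * \<phi> u0 - (1 + e) * \<phi> p) + ((1 + e) * \<phi> a - (2 * \<phi> u1 - (1 - e) * \<phi> u0))"
    unfolding \<phi>_p by (simp add: algebra_simps)
  then show ?thesis
    using defect_p defect_a by linarith
qed

lemma normal_after_projection: "\<phi> u2 + e * \<phi> u0 \<le> E * h\<^sup>2"
proof -
  have "(1 + e) * \<phi> p \<le> 0"
    using e unfolding \<phi>_p by (intro mult_nonneg_nonpos) auto
  then show ?thesis
    using defect_p by linarith
qed

lemma free_or_contact:
  "\<bar>\<phi> u2 - 2 * \<phi> u1 + \<phi> u0\<bar> \<le> 2 * E * h\<^sup>2 \<or>
   (\<bar>\<phi> u2 + e * \<phi> u0\<bar> \<le> E * h\<^sup>2 \<and> \<phi> u2 - 2 * \<phi> u1 + \<phi> u0 \<le> 2 * E * h\<^sup>2)"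
proof (cases "\<phi> a \<le> 0")
  case True
  then show ?thesis
    using normal_second_difference by simp
next
  case False
  then have "\<phi> p = 0"
    by (simp add: \<phi>_p)
  moreover have "0 \<le> (1 + e) * \<kappa>"
    using e by (intro mult_nonneg_nonneg) auto
  ultimately show ?thesis
    using defect_p normal_second_difference by (intro disjI2 conjI) (simp, linarith)
qed

lemma \<kappa>_le: "\<kappa> \<le> E * h"
proof -
  have "\<kappa> = n u1 \<bullet> (a - p) + err a - err p"
    using \<phi>_p by (simp add: err_def inner_simps)
  also have "n u1 \<bullet> (a - p) \<le> A * (4 * D * h)"
  proof -
    have "n u1 \<bullet> (a - p) \<le> norm (n u1) * norm (a - p)"
      by (rule norm_cauchy_schwarz)
    also have "\<dots> \<le> A * (4 * D * h)"
      using n_bound[OF u1_in] near_u1(1,2) norm_triangle_ineq4[of "a - u1" "p - u1"] A_ge_1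
      by (intro mult_mono) auto
    finally show ?thesis .
  qed
  finally have "\<kappa> \<le> A * (4 * D * h) + 2 * (A * (2 * D)\<^sup>2 * h\<^sup>2)"
    using err_le[OF near_u1(1)] err_le[OF near_u1(2)] by linarith
  also have "A * (2 * D)\<^sup>2 * h\<^sup>2 \<le> A * (2 * D)\<^sup>2 * h"
    using h A_ge_1 by (intro mult_left_mono) (auto simp: power2_eq_square mult_left_le)
  finally have "\<kappa> \<le> (2 * A * (2 * D) + 2 * A * (2 * D)\<^sup>2) * h"
    by (simp add: algebra_simps)
  also have "\<dots> \<le> E * h"
    using D_nonneg h by (intro mult_right_mono K_normal_ge) auto
  finally show ?thesis .
qed

text \<open>The push on the position is \<open>- (1 + e) \<kappa> b a\<close> and that on the normal coordinate is \<open>- (1 + e) \<kappa>\<close>;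
  subtracting \<open>b u1\<close> times the latter from the former leaves \<open>(1 + e) \<kappa> (b u1 - b a)\<close>, which is
  \<open>O(h\<^sup>2)\<close> because \<open>\<kappa>\<close> and \<open>u1 - a\<close> are \<open>O(h)\<close>.\<close>

lemma tangential_increment:
  "norm ((1 / h) *\<^sub>R (u2 - u1) - ((\<phi> u2 - \<phi> u1) / h) *\<^sub>R b u1
      - ((1 / h) *\<^sub>R (u1 - u0) - ((\<phi> u1 - \<phi> u0) / h) *\<^sub>R b u0)) \<le> K_tangential (2 * D) * h"
proof -
  let ?x = "\<phi> u2 - 2 * \<phi> u1 + \<phi> u0"
  define X where "X = (1 + e) *\<^sub>R (p - a + \<kappa> *\<^sub>R b a) + h\<^sup>2 *\<^sub>R f + ((1 + e) * \<kappa>) *\<^sub>R (b u1 - b a)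
    + (- (?x + (1 + e) * \<kappa>)) *\<^sub>R b u1"
  have second: "u2 - 2 *\<^sub>R u1 + u0 = (1 + e) *\<^sub>R (p - a) + h\<^sup>2 *\<^sub>R f"
  proof -
    have "(1 + e) *\<^sub>R (p - a) = (1 + e) *\<^sub>R (p - u1) - (1 + e) *\<^sub>R (a - u1)"
      by (simp add: algebra_simps)
    then show ?thesis
      unfolding p_combination a_combination by (simp add: algebra_simps scaleR_2)
  qed
  have X: "u2 - 2 *\<^sub>R u1 + u0 - ?x *\<^sub>R b u1 = X"
    unfolding second X_def by (simp add: algebra_simps)
  have Dh: "0 \<le> D * h" "0 \<le> 2 * D * h" "0 \<le> E * h"
    using D_nonneg h K_normal_nonneg by auto
  note aR = in_ball[OF near_u1(1)] and u0R = in_ball[OF near_u1(3)]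
  have "norm X \<le> norm ((1 + e) *\<^sub>R (p - a + \<kappa> *\<^sub>R b a)) + norm (h\<^sup>2 *\<^sub>R f)
      + norm (((1 + e) * \<kappa>) *\<^sub>R (b u1 - b a)) + norm ((- (?x + (1 + e) * \<kappa>)) *\<^sub>R b u1)"
    unfolding X_def by (intro norm_triangle_le add_mono order_refl)
  also have "norm ((1 + e) *\<^sub>R (p - a + \<kappa> *\<^sub>R b a)) \<le> 2 * (A * (E * h)\<^sup>2)"
  proof -
    have "norm (p - a + \<kappa> *\<^sub>R b a) \<le> A * \<kappa>\<^sup>2"
      unfolding p_def by (rule P_displacement[OF aR])
    also have "\<dots> \<le> A * (E * h)\<^sup>2"
      using A_ge_1 by (intro mult_left_mono power_mono \<kappa>_le) auto
    finally have "(1 + e) * norm (p - a + \<kappa> *\<^sub>R b a) \<le> 2 * (A * (E * h)\<^sup>2)"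
      using e by (intro mult_mono) auto
    then show ?thesis
      using e by simp
  qed
  also have "norm (h\<^sup>2 *\<^sub>R f) \<le> h\<^sup>2 * (2 * D)"
    using f D_nonneg by (auto intro!: mult_left_mono)
  also have "norm (((1 + e) * \<kappa>) *\<^sub>R (b u1 - b a)) \<le> (2 * (E * h)) * (A * (2 * D * h))"
  proof -
    have "norm (b u1 - b a) \<le> A * norm (u1 - a)"
      by (rule b_Lipschitz[OF u1_in aR])
    also have "\<dots> \<le> A * (2 * D * h)"
      using near_u1(1) A_ge_1 by (intro mult_left_mono) (auto simp: norm_minus_commute)
    finally have 1: "norm (b u1 - b a) \<le> A * (2 * D * h)" .
    have 2: "(1 + e) * \<kappa> \<le> 2 * (E * h)"
      using e \<kappa>_le by (intro mult_mono) auto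
    have "((1 + e) * \<kappa>) * norm (b u1 - b a) \<le> (2 * (E * h)) * (A * (2 * D * h))"
      by (rule mult_mono[OF 2 1]) (use Dh in auto)
    then show ?thesis
      using e by (simp add: abs_mult)
  qed
  also have "norm ((- (?x + (1 + e) * \<kappa>)) *\<^sub>R b u1) \<le> (2 * E * h\<^sup>2) * A"
    unfolding norm_scaleR abs_minus_cancel
    by (rule mult_mono[OF normal_second_difference b_bound[OF u1_in]]) (use K_normal_nonneg in auto)
  finally have NX: "norm X \<le> 2 * (A * (E * h)\<^sup>2) + h\<^sup>2 * (2 * D) + (2 * (E * h)) * (A * (2 * D * h)) + (2 * E * h\<^sup>2) * A"
    by simp
  have Y: "norm (((\<phi> u1 - \<phi> u0) / h) *\<^sub>R (b u1 - b u0)) \<le> E * (A * (2 * D * h))"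
  proof -
    have "\<bar>\<phi> u0 - \<phi> u1\<bar> \<le> A * norm (u0 - u1) + A * (norm (u0 - u1))\<^sup>2"
      by (rule \<phi>_increment[OF u1_in u0R])
    also have "\<dots> \<le> A * (2 * D * h) + A * (2 * D * h)\<^sup>2"
      using near_u1(3) A_ge_1 by (intro add_mono mult_left_mono power_mono) auto
    also have "\<dots> \<le> (2 * A * (2 * D) + 2 * A * (2 * D)\<^sup>2) * h"
    proof -
      have "A * (2 * D)\<^sup>2 * (h * h) \<le> A * (2 * D)\<^sup>2 * (1 * h)"
        using h A_ge_1 by (intro mult_left_mono mult_right_mono) auto
      moreover have "0 \<le> A * (2 * D * h)" "0 \<le> A * (2 * D)\<^sup>2 * h"
        using A_ge_1 Dh h by auto
      ultimately show ?thesis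
        by (simp add: power2_eq_square algebra_simps)
    qed
    also have "\<dots> \<le> E * h"
      using D_nonneg h by (intro mult_right_mono K_normal_ge) auto
    finally have 1: "\<bar>\<phi> u1 - \<phi> u0\<bar> / h \<le> E"
      using h by (simp add: field_simps abs_minus_commute)
    have "norm (b u1 - b u0) \<le> A * norm (u1 - u0)"
      by (rule b_Lipschitz[OF u1_in u0R])
    also have "\<dots> \<le> A * (2 * D * h)"
      using near_u1(3) A_ge_1 by (intro mult_left_mono) (auto simp: norm_minus_commute)
    finally have "(\<bar>\<phi> u1 - \<phi> u0\<bar> / h) * norm (b u1 - b u0) \<le> E * (A * (2 * D * h))"
      by (intro mult_mono 1 K_normal_nonneg) auto
    then show ?thesis
      using h by simp
  qed
  have split: "(1 / h) *\<^sub>R (u2 - u1) - ((\<phi> u2 - \<phi> u1) / h) *\<^sub>R b u1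
      - ((1 / h) *\<^sub>R (u1 - u0) - ((\<phi> u1 - \<phi> u0) / h) *\<^sub>R b u0)
      = (1 / h) *\<^sub>R X - ((\<phi> u1 - \<phi> u0) / h) *\<^sub>R (b u1 - b u0)"
  proof -
    define s where "s = (\<phi> u2 - \<phi> u1) / h"
    define t where "t = (\<phi> u1 - \<phi> u0) / h"
    have 1: "(1 / h) * ?x = s - t"
      by (simp add: s_def t_def diff_divide_distrib add_divide_distrib)
    have 2: "u2 - 2 *\<^sub>R u1 + u0 = (u2 - u1) - (u1 - u0)"
      by (simp add: scaleR_2)
    have "(1 / h) *\<^sub>R X = (1 / h) *\<^sub>R (u2 - u1) - (1 / h) *\<^sub>R (u1 - u0) - (s - t) *\<^sub>R b u1"
      by (simp only: X[symmetric] 2 scaleR_diff_right scaleR_scaleR 1)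
    then show ?thesis
      unfolding s_def[symmetric] t_def[symmetric] by (simp add: scaleR_diff_right scaleR_diff_left)
  qed
  have "norm ((1 / h) *\<^sub>R X - ((\<phi> u1 - \<phi> u0) / h) *\<^sub>R (b u1 - b u0))
      \<le> norm X / h + norm (((\<phi> u1 - \<phi> u0) / h) *\<^sub>R (b u1 - b u0))"
  proof -
    have "norm ((1 / h) *\<^sub>R X) = norm X / h"
      using h by simp
    then show ?thesis
      using norm_triangle_ineq4[of "(1 / h) *\<^sub>R X" "((\<phi> u1 - \<phi> u0) / h) *\<^sub>R (b u1 - b u0)"] by linarith
  qed
  also have "norm X / h \<le> (2 * (A * (E * h)\<^sup>2) + h\<^sup>2 * (2 * D) + (2 * (E * h)) * (A * (2 * D * h)) + (2 * E * h\<^sup>2) * A) / h"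
    using NX h by (intro divide_right_mono) auto
  also have "\<dots> = (2 * A * E\<^sup>2 + 2 * D + 2 * E * A * (2 * D) + 2 * E * A) * h"
    using h by (simp add: field_simps power2_eq_square)
  finally have "norm ((1 / h) *\<^sub>R X - ((\<phi> u1 - \<phi> u0) / h) *\<^sub>R (b u1 - b u0)) \<le> K_tangential (2 * D) * h"
    using Y by (simp add: K_tangential_def algebra_simps)
  then show ?thesis
    unfolding split .
qed

end

context regular_projection
begin

text \<open>At a contact step the restitution law gives \<open>w m \<ge> - e * w (m - 2)\<close> up to \<open>O(h)\<close>, whereas
  \<open>w m \<le> w (m - 1)\<close> up to \<open>O(h)\<close> because the push is inward; without contact \<open>w m\<close> differs from
  \<open>w (m - 1)\<close> by \<open>O(h)\<close>.  So the larger of two consecutive normal speeds grows by \<open>O(h)\<close> per step.\<close>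

lemma velocity_bound:
  fixes U f a :: "nat \<Rightarrow> real^'n" and e h D :: real
  assumes e: "0 \<le> e" "e \<le> 1" and h: "0 < h" "h \<le> 1"
    and V: "\<And>l. l \<le> k \<Longrightarrow> norm (U (l + 1) - U l) \<le> D * h"
    and inball: "\<And>l. l \<le> k \<Longrightarrow> U l \<in> cball z (R / 2)" and D: "2 * D * h \<le> R / 2"
    and f: "\<And>m. 1 \<le> m \<Longrightarrow> m \<le> k \<Longrightarrow> norm (f m) \<le> D"
    and a: "\<And>m. 1 \<le> m \<Longrightarrow> m \<le> k \<Longrightarrow>
      a m = (2 *\<^sub>R U m - (1 - e) *\<^sub>R U (m - 1) + h\<^sup>2 *\<^sub>R f m) /\<^sub>R (1 + e)"
    and step: "\<And>m. 1 \<le> m \<Longrightarrow> m \<le> k \<Longrightarrow> U (m + 1) = - (e *\<^sub>R U (m - 1)) + (1 + e) *\<^sub>R P (a m)"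
    and C2: "norm (U 1 - U 0) \<le> C2 * h" "norm (U 2 - U 1) \<le> C2 * h" "0 \<le> C2" and k: "1 \<le> k"
  shows "norm (U (k + 1) - U k) \<le>
    (C2 + 2 * A\<^sup>2 * (C2 + C2\<^sup>2) + (K_tangential (2 * D) + 2 * A * K_normal (2 * D)) * (real k * h)) * h"
proof -
  define x where "x m = \<phi> (U m)" for m
  define w where "w m = (x (m + 1) - x m) / h" for m
  define Q where "Q m = (1 / h) *\<^sub>R (U (m + 1) - U m) - w m *\<^sub>R b (U m)" for m
  let ?E = "K_normal (2 * D)"
  have E0: "0 \<le> ?E"
    by (rule K_normal_nonneg)
  have S: "norm (Q m - Q (m - 1)) \<le> K_tangential (2 * D) * h" "x (m + 1) + e * x (m - 1) \<le> ?E * h\<^sup>2"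
    "\<bar>x (m + 1) - 2 * x m + x (m - 1)\<bar> \<le> 2 * ?E * h\<^sup>2 \<or>
     (\<bar>x (m + 1) + e * x (m - 1)\<bar> \<le> ?E * h\<^sup>2 \<and> x (m + 1) - 2 * x m + x (m - 1) \<le> 2 * ?E * h\<^sup>2)"
    if m: "1 \<le> m" "m \<le> k" for m
  proof -
    have m1: "m - 1 \<le> k" "m - 1 + 1 = m"
      using m by auto
    interpret projection_step P \<phi> n b z R A e h D "U (m - 1)" "U m" "U (m + 1)" "f m" "a m" "P (a m)"
      using V[OF m1(1)] V[OF m(2)] f[OF m] a[OF m] step[OF m] inball[OF m(2)] D e h m1(2)
      by unfold_locales auto
    show "norm (Q m - Q (m - 1)) \<le> K_tangential (2 * D) * h"
      using tangential_increment m by (simp add: Q_def w_def x_def)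
    show "x (m + 1) + e * x (m - 1) \<le> ?E * h\<^sup>2"
      using normal_after_projection by (simp add: x_def)
    show "\<bar>x (m + 1) - 2 * x m + x (m - 1)\<bar> \<le> 2 * ?E * h\<^sup>2 \<or>
     (\<bar>x (m + 1) + e * x (m - 1)\<bar> \<le> ?E * h\<^sup>2 \<and> x (m + 1) - 2 * x m + x (m - 1) \<le> 2 * ?E * h\<^sup>2)"
      using free_or_contact by (simp add: x_def)
  qed
  have start: "\<bar>w m\<bar> \<le> A * (C2 + C2\<^sup>2)" if m: "m \<le> 1" for m
  proof -
    have d: "norm (U (m + 1) - U m) \<le> C2 * h"
      using m C2 by (cases m) (auto simp: numeral_2_eq_2)
    have mk: "m \<le> k"
      using m k by simp
    have "U m \<in> cball z R"
      using inball[OF mk] R_pos by auto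
    moreover have "U (m + 1) \<in> cball z R"
    proof -
      have "norm (U (m + 1) - U m) \<le> R / 2"
        using V[OF mk] D norm_ge_zero[of "U (m + 1) - U m"] by linarith
      then show ?thesis
        using inball[OF mk] norm_triangle_ineq[of "U (m + 1) - U m" "U m - z"]
        by (simp add: dist_norm norm_minus_commute)
    qed
    ultimately have "\<bar>x (m + 1) - x m\<bar> \<le> A * norm (U (m + 1) - U m) + A * (norm (U (m + 1) - U m))\<^sup>2"
      unfolding x_def by (rule \<phi>_increment)
    also have "\<dots> \<le> A * (C2 * h) + A * (C2 * h)\<^sup>2"
      using d A_ge_1 by (intro add_mono mult_left_mono power_mono) auto
    also have "\<dots> \<le> (A * (C2 + C2\<^sup>2)) * h"
    proof -
      have "A * C2\<^sup>2 * (h * h) \<le> A * C2\<^sup>2 * (1 * h)"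
        using h A_ge_1 by (intro mult_left_mono mult_right_mono) auto
      then show ?thesis
        by (simp add: power2_eq_square algebra_simps)
    qed
    finally show ?thesis
      using h by (simp add: w_def field_simps)
  qed
  have w: "\<bar>w m\<bar> \<le> A * (C2 + C2\<^sup>2) + 2 * ?E * (real m * h)" if "m \<le> k" for m
    using that
  proof (induction m rule: less_induct)
    case (less m)
    let ?b = "\<lambda>m. A * (C2 + C2\<^sup>2) + 2 * ?E * (real m * h)"
    have mono: "?b i + 2 * ?E * h \<le> ?b j" if "i < j" for i j
    proof -
      have "2 * ?E * ((real i + 1) * h) \<le> 2 * ?E * (real j * h)"
        using that h E0 by (intro mult_left_mono mult_right_mono) auto
      then show ?thesis
        by (simp add: algebra_simps)
    qed
    show ?case
    proof (cases "m \<le> 1")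
      case True
      then show ?thesis
        using start[OF True] E0 h by (smt (verit, best) mult_nonneg_nonneg of_nat_0_le_iff)
    next
      case False
      define i where "i = m - 2"
      have m: "m = i + 2" "m - 1 = i + 1" "m + 1 = i + 3"
        using False by (auto simp: i_def)
      have Eh: "2 * ?E * h\<^sup>2 = (2 * ?E * h) * h"
        by (simp add: power2_eq_square)
      have w1: "\<bar>w (i + 1)\<bar> \<le> ?b (i + 1)" and w0: "\<bar>w i\<bar> \<le> ?b i"
        using less.IH[of "i + 1"] less.IH[of i] less.prems by (simp_all add: m)
      have b1: "?b (i + 1) + 2 * ?E * h \<le> ?b m" and b0: "?b i + 2 * ?E * h \<le> ?b m"
        by (rule mono; simp add: m)+
      have wm: "w m * h = x (i + 3) - x (i + 2)" "w (i + 1) * h = x (i + 2) - x (i + 1)" "w i * h = x (i + 1) - x i"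
        using h by (auto simp: w_def m numeral_3_eq_3)
      have le: "c \<le> d" if "c * h \<le> d * h" for c d
        using that h by simp
      have S2: "x (i + 2) + e * x i \<le> ?E * h\<^sup>2"
        using S(2)[of "i + 1"] less.prems by (simp add: m)
      consider "\<bar>x (i + 3) - 2 * x (i + 2) + x (i + 1)\<bar> \<le> 2 * ?E * h\<^sup>2"
        | "\<bar>x (i + 3) + e * x (i + 1)\<bar> \<le> ?E * h\<^sup>2" "x (i + 3) - 2 * x (i + 2) + x (i + 1) \<le> 2 * ?E * h\<^sup>2"
        using S(3)[of m] less.prems m by (auto simp: numeral_3_eq_3)
      then show ?thesis
      proof cases
        case 1
        then have "\<bar>w m * h - w (i + 1) * h\<bar> \<le> (2 * ?E * h) * h"
          unfolding wm Eh by linarith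
        then have "w m * h \<le> (w (i + 1) + 2 * ?E * h) * h" "(w (i + 1) - 2 * ?E * h) * h \<le> w m * h"
          by (simp_all add: algebra_simps abs_le_iff)
        then have "w m \<le> w (i + 1) + 2 * ?E * h" "w (i + 1) - 2 * ?E * h \<le> w m"
          by (blast intro: le)+
        then show ?thesis
          using w1 b1 by linarith
      next
        case 2
        have "w m * h \<le> (w (i + 1) + 2 * ?E * h) * h"
        proof -
          have "(w (i + 1) + 2 * ?E * h) * h = w (i + 1) * h + 2 * ?E * h\<^sup>2"
            unfolding Eh by (rule distrib_right)
          then show ?thesis
            using 2(2) wm by linarith
        qed
        moreover have "(- (e * w i) - 2 * ?E * h) * h \<le> w m * h"
        proof -
          have "(- (e * w i) - 2 * ?E * h) * h = - e * (w i * h) - 2 * ?E * h\<^sup>2"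
            by (simp add: power2_eq_square algebra_simps)
          also have "\<dots> \<le> w m * h"
            unfolding wm using 2(1) S2 by (simp add: algebra_simps abs_le_iff)
          finally show ?thesis .
        qed
        ultimately have "w m \<le> w (i + 1) + 2 * ?E * h" "- (e * w i) - 2 * ?E * h \<le> w m"
          by (blast intro: le)+
        moreover have "e * w i \<le> \<bar>w i\<bar>"
          using e mult_right_mono[of e 1 "\<bar>w i\<bar>"] mult_left_mono[OF abs_ge_self, of e "w i"] by simp
        ultimately show ?thesis
          using w1 w0 b1 b0 by linarith
      qed
    qed
  qed
  have Q: "norm (Q m) \<le> norm (Q 0) + K_tangential (2 * D) * (real m * h)" if "m \<le> k" for m
    using that
  proof (induction m)
    case (Suc m)
    have "norm (Q (Suc m)) \<le> norm (Q m) + norm (Q (Suc m) - Q m)"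
      using norm_triangle_ineq[of "Q m" "Q (Suc m) - Q m"] by simp
    then show ?case
      using Suc S(1)[of "Suc m"] by (simp add: algebra_simps)
  qed simp
  have b_le: "norm (b (U m)) \<le> A" if "m \<le> k" for m
    using b_bound[of "U m"] inball[OF that] R_pos by auto
  have w0: "\<bar>w 0\<bar> \<le> A * (C2 + C2\<^sup>2)"
    by (rule start) simp
  have "norm (Q 0) \<le> norm ((1 / h) *\<^sub>R (U 1 - U 0)) + norm (w 0 *\<^sub>R b (U 0))"
    unfolding Q_def by (rule order_trans[OF norm_triangle_ineq4]) simp
  also have "\<dots> \<le> C2 + A * (C2 + C2\<^sup>2) * A"
  proof (rule add_mono)
    show "norm ((1 / h) *\<^sub>R (U 1 - U 0)) \<le> C2"
      using C2(1) h by (simp add: pos_divide_le_eq)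
    show "norm (w 0 *\<^sub>R b (U 0)) \<le> A * (C2 + C2\<^sup>2) * A"
      unfolding norm_scaleR by (rule mult_mono[OF w0 b_le]) (use A_ge_1 C2 in auto)
  qed
  finally have Q0: "norm (Q 0) \<le> C2 + A * (C2 + C2\<^sup>2) * A" .
  have "norm ((1 / h) *\<^sub>R (U (k + 1) - U k)) = norm (Q k + w k *\<^sub>R b (U k))"
    by (simp add: Q_def)
  also have "\<dots> \<le> norm (Q k) + \<bar>w k\<bar> * norm (b (U k))"
    using norm_triangle_ineq[of "Q k" "w k *\<^sub>R b (U k)"] by simp
  also have "\<dots> \<le> (C2 + A * (C2 + C2\<^sup>2) * A + K_tangential (2 * D) * (real k * h))
      + (A * (C2 + C2\<^sup>2) + 2 * ?E * (real k * h)) * A"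
  proof (rule add_mono)
    show "norm (Q k) \<le> C2 + A * (C2 + C2\<^sup>2) * A + K_tangential (2 * D) * (real k * h)"
      using Q[of k] Q0 by simp
    show "\<bar>w k\<bar> * norm (b (U k)) \<le> (A * (C2 + C2\<^sup>2) + 2 * ?E * (real k * h)) * A"
      by (rule mult_mono[OF w b_le]) (use A_ge_1 C2 E0 h in auto)
  qed
  also have "\<dots> = C2 + 2 * A\<^sup>2 * (C2 + C2\<^sup>2) + (K_tangential (2 * D) + 2 * A * ?E) * (real k * h)"
    by (simp add: power2_eq_square algebra_simps)
  finally show ?thesis
    using h by (simp add: pos_divide_le_eq)
qed

text \<open>The implicit unknown enters the argument of \<open>P\<close> with a factor \<open>O(h)\<close>, so the step is a contraction.\<close>

lemma step_contraction:
  fixes e h \<Phi> r :: real and u0 u1 :: "real^'n" and G :: "real^'n \<Rightarrow> real^'n"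
  defines "a \<equiv> \<lambda>u. (2 *\<^sub>R u1 - (1 - e) *\<^sub>R u0 + h\<^sup>2 *\<^sub>R G u) /\<^sub>R (1 + e)"
  assumes e: "0 \<le> e" "e \<le> 1" and h: "0 < h"
    and G: "norm (G u - G v) \<le> \<Phi> * (norm (u - v) / (2 * h))"
    and inball: "a u \<in> cball z R" "a v \<in> cball z R" and small: "2 * A * \<Phi> * h \<le> 1"
  shows "norm ((- (e *\<^sub>R u0) + (1 + e) *\<^sub>R P (a u)) - (- (e *\<^sub>R u0) + (1 + e) *\<^sub>R P (a v))) \<le> 1 / 2 * norm (u - v)"
proof -
  have "(- (e *\<^sub>R u0) + (1 + e) *\<^sub>R P (a u)) - (- (e *\<^sub>R u0) + (1 + e) *\<^sub>R P (a v)) = (1 + e) *\<^sub>R (P (a u) - P (a v))"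
    by (simp add: scaleR_diff_right)
  then have "norm ((- (e *\<^sub>R u0) + (1 + e) *\<^sub>R P (a u)) - (- (e *\<^sub>R u0) + (1 + e) *\<^sub>R P (a v)))
      = (1 + e) * norm (P (a u) - P (a v))"
    using e by simp
  also have "\<dots> \<le> (1 + e) * (A * norm (a u - a v))"
    using e by (intro mult_left_mono P_Lipschitz inball) auto
  also have "a u - a v = (h\<^sup>2 / (1 + e)) *\<^sub>R (G u - G v)"
    unfolding a_def by (simp add: scaleR_add_right scaleR_diff_right divide_inverse mult.commute)
  also have "norm ((h\<^sup>2 / (1 + e)) *\<^sub>R (G u - G v)) = h\<^sup>2 / (1 + e) * norm (G u - G v)"
    using e by simp
  also have "(1 + e) * (A * (h\<^sup>2 / (1 + e) * norm (G u - G v))) = A * h\<^sup>2 * norm (G u - G v)"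
    using e by (simp add: add_pos_nonneg less_imp_neq[symmetric])
  also have "\<dots> \<le> A * h\<^sup>2 * (\<Phi> * (norm (u - v) / (2 * h)))"
    using A_ge_1 by (intro mult_left_mono G) auto
  also have "\<dots> = (2 * A * \<Phi> * h) * (1 / 4 * norm (u - v))"
    using h by (simp add: power2_eq_square)
  also have "\<dots> \<le> 1 * (1 / 4 * norm (u - v))"
    by (intro mult_right_mono small) auto
  finally show ?thesis
    using norm_ge_zero[of "u - v"] by linarith
qed

lemma argument_near:
  fixes f :: "real^'n"
  assumes e: "0 \<le> e" "e \<le> 1" and h: "0 < h" "h \<le> 1"
    and v: "norm (u1 - u0) \<le> C * h" and f: "norm f \<le> \<Phi>"
  shows "norm ((2 *\<^sub>R u1 - (1 - e) *\<^sub>R u0 + h\<^sup>2 *\<^sub>R f) /\<^sub>R (1 + e) - u1) \<le> C * h + \<Phi> * h\<^sup>2"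
proof -
  let ?a = "(2 *\<^sub>R u1 - (1 - e) *\<^sub>R u0 + h\<^sup>2 *\<^sub>R f) /\<^sub>R (1 + e)"
  have "(1 + e) *\<^sub>R ?a = 2 *\<^sub>R u1 - (1 - e) *\<^sub>R u0 + h\<^sup>2 *\<^sub>R f"
    using e by simp
  then have "(1 + e) *\<^sub>R (?a - u1) = (1 - e) *\<^sub>R (u1 - u0) + h\<^sup>2 *\<^sub>R f"
    by (simp only: scaleR_diff_right) (simp add: algebra_simps scaleR_2)
  then have "(1 + e) * norm (?a - u1) = norm ((1 - e) *\<^sub>R (u1 - u0) + h\<^sup>2 *\<^sub>R f)"
    using e by (metis abs_of_nonneg add_nonneg_nonneg norm_scaleR zero_le_one)
  also have "\<dots> \<le> (1 - e) * norm (u1 - u0) + h\<^sup>2 * norm f"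
    using e norm_triangle_ineq[of "(1 - e) *\<^sub>R (u1 - u0)" "h\<^sup>2 *\<^sub>R f"] by simp
  also have "\<dots> \<le> 1 * (C * h) + h\<^sup>2 * \<Phi>"
    using e v f by (intro add_mono mult_mono) auto
  finally have "(1 + e) * norm (?a - u1) \<le> C * h + \<Phi> * h\<^sup>2"
    by (simp add: mult.commute)
  moreover have "1 * norm (?a - u1) \<le> (1 + e) * norm (?a - u1)"
    using e by (intro mult_right_mono) auto
  ultimately show ?thesis
    by linarith
qed

text \<open>The projection is only controlled through its Lipschitz constant, so a reference point \<open>y\<close> in \<open>K\<close>
  within \<open>O(h)\<close> is needed; the previous projected point will serve. This gives a ball that the
  step maps into itself, with a radius that may exceed \<open>C * h\<close>; the sharper bound on the new
  velocity comes afterwards from \<open>velocity_bound\<close>.\<close>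

lemma step_exists:
  fixes e h C \<Phi> :: real and u0 u1 y :: "real^'n" and G :: "real^'n \<Rightarrow> real^'n"
  defines "a \<equiv> \<lambda>u. (2 *\<^sub>R u1 - (1 - e) *\<^sub>R u0 + h\<^sup>2 *\<^sub>R G u) /\<^sub>R (1 + e)"
    and "r \<equiv> (11 * A * C + 1) * h"
  assumes e: "0 \<le> e" "e \<le> 1" and h: "0 < h" "h \<le> 1" and C: "0 \<le> C"
    and v: "norm (u1 - u0) \<le> C * h"
    and G: "\<And>u. u \<in> cball u1 r \<Longrightarrow> norm (G u) \<le> \<Phi>"
      "\<And>u v. u \<in> cball u1 r \<Longrightarrow> v \<in> cball u1 r \<Longrightarrow> norm (G u - G v) \<le> \<Phi> * (norm (u - v) / (2 * h))"
    and small: "2 * A * \<Phi> * h \<le> 1" and u1: "\<And>x. norm (x - u1) \<le> (2 * C + \<Phi>) * h \<Longrightarrow> x \<in> cball z R"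
    and y: "norm (y - u1) \<le> 2 * C * h" "\<phi> y \<le> 0" "0 \<le> \<Phi>"
  obtains u where "u \<in> cball u1 r" "u = - (e *\<^sub>R u0) + (1 + e) *\<^sub>R P (a u)"
proof -
  define S where "S u = - (e *\<^sub>R u0) + (1 + e) *\<^sub>R P (a u)" for u
  have h2: "h\<^sup>2 \<le> h"
    using h by (simp add: power2_eq_square mult_left_le)
  have Ch: "0 \<le> C * h" "0 \<le> \<Phi> * h"
    using C h y by auto
  have a_near: "norm (a u - u1) \<le> C * h + \<Phi> * h\<^sup>2" if "u \<in> cball u1 r" for u
    unfolding a_def by (rule argument_near[OF e h v G(1)[OF that]])
  have aR: "a u \<in> cball z R" if "u \<in> cball u1 r" for u
  proof (rule u1)
    have "\<Phi> * h\<^sup>2 \<le> \<Phi> * h"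
      by (intro mult_left_mono h2 y)
    then show "norm (a u - u1) \<le> (2 * C + \<Phi>) * h"
      using a_near[OF that] Ch by (simp add: algebra_simps)
  qed
  have yR: "y \<in> cball z R"
  proof (rule u1)
    show "norm (y - u1) \<le> (2 * C + \<Phi>) * h"
      using y(1) Ch by (simp add: algebra_simps)
  qed
  have Py: "P y = y"
    by (rule fixed_point_of_P[OF yR y(2)])
  have "\<exists>!u. u \<in> cball u1 r \<and> S u = u"
  proof (rule Banach_fix[of _ "1 / 2"])
    show "complete (cball u1 r)"
      by (simp add: complete_eq_closed)
    have "0 \<le> r"
      using A_ge_1 C h by (simp add: r_def)
    then show "cball u1 r \<noteq> {}"
      by simp
    show "S ` cball u1 r \<subseteq> cball u1 r"
    proof safe
      fix u
      assume u: "u \<in> cball u1 r"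
      have "norm (P (a u) - u1) \<le> norm (P (a u) - P y) + norm (y - u1)"
        using norm_triangle_ineq[of "P (a u) - P y" "y - u1"] by (simp add: Py)
      also have "norm (P (a u) - P y) \<le> A * norm (a u - y)"
        by (rule P_Lipschitz[OF aR[OF u] yR])
      also have "norm (a u - y) \<le> (C * h + \<Phi> * h\<^sup>2) + 2 * C * h"
        using a_near[OF u] y(1) norm_triangle_ineq4[of "a u - u1" "y - u1"] by simp
      finally have Pu: "norm (P (a u) - u1) \<le> A * ((C * h + \<Phi> * h\<^sup>2) + 2 * C * h) + 2 * C * h"
        using y(1) A_ge_1 by (smt (verit) mult_left_mono)
      have "S u - u1 = e *\<^sub>R (u1 - u0) + (1 + e) *\<^sub>R (P (a u) - u1)"
        by (simp add: S_def algebra_simps)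
      then have "norm (S u - u1) \<le> e * norm (u1 - u0) + (1 + e) * norm (P (a u) - u1)"
        using e norm_triangle_ineq[of "e *\<^sub>R (u1 - u0)" "(1 + e) *\<^sub>R (P (a u) - u1)"] by simp
      also have "\<dots> \<le> 1 * (C * h) + 2 * (A * ((C * h + \<Phi> * h\<^sup>2) + 2 * C * h) + 2 * C * h)"
        using e v Pu Ch by (intro add_mono mult_mono) auto
      also have "\<dots> = 5 * (C * h) + 6 * (A * (C * h)) + (2 * A * \<Phi> * h) * h"
        by (simp add: power2_eq_square algebra_simps)
      also have "\<dots> \<le> 5 * (A * (C * h)) + 6 * (A * (C * h)) + 1 * h"
        using small h Ch A_ge_1 mult_right_mono[of 1 A "C * h"] by (intro add_mono mult_right_mono) auto
      finally show "S u \<in> cball u1 r"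
        by (simp add: r_def dist_norm norm_minus_commute algebra_simps)
    qed
    show "dist (S u) (S v) \<le> 1 / 2 * dist u v" if "u \<in> cball u1 r" "v \<in> cball u1 r" for u v
      unfolding S_def dist_norm a_def
      by (rule step_contraction[OF e h(1) G(2)[OF that] _ _ small])
         (use aR that in \<open>auto simp: a_def\<close>)
  qed auto
  then show ?thesis
    using that by (metis S_def)
qed

end

section \<open>The scheme near one point\<close>

lemma norm_divideR: "0 < h \<Longrightarrow> norm (v /\<^sub>R h) = norm v / h"
  for v :: "'a::real_normed_vector"
  by (simp add: divide_inverse mult.commute)

lemma norm_divideR_le_iff: "0 < h \<Longrightarrow> norm (v /\<^sub>R h) \<le> c \<longleftrightarrow> norm v \<le> c * h"
  for v :: "'a::real_normed_vector"
  by (simp only: norm_divideR pos_divide_le_eq)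

context regular_projection
begin

text \<open>The velocity bound \<open>C3\<close> may be any sufficiently large number, so that finitely many neighbourhoods
  can share it; only the bound \<open>\<delta>\<close> on \<open>\<tau>\<close> and \<open>h\<close> depends on the choice.\<close>

lemma local_scheme:
  fixes F :: "real \<Rightarrow> real^'n \<Rightarrow> real^'n \<Rightarrow> real^'n \<Rightarrow> real \<Rightarrow> real^'n" and e hs T C2 C3 :: real
  assumes P: "P = proj M K" and dom: "cball z R \<subseteq> proj_dom M K"
    and e: "0 \<le> e" "e \<le> 1" and hs: "0 < hs" "hs \<le> 1" and C2: "0 < C2"
    and F: "\<And>C. 0 \<le> C \<Longrightarrow> \<exists>\<Phi>\<ge>0. \<forall>t\<in>{0..T}. \<forall>h\<in>{0..hs}. \<forall>u\<in>cball z R. \<forall>u'\<in>cball z R. \<forall>v\<in>cball 0 C. \<forall>v'\<in>cball 0 C.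
      norm (F t u u' v h) \<le> \<Phi> \<and> norm (F t u u' v h - F t u u' v' h) \<le> \<Phi> * norm (v - v')"
    and C3: "C2 + 2 * A\<^sup>2 * (C2 + C2\<^sup>2) + 1 \<le> C3"
  shows "\<exists>\<delta>>0. \<forall>\<tau> t0 h U0 U1 U2. 0 < \<tau> \<and> \<tau> \<le> \<delta> \<and> 0 \<le> t0 \<and> 0 < h \<and> h \<le> \<delta> \<and> h \<le> hs \<and> U0 \<in> cball z (R / 8) \<and>
    norm (U1 - U0) \<le> C2 * h \<and> first_step M K e F h (t0 + h) U0 U1 U2 \<and> norm (U2 - U1) \<le> C2 * h \<longrightarrow>
    (let n = nat \<lfloor>min \<tau> (T - t0) / h\<rfloor> in
       \<exists>U. scheme_solution M K e F t0 h C3 n U0 U1 U \<and>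
         (\<forall>W. scheme_solution M K e F t0 h C3 n U0 U1 W \<longrightarrow> (\<forall>m\<le>n. W m = U m)))"
proof -
  define C4 where "C4 = 11 * A * C3 + 1"
  have C23: "C2 \<le> C3" and C3_pos: "0 < C3"
  proof -
    have "0 \<le> 2 * A\<^sup>2 * (C2 + C2\<^sup>2)"
      using C2 by (intro mult_nonneg_nonneg add_nonneg_nonneg) auto
    then show "C2 \<le> C3" "0 < C3"
      using C3 C2 by linarith+
  qed
  have C34: "C3 \<le> C4"
  proof -
    have "1 * C3 \<le> A * C3"
      using A_ge_1 C3_pos by (intro mult_right_mono) auto
    then show ?thesis
      unfolding C4_def using C3_pos by linarith
  qed
  have "0 \<le> C4"
    using C34 C3_pos by simp
  from F[OF this] obtain \<Phi> where \<Phi>0: "0 \<le> \<Phi>" and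
    \<Phi>_all: "\<forall>t\<in>{0..T}. \<forall>h\<in>{0..hs}. \<forall>u\<in>cball z R. \<forall>u'\<in>cball z R. \<forall>v\<in>cball 0 C4. \<forall>v'\<in>cball 0 C4.
      norm (F t u u' v h) \<le> \<Phi> \<and> norm (F t u u' v h - F t u u' v' h) \<le> \<Phi> * norm (v - v')"
    by (elim exE conjE)
  note \<Phi> = \<Phi>_all[rule_format]
  define D where "D = C4 + \<Phi>"
  have D: "C4 \<le> D" "\<Phi> \<le> D" "0 < D"
    using \<Phi>0 C34 C3_pos by (auto simp: D_def)
  define B where "B = K_tangential (2 * D) + 2 * A * K_normal (2 * D)"
  have "eventually (\<lambda>\<delta>. 1 * \<delta> < 1 \<and> 2 * D * \<delta> < R / 8 \<and> 2 * A * \<Phi> * \<delta> < 1 \<and> B * \<delta> < 1 \<and> C3 * \<delta> < R / 8) (at_right 0)"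
    by (intro eventually_conj eventually_linear_less) (use R_pos in auto)
  with eventually_at_right_less[of 0]
  have "eventually (\<lambda>\<delta>. 0 < \<delta> \<and> \<delta> < 1 \<and> 2 * D * \<delta> < R / 8 \<and> 2 * A * \<Phi> * \<delta> < 1 \<and> B * \<delta> < 1 \<and> C3 * \<delta> < R / 8) (at_right 0)"
    by eventually_elim auto
  then obtain \<delta> where \<delta>: "0 < \<delta>" "\<delta> < 1" "2 * D * \<delta> < R / 8" "2 * A * \<Phi> * \<delta> < 1" "B * \<delta> < 1" "C3 * \<delta> < R / 8"
    using eventually_happens'[OF trivial_limit_at_right_real] by blast
  have B0: "0 \<le> B"
    unfolding B_def K_tangential_def using A_ge_1 D K_normal_nonneg[of "2 * D"] by auto
  show ?thesis
  proof (intro exI[of _ \<delta>] conjI allI impI \<delta>(1))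
    fix \<tau> t0 h :: real and U0 U1 U2 :: "real^'n"
    assume "0 < \<tau> \<and> \<tau> \<le> \<delta> \<and> 0 \<le> t0 \<and> 0 < h \<and> h \<le> \<delta> \<and> h \<le> hs \<and> U0 \<in> cball z (R / 8) \<and>
      norm (U1 - U0) \<le> C2 * h \<and> first_step M K e F h (t0 + h) U0 U1 U2 \<and> norm (U2 - U1) \<le> C2 * h"
    then have \<tau>: "0 < \<tau>" "\<tau> \<le> \<delta>" and t0: "0 \<le> t0" and h: "0 < h" "h \<le> \<delta>" "h \<le> hs"
      and U0: "U0 \<in> cball z (R / 8)" and V0: "norm (U1 - U0) \<le> C2 * h"
      and first: "first_step M K e F h (t0 + h) U0 U1 U2" and V1: "norm (U2 - U1) \<le> C2 * h"
      by auto
    define n where "n = nat \<lfloor>min \<tau> (T - t0) / h\<rfloor>"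
    have n: "real m * h \<le> \<tau>" "t0 + real m * h \<le> T" if "m \<le> n" "1 \<le> m" for m
    proof -
      have "n \<noteq> 0"
        using that by simp
      then have "0 \<le> \<lfloor>min \<tau> (T - t0) / h\<rfloor>"
        unfolding n_def by linarith
      then have "real n \<le> min \<tau> (T - t0) / h"
        unfolding n_def by simp
      then have "real m \<le> min \<tau> (T - t0) / h"
        using that by linarith
      then have "real m * h \<le> min \<tau> (T - t0)"
        using h by (simp add: field_simps)
      then show "real m * h \<le> \<tau>" "t0 + real m * h \<le> T"
        by auto
    qed
    have h1: "h \<le> 1"
      using h \<delta> by simp
    have small: "2 * D * h \<le> R / 8" "2 * A * \<Phi> * h \<le> 1"
    proof -
      have "2 * D * h \<le> 2 * D * \<delta>" "2 * A * \<Phi> * h \<le> 2 * A * \<Phi> * \<delta>"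
        using h D \<Phi>0 A_ge_1 by (intro mult_left_mono; simp)+
      then show "2 * D * h \<le> R / 8" "2 * A * \<Phi> * h \<le> 1"
        using \<delta> by auto
    qed
    have C4h: "C3 * h \<le> C4 * h" "C4 * h \<le> D * h" "0 \<le> D * h" "C2 * h \<le> C3 * h"
      using C34 D h C23 by (auto intro!: mult_right_mono)
    define sol where "sol k U \<longleftrightarrow> scheme_solution M K e F t0 h C3 k U0 U1 U" for k U
    define arg where "arg m U u = (2 *\<^sub>R U m - (1 - e) *\<^sub>R U (m - 1) + h\<^sup>2 *\<^sub>R
      F (t0 + real m * h) (U m) (U (m - 1)) ((u - U (m - 1)) /\<^sub>R (2 * h)) h) /\<^sub>R (1 + e)"
      for m and U :: "nat \<Rightarrow> real^'n" and u
    have sol_iff: "sol k U \<longleftrightarrow> U 0 = U0 \<and> U 1 = U1 \<and>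
      (\<forall>m. 1 \<le> m \<and> m < k \<longrightarrow> arg m U (U (m + 1)) \<in> proj_dom M K \<and>
         U (m + 1) = - (e *\<^sub>R U (m - 1)) + (1 + e) *\<^sub>R P (arg m U (U (m + 1)))) \<and>
      (\<forall>l<k. norm (U (l + 1) - U l) \<le> C3 * h)" for k U
    proof -
      have "norm ((U (l + 1) - U l) /\<^sub>R h) \<le> C3 \<longleftrightarrow> norm (U (l + 1) - U l) \<le> C3 * h" for l
        by (rule norm_divideR_le_iff[OF h(1)])
      then show ?thesis
        by (simp add: sol_def scheme_solution_def scheme_arg_def arg_def Let_def P)
    qed
    have pos: "U m \<in> cball z (R / 4)" if "\<And>l. l < m \<Longrightarrow> norm (U (l + 1) - U l) \<le> C3 * h" "U 0 = U0" "real m * h \<le> \<tau>"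
      for m and U :: "nat \<Rightarrow> real^'n"
    proof -
      have "norm (U m - U0) \<le> real m * (C3 * h)"
        using that(1)
      proof (induction m)
        case (Suc m)
        have "norm (U (Suc m) - U0) \<le> norm (U (m + 1) - U m) + norm (U m - U0)"
          using norm_triangle_ineq[of "U (m + 1) - U m" "U m - U0"] by simp
        then show ?case
          using Suc.IH Suc.prems by (simp add: distrib_right) (meson add_mono less_Suc_eq lessI order_trans)
      qed (simp add: that(2))
      also have "\<dots> = C3 * (real m * h)"
        by simp
      also have "\<dots> \<le> C3 * \<delta>"
        using that(3) \<tau> C3_pos by (intro mult_left_mono) auto
      finally show ?thesis
        using \<delta> U0 norm_triangle_ineq[of "U m - U0" "U0 - z"] by (simp add: dist_norm norm_minus_commute)
    qed
    have near: "x \<in> cball z R" if "norm (x - u) \<le> 2 * D * h" "u \<in> cball z (R / 2)" for x u :: "real^'n"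
      using that small(1) R_pos norm_triangle_ineq[of "x - u" "u - z"] by (simp add: dist_norm norm_minus_commute)
    have vel: "(u - u0) /\<^sub>R (2 * h) \<in> cball 0 C4"
      if "norm (u1 - u0) \<le> C4 * h" "norm (u - u1) \<le> C4 * h" for u u0 u1 :: "real^'n"
    proof -
      have "norm (u - u0) \<le> C4 * (2 * h)"
        using that norm_triangle_ineq[of "u - u1" "u1 - u0"] by simp
      then show ?thesis
        using norm_divideR_le_iff[of "2 * h" "u - u0" C4] h by simp
    qed
    have force: "norm (F t u1 u0 ((u - u0) /\<^sub>R (2 * h)) h) \<le> \<Phi>"
      "norm (F t u1 u0 ((u - u0) /\<^sub>R (2 * h)) h - F t u1 u0 ((v - u0) /\<^sub>R (2 * h)) h) \<le> \<Phi> * (norm (u - v) / (2 * h))"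
      if t: "t \<in> {0..T}" and u1: "u1 \<in> cball z (R / 2)" and u0: "norm (u1 - u0) \<le> C3 * h"
        and u: "norm (u - u1) \<le> C4 * h" and v: "norm (v - u1) \<le> C4 * h" for t u1 u0 u v
    proof -
      have u0': "norm (u1 - u0) \<le> C4 * h"
        using u0 C4h by simp
      have "norm (u0 - u1) \<le> 2 * D * h"
        using u0 C4h by (simp add: norm_minus_commute)
      then have u0R: "u0 \<in> cball z R"
        by (rule near[OF _ u1])
      have u1R: "u1 \<in> cball z R"
        using u1 R_pos by auto
      have hI: "h \<in> {0..hs}"
        using h by simp
      have both: "norm (F t u1 u0 ((u - u0) /\<^sub>R (2 * h)) h) \<le> \<Phi> \<and>
          norm (F t u1 u0 ((u - u0) /\<^sub>R (2 * h)) h - F t u1 u0 ((v - u0) /\<^sub>R (2 * h)) h)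
            \<le> \<Phi> * norm ((u - u0) /\<^sub>R (2 * h) - (v - u0) /\<^sub>R (2 * h))"
        by (rule \<Phi>[OF t hI u1R u0R vel[OF u0' u] vel[OF u0' v]])
      then show "norm (F t u1 u0 ((u - u0) /\<^sub>R (2 * h)) h) \<le> \<Phi>"
        by (rule conjunct1)
      have "(u - u0) /\<^sub>R (2 * h) - (v - u0) /\<^sub>R (2 * h) = (u - v) /\<^sub>R (2 * h)"
        by (simp only: scaleR_diff_right[symmetric]) simp
      then have "norm ((u - u0) /\<^sub>R (2 * h) - (v - u0) /\<^sub>R (2 * h)) = norm (u - v) / (2 * h)"
        using h by (simp only: norm_divideR)
      then show "norm (F t u1 u0 ((u - u0) /\<^sub>R (2 * h)) h - F t u1 u0 ((v - u0) /\<^sub>R (2 * h)) h) \<le> \<Phi> * (norm (u - v) / (2 * h))"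
        using conjunct2[OF both] by (simp only:)
    qed
    have arg_near: "norm (arg m U u - U m) \<le> D * h"
      if t: "t0 + real m * h \<in> {0..T}" and u1: "U m \<in> cball z (R / 2)"
        and u0: "norm (U m - U (m - 1)) \<le> C3 * h" and u: "norm (u - U m) \<le> C4 * h" for m U u
    proof -
      have "norm (arg m U u - U m) \<le> C3 * h + \<Phi> * h\<^sup>2"
        unfolding arg_def by (rule argument_near[OF e h(1) h1 u0 force(1)[OF t u1 u0 u u]])
      also have "\<Phi> * h\<^sup>2 \<le> \<Phi> * h"
        using h h1 \<Phi>0 by (intro mult_left_mono) (auto simp: power2_eq_square mult_left_le)
      finally show ?thesis
        using C4h by (simp add: D_def algebra_simps)
    qed
    have time: "t0 + real m * h \<in> {0..T}" if "1 \<le> m" "m \<le> n" for m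
      using n[OF that(2,1)] t0 h by simp
    have half: "x \<in> cball z (R / 2)" if "x \<in> cball z (R / 4)" for x
      using that R_pos by auto
    have near2: "x \<in> cball z R" if "norm (x - u) \<le> D * h" "u \<in> cball z (R / 2)" for x u :: "real^'n"
      using near[of x u] that C4h(3) by simp
    have exists: "\<exists>U. sol k U \<and> (2 \<le> k \<longrightarrow> U 2 = U2)" if "k \<le> n" for k
      using that
    proof (induction k)
      case 0
      then show ?case
        by (intro exI[of _ "\<lambda>i. if i = 0 then U0 else U1"]) (simp add: sol_iff)
    next
      case (Suc m)
      then obtain U where U: "sol m U" "2 \<le> m \<longrightarrow> U 2 = U2"
        by auto
      show ?case
      proof (cases "m \<le> 1")
        case True
        define W where "W i = (if i = 0 then U0 else if i = 1 then U1 else U2)" for i :: nat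
        have W: "W 0 = U0" "W 1 = U1" "W (Suc 0) = U1" "W 2 = U2"
          by (auto simp: W_def)
        have eq: "scheme_arg e F h (t0 + h) U0 U1 U2 = arg 1 W (W 2)"
          by (simp add: scheme_arg_def arg_def W)
        have "(U2 + e *\<^sub>R U0) /\<^sub>R (1 + e) = P (arg 1 W (W 2))" "arg 1 W (W 2) \<in> proj_dom M K"
          using first by (auto simp: first_step_def eq P)
        moreover have "U2 + e *\<^sub>R U0 = (1 + e) *\<^sub>R ((U2 + e *\<^sub>R U0) /\<^sub>R (1 + e))"
          using e by simp
        ultimately have "U2 = - (e *\<^sub>R U0) + (1 + e) *\<^sub>R P (arg 1 W (W 2))"
          by (metis add.commute add_diff_cancel_right' uminus_add_conv_diff)
        with \<open>arg 1 W (W 2) \<in> proj_dom M K\<close> have "sol (Suc m) W"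
          unfolding sol_iff using True W V0 V1 C4h(4)
          by (auto simp: less_Suc_eq le_Suc_eq numeral_2_eq_2)
        then show ?thesis
          using W by auto
      next
        case False
        then have m2: "2 \<le> m" "m \<le> n" "1 \<le> m" "1 \<le> m - 1" "m - 1 < m"
          using Suc.prems by auto
        have Usol: "U 0 = U0" "U 1 = U1" and
          Ustep: "\<And>l. 1 \<le> l \<Longrightarrow> l < m \<Longrightarrow> U (l + 1) = - (e *\<^sub>R U (l - 1)) + (1 + e) *\<^sub>R P (arg l U (U (l + 1)))" and
          Uv: "\<And>l. l < m \<Longrightarrow> norm (U (l + 1) - U l) \<le> C3 * h"
          using U(1) unfolding sol_iff by auto
        have Upos: "U l \<in> cball z (R / 4)" if "l \<le> m" for l
        proof (rule pos[OF Uv Usol(1)])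
          have "real l * h \<le> real m * h"
            using that h by (intro mult_right_mono) auto
          then show "real l * h \<le> \<tau>"
            using n(1)[OF m2(2,3)] by linarith
        qed (use that in auto)
        have v: "norm (U m - U (m - 1)) \<le> C3 * h"
          using Uv[of "m - 1"] m2 by simp
        \<comment> \<open>The previous projected point is the reference point for the new step.\<close>
        define y where "y = P (arg (m - 1) U (U m))"
        have m1: "m - 1 + 1 = m" "m - 1 - 1 + 1 = m - 1"
          using m2 by auto
        have v1: "norm (U (m - 1) - U (m - 1 - 1)) \<le> C3 * h"
          using Uv[of "m - 1 - 1"] m2 unfolding m1 by auto
        have aR: "arg (m - 1) U (U m) \<in> cball z R"
        proof (rule near2[OF arg_near])
          show "t0 + real (m - 1) * h \<in> {0..T}"
            using m2 by (intro time) auto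
          show "U (m - 1) \<in> cball z (R / 2)" "U (m - 1) \<in> cball z (R / 2)"
            by (rule half[OF Upos]; simp)+
          show "norm (U (m - 1) - U (m - 1 - 1)) \<le> C3 * h" "norm (U m - U (m - 1)) \<le> C4 * h"
            using v v1 C4h(1) by linarith+
        qed
        have y\<phi>: "\<phi> y \<le> 0"
          unfolding y_def \<phi>_P[OF aR] by simp
        have Um: "U m = - (e *\<^sub>R U (m - 1 - 1)) + (1 + e) *\<^sub>R y"
          using Ustep[of "m - 1"] m2 unfolding m1 y_def by auto
        have y: "norm (y - U m) \<le> 2 * C3 * h"
        proof -
          have "(1 + e) *\<^sub>R (y - U m) = e *\<^sub>R ((U (m - 1 - 1) - U (m - 1)) + (U (m - 1) - U m))"
            using Um by (simp add: algebra_simps)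
          then have "(1 + e) * norm (y - U m) = e * norm ((U (m - 1 - 1) - U (m - 1)) + (U (m - 1) - U m))"
            using e by (metis abs_of_nonneg add_nonneg_nonneg norm_scaleR zero_le_one)
          also have "\<dots> \<le> 1 * (C3 * h + C3 * h)"
            using e v v1 norm_triangle_ineq[of "U (m - 1 - 1) - U (m - 1)" "U (m - 1) - U m"]
            by (intro mult_mono) (auto simp: norm_minus_commute)
          finally show ?thesis
            using e mult_right_mono[of 1 "1 + e" "norm (y - U m)"] by simp
        qed
        obtain u where u: "u \<in> cball (U m) (C4 * h)" "u = - (e *\<^sub>R U (m - 1)) + (1 + e) *\<^sub>R P (arg m U u)"
        proof -
          note Um2 = half[OF Upos[OF order_refl]]
          have inb: "norm (u - U m) \<le> C4 * h" if "u \<in> cball (U m) ((11 * A * C3 + 1) * h)" for u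
            using that by (simp add: C4_def dist_norm norm_minus_commute)
          show ?thesis
          proof (rule step_exists[OF e h(1) h1 less_imp_le[OF C3_pos] v _ _ small(2) _ y y\<phi> \<Phi>0])
            show "x \<in> cball z R" if "norm (x - U m) \<le> (2 * C3 + \<Phi>) * h" for x
            proof (rule near[OF _ Um2])
              have "(2 * C3 + \<Phi>) * h \<le> (2 * D) * h"
                using C34 \<Phi>0 h by (intro mult_right_mono) (auto simp: D_def)
              then show "norm (x - U m) \<le> 2 * D * h"
                using that by linarith
            qed
          qed (use that[unfolded arg_def C4_def] force[OF time[OF m2(3,2)] Um2 v inb inb] in blast)+
        qed
        define W where "W = U (m + 1 := u)"
        have WU: "W l = U l" if "l \<le> m" for l
          using that by (simp add: W_def)
        have Wm: "W (m + 1) = u"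
          by (simp add: W_def)
        have arg_cong: "arg l W x = arg l U x" if "l \<le> m" for l x
          using that by (simp add: arg_def WU)
        have Wstep: "W (l + 1) = - (e *\<^sub>R W (l - 1)) + (1 + e) *\<^sub>R P (arg l W (W (l + 1)))"
          if "1 \<le> l" "l \<le> m" for l
        proof (cases "l = m")
          case True
          then show ?thesis
            using u(2) WU[of "m - 1"] Wm arg_cong[of m u] by simp
        next
          case False
          then show ?thesis
            using Ustep[of l] that WU[of "l + 1"] WU[of "l - 1"] arg_cong[of l] by simp
        qed
        have Wv3: "norm (W (l + 1) - W l) \<le> C3 * h" if "l < m" for l
          using Uv[OF that] WU[of l] WU[of "l + 1"] that by simp
        have Wv: "norm (W (l + 1) - W l) \<le> C4 * h" if "l \<le> m" for l
        proof (cases "l = m")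
          case True
          then show ?thesis
            using u(1) WU[of m] Wm by (simp add: dist_norm norm_minus_commute)
        next
          case False
          then show ?thesis
            using Wv3[of l] that C4h(1) by simp
        qed
        have Wpos: "W l \<in> cball z (R / 2)" if "l \<le> m" for l
          using half[OF Upos[OF that]] WU[OF that] by simp
        have Wv0: "norm (W l - W (l - 1)) \<le> C3 * h" if "1 \<le> l" "l \<le> m" for l
          using Wv3[of "l - 1"] that by simp
        have bound: "norm (W (m + 1) - W m) \<le> (C2 + 2 * A\<^sup>2 * (C2 + C2\<^sup>2) + B * (real m * h)) * h"
          unfolding B_def
        proof (rule velocity_bound[where f = "\<lambda>l. F (t0 + real l * h) (W l) (W (l - 1)) ((W (l + 1) - W (l - 1)) /\<^sub>R (2 * h)) h"
              and a = "\<lambda>l. arg l W (W (l + 1))" and e = e])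
          show "norm (W (l + 1) - W l) \<le> D * h" if "l \<le> m" for l
            using Wv[OF that] C4h by simp
          show "2 * D * h \<le> R / 2"
            using small R_pos by simp
          show "norm (F (t0 + real l * h) (W l) (W (l - 1)) ((W (l + 1) - W (l - 1)) /\<^sub>R (2 * h)) h) \<le> D"
            if l: "1 \<le> l" "l \<le> m" for l
          proof -
            have "l \<le> n"
              using l m2 by simp
            from force(1)[OF time[OF l(1) this] Wpos[OF l(2)] Wv0[OF l] Wv[OF l(2)] Wv[OF l(2)]] D(2)
            show ?thesis
              by simp
          qed
          show "norm (W 1 - W 0) \<le> C2 * h" "norm (W 2 - W 1) \<le> C2 * h"
            using WU[of 0] WU[of 1] WU[of 2] m2 Usol U(2) V0 V1 by auto
        qed (use e h h1 Wpos Wstep m2 C2 arg_def in auto)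
        have "norm (W (m + 1) - W m) \<le> C3 * h"
        proof -
          have "B * (real m * h) \<le> B * \<delta>"
            using n(1)[OF m2(2,3)] \<tau> B0 by (intro mult_left_mono) auto
          then have "(C2 + 2 * A\<^sup>2 * (C2 + C2\<^sup>2) + B * (real m * h)) * h \<le> C3 * h"
            using \<delta>(5) C3 h by (intro mult_right_mono) auto
          then show ?thesis
            using bound by linarith
        qed
        with Wv3 have Wv': "norm (W (l + 1) - W l) \<le> C3 * h" if "l < Suc m" for l
          using that by (cases "l = m") auto
        have "arg l W (W (l + 1)) \<in> proj_dom M K" if l: "1 \<le> l" "l \<le> m" for l
        proof -
          have "l \<le> n"
            using l m2 by simp
          from near2[OF arg_near[OF time[OF l(1) this] Wpos[OF l(2)] Wv0[OF l] Wv[OF l(2)]] Wpos[OF l(2)]]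
          show ?thesis
            using dom by blast
        qed
        then have "sol (Suc m) W"
          unfolding sol_iff using Wstep Wv' WU[of 0] WU[of 1] m2 Usol by (auto simp: less_Suc_eq_le)
        moreover have "W 2 = U2"
          using WU[of 2] m2 U(2) by simp
        ultimately show ?thesis
          by blast
      qed
    qed
    have unique: "W m = U m" if U: "sol n U" and W: "sol n W" and m: "m \<le> n" for U W m
      using m
    proof (induction m rule: less_induct)
      case (less m)
      show ?case
      proof (cases "m \<le> 1")
        case True
        then show ?thesis
          using U W unfolding sol_iff by (cases m) auto
      next
        case False
        define l where "l = m - 1"
        have l: "m = l + 1" "1 \<le> l" "l < n" "l \<le> n" "l - 1 < m" "l < m"
          using False less.prems by (auto simp: l_def)
        have eq: "W l = U l" "W (l - 1) = U (l - 1)"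
          using less l by auto
        have Uv: "norm (U (i + 1) - U i) \<le> C3 * h" if "i < n" for i
          using U that unfolding sol_iff by auto
        have Ul: "U l \<in> cball z (R / 2)"
        proof (rule half[OF pos])
          show "real l * h \<le> \<tau>"
            by (rule n(1)[OF l(4,2)])
        qed (use Uv l U sol_iff in auto)
        have v0: "norm (U l - U (l - 1)) \<le> C3 * h"
          using Uv[of "l - 1"] l by simp
        have u: "norm (U m - U l) \<le> C4 * h" and w: "norm (W m - U l) \<le> C4 * h"
          using Uv[of l] W l eq C4h unfolding sol_iff by auto
        note t = time[OF l(2,4)]
        have ineq: "norm ((- (e *\<^sub>R U (l - 1)) + (1 + e) *\<^sub>R P (arg l U (W m)))
            - (- (e *\<^sub>R U (l - 1)) + (1 + e) *\<^sub>R P (arg l U (U m)))) \<le> 1 / 2 * norm (W m - U m)"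
          unfolding arg_def
          by (rule step_contraction[OF e h(1) force(2)[OF t Ul v0 w u] _ _ small(2)];
              fold arg_def; intro near2[OF arg_near[OF t Ul v0] Ul] u w)
        have "arg l W (W m) = arg l U (W m)"
          by (simp only: arg_def eq)
        then have "W m = - (e *\<^sub>R U (l - 1)) + (1 + e) *\<^sub>R P (arg l U (W m))"
          using W l(1-3) eq unfolding sol_iff by auto
        moreover have "U m = - (e *\<^sub>R U (l - 1)) + (1 + e) *\<^sub>R P (arg l U (U m))"
          using U l(1-3) unfolding sol_iff by auto
        ultimately have "norm (W m - U m) \<le> 1 / 2 * norm (W m - U m)"
          using ineq by metis
        then show ?thesis
          by simp
      qed
    qed
    show "let n = nat \<lfloor>min \<tau> (T - t0) / h\<rfloor> in
       \<exists>U. scheme_solution M K e F t0 h C3 n U0 U1 U \<and>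
         (\<forall>W. scheme_solution M K e F t0 h C3 n U0 U1 W \<longrightarrow> (\<forall>m\<le>n. W m = U m))"
      unfolding Let_def n_def[symmetric] sol_def[symmetric]
      using exists[OF order_refl] unique by blast
  qed
qed

end

section \<open>Local data of the problem\<close>

lemma uniformly_elliptic_on_cball:
  fixes M :: "real^'n \<Rightarrow> real^'n^'n"
  assumes M: "continuous_on UNIV M" and pos: "\<And>u. sym_pos_def (M u)" and R: "0 \<le> R"
  obtains \<alpha> where "0 < \<alpha>" "\<And>x v. x \<in> cball z R \<Longrightarrow> \<alpha> * (norm v)\<^sup>2 \<le> v \<bullet> (M x *v v)"
proof -
  define q where "q = (\<lambda>(x, v). v \<bullet> (M x *v v))"
  let ?S = "cball z R \<times> sphere (0 :: real^'n) 1"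
  have "compact ?S"
    by (intro compact_Times) auto
  moreover have "?S \<noteq> {}"
    using R by (auto intro: vector_choose_size[of 1])
  moreover have "continuous_on ?S q"
    unfolding q_def case_prod_beta
    by (intro continuous_intros continuous_on_matrix_vector_mult continuous_on_compose2[OF M]) auto
  ultimately obtain s where s: "s \<in> ?S" "\<And>t. t \<in> ?S \<Longrightarrow> q s \<le> q t"
    using continuous_attains_inf[of ?S q] by blast
  show ?thesis
  proof (rule that)
    have "snd s \<noteq> 0"
      using s(1) by (cases s) auto
    then show "0 < q s"
      using pos[of "fst s"] by (simp add: q_def case_prod_beta sym_pos_def_def)
    show "q s * (norm v)\<^sup>2 \<le> v \<bullet> (M x *v v)" if x: "x \<in> cball z R" for x v
    proof (cases "v = 0")
      case False
      define w where "w = (1 / norm v) *\<^sub>R v"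
      have "q s \<le> q (x, w)"
        using x False by (intro s(2)) (simp add: w_def)
      also have "q (x, w) = (v \<bullet> (M x *v v)) / (norm v)\<^sup>2"
        by (simp add: q_def w_def matrix_vector_mult_scaleR power2_eq_square)
      finally show ?thesis
        using False by (simp add: field_simps)
    qed simp
  qed
qed

lemma C2_metric_estimates:
  fixes M :: "real^'n \<Rightarrow> real^'n^'n"
  assumes M: "Ck_on 3 M UNIV" and R: "0 \<le> R"
  obtains A where "0 \<le> A" "\<And>x. x \<in> cball z R \<Longrightarrow> norm (M x) \<le> A"
    "\<And>x y. x \<in> cball z R \<Longrightarrow> y \<in> cball z R \<Longrightarrow> norm (M x - M y) \<le> A * norm (x - y)"
    "\<And>x d. x \<in> cball z R \<Longrightarrow> x + d \<in> cball z R \<Longrightarrow> x - d \<in> cball z R \<Longrightarrow>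
      norm (M (x + d) + M (x - d) - 2 *\<^sub>R M x) \<le> A * (norm d)\<^sup>2"
proof -
  have M1: "Ck_on 1 M UNIV" and M2: "Ck_on 2 M UNIV"
    by (rule Ck_on_antimono[OF M]; simp)+
  obtain L where L: "0 \<le> L" "\<And>x y. x \<in> cball z R \<Longrightarrow> y \<in> cball z R \<Longrightarrow> norm (M x - M y) \<le> L * norm (x - y)"
    using C1_on_Lipschitz_cball[OF M1 subset_UNIV, of z R] by blast
  let ?D = "\<lambda>x. frechet_derivative M (at x)"
  obtain C where C: "0 \<le> C" "\<And>x v. x \<in> cball z R \<Longrightarrow> norm (?D x v) \<le> C * norm v"
    "\<And>x y v. x \<in> cball z R \<Longrightarrow> y \<in> cball z R \<Longrightarrow> norm (?D x v - ?D y v) \<le> C * norm (x - y) * norm v"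
    "\<And>x y. x \<in> cball z R \<Longrightarrow> y \<in> cball z R \<Longrightarrow>
      norm (M y - M x - ?D x (y - x)) \<le> C * (norm (y - x))\<^sup>2"
    using C2_on_Taylor_cball[OF M2 subset_UNIV R, of z] by blast
  have z: "z \<in> cball z R"
    using R by simp
  have "(M has_derivative ?D x) (at x)" for x
    using C1_on_has_derivative[of 0 M UNIV x] M1 by simp
  then have lin: "linear (?D x)" for x
    by (rule has_derivative_linear)
  define A where "A = (norm (M z) + L * R) + L + 2 * C"
  show ?thesis
  proof (rule that)
    have LR: "0 \<le> L * R"
      using L R by simp
    show "0 \<le> A"
      using L(1) C(1) LR by (simp add: A_def)
    show "norm (M x) \<le> A" if x: "x \<in> cball z R" for x
    proof -
      have "norm (M x - M z) \<le> L * norm (x - z)"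
        by (rule L(2)[OF x z])
      also have "\<dots> \<le> L * R"
        using x L(1) by (intro mult_left_mono) (auto simp: dist_norm norm_minus_commute)
      finally show ?thesis
        using norm_triangle_ineq[of "M x - M z" "M z"] L(1) C(1) by (simp add: A_def)
    qed
    show "norm (M x - M y) \<le> A * norm (x - y)" if "x \<in> cball z R" "y \<in> cball z R" for x y
    proof -
      have "L \<le> A"
        using C(1) LR norm_ge_zero[of "M z"] unfolding A_def by linarith
      from mult_right_mono[OF this norm_ge_zero, of "x - y"] show ?thesis
        using L(2)[OF that] by linarith
    qed
    show "norm (M (x + d) + M (x - d) - 2 *\<^sub>R M x) \<le> A * (norm d)\<^sup>2"
      if x: "x \<in> cball z R" and p: "x + d \<in> cball z R" and m: "x - d \<in> cball z R" for x d
    proof -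
      have neg: "?D x (- d) = - ?D x d"
        using linear_neg[OF lin] .
      have 1: "norm (M (x + d) - M x - ?D x d) \<le> C * (norm d)\<^sup>2"
        using C(4)[OF x p] by simp
      have 2: "norm (M (x - d) - M x + ?D x d) \<le> C * (norm d)\<^sup>2"
        using C(4)[OF x m] neg by simp
      have "M (x + d) + M (x - d) - 2 *\<^sub>R M x = (M (x + d) - M x - ?D x d) + (M (x - d) - M x + ?D x d)"
        by (simp add: scaleR_2)
      then have "norm (M (x + d) + M (x - d) - 2 *\<^sub>R M x) \<le> C * (norm d)\<^sup>2 + C * (norm d)\<^sup>2"
        using norm_triangle_mono[OF 1 2] by (simp only:)
      also have "\<dots> = (2 * C) * (norm d)\<^sup>2"
        by simp
      also have "\<dots> \<le> A * (norm d)\<^sup>2"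
        using L LR norm_ge_zero[of "M z"] unfolding A_def by (intro mult_right_mono) auto
      finally show ?thesis .
    qed
  qed
qed

lemma C2_gradient_estimates:
  fixes \<phi> :: "real^'n \<Rightarrow> real"
  assumes \<phi>: "Ck_on 2 \<phi> W" and W: "cball z R \<subseteq> W" and R: "0 \<le> R"
  shows "\<exists>n A. 0 \<le> A \<and> (\<forall>x\<in>cball z R. (\<phi> has_derivative (\<lambda>v. n x \<bullet> v)) (at x) \<and> norm (n x) \<le> A \<and>
    (\<forall>y\<in>cball z R. \<bar>\<phi> y - \<phi> x - n x \<bullet> (y - x)\<bar> \<le> A * (norm (y - x))\<^sup>2 \<and> norm (n x - n y) \<le> A * norm (x - y)))"
proof -
  let ?D = "\<lambda>x. frechet_derivative \<phi> (at x)"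
  obtain A where A: "0 \<le> A" "\<And>x v. x \<in> cball z R \<Longrightarrow> norm (?D x v) \<le> A * norm v"
    "\<And>x y v. x \<in> cball z R \<Longrightarrow> y \<in> cball z R \<Longrightarrow> norm (?D x v - ?D y v) \<le> A * norm (x - y) * norm v"
    "\<And>x y. x \<in> cball z R \<Longrightarrow> y \<in> cball z R \<Longrightarrow> norm (\<phi> y - \<phi> x - ?D x (y - x)) \<le> A * (norm (y - x))\<^sup>2"
    using C2_on_Taylor_cball[OF \<phi> W R] by blast
  define n where "n x = (\<Sum>i\<in>Basis. ?D x i *\<^sub>R i)" for x
  have der: "(\<phi> has_derivative ?D x) (at x)" if "x \<in> cball z R" for x
    using C1_on_has_derivative[of 1 \<phi> W x] \<phi> W that by (auto simp: numeral_2_eq_2)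
  have n: "?D x v = n x \<bullet> v" if x: "x \<in> cball z R" for x v
  proof -
    have lin: "linear (?D x)"
      by (rule has_derivative_linear[OF der[OF x]])
    have "?D x v = ?D x (\<Sum>i\<in>Basis. (v \<bullet> i) *\<^sub>R i)"
      by (simp add: euclidean_representation)
    also have "\<dots> = (\<Sum>i\<in>Basis. (v \<bullet> i) * ?D x i)"
      by (simp add: linear_sum[OF lin] linear_scale[OF lin])
    also have "\<dots> = n x \<bullet> v"
      unfolding n_def inner_sum_left inner_scaleR_left
      by (intro sum.cong) (simp_all add: inner_commute mult.commute)
    finally show ?thesis .
  qed
  have n_eq: "?D x = (\<lambda>v. n x \<bullet> v)" if "x \<in> cball z R" for x
    using n[OF that] by auto
  have cancel: "norm w \<le> c" if "norm (w \<bullet> w) \<le> c * norm w" "0 \<le> c" for w :: "real^'n" and c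
  proof (cases "w = 0")
    case False
    then show ?thesis
      using that by (simp add: power2_norm_eq_inner[symmetric] power2_eq_square)
  qed (use that in simp)
  show ?thesis
  proof (intro exI[of _ n] exI[of _ A] conjI ballI)
    show "0 \<le> A"
      by (rule A(1))
    show "(\<phi> has_derivative (\<lambda>v. n x \<bullet> v)) (at x)" if "x \<in> cball z R" for x
      using der[OF that] unfolding n_eq[OF that] .
    show "\<bar>\<phi> y - \<phi> x - n x \<bullet> (y - x)\<bar> \<le> A * (norm (y - x))\<^sup>2" if "x \<in> cball z R" "y \<in> cball z R" for x y
      using A(4)[OF that] unfolding n[OF that(1)] by simp
    show "norm (n x) \<le> A" if "x \<in> cball z R" for x
      using A(2)[OF that, of "n x"] unfolding n[OF that] by (rule cancel[OF _ A(1)])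
    show "norm (n x - n y) \<le> A * norm (x - y)" if "x \<in> cball z R" "y \<in> cball z R" for x y
    proof (rule cancel)
      show "norm ((n x - n y) \<bullet> (n x - n y)) \<le> A * norm (x - y) * norm (n x - n y)"
        using A(3)[OF that, of "n x - n y"] unfolding n[OF that(1)] n[OF that(2)]
        by (simp add: inner_diff_left)
    qed (use A(1) in simp)
  qed
qed

text \<open>The ball is chosen so small that the gradient of \<open>\<phi>\<close> varies in it by at most half of its length.\<close>

lemma regular_projection_near_frontier:
  fixes M :: "real^'n \<Rightarrow> real^'n^'n"
  assumes M: "Ck_on 3 M UNIV" and pos: "\<And>u. sym_pos_def (M u)"
    and side: "on_one_side_of_frontier K" and z: "z \<in> frontier K"
  obtains \<phi> n b R A where "cball z R \<subseteq> proj_dom M K" "regular_projection (proj M K) \<phi> n b z R A"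
proof -
  obtain W \<phi> where zW: "z \<in> W" and eqn: "local_C3_equation (frontier K) W \<phi>" and KW: "K \<inter> W = {x\<in>W. \<phi> x \<le> 0}"
    using side[unfolded on_one_side_of_frontier_def, rule_format, OF z] by (elim exE conjE)
  have W: "open W" and \<phi>3: "Ck_on 3 \<phi> W" and nz: "\<And>x. x \<in> W \<Longrightarrow> frechet_derivative \<phi> (at x) \<noteq> (\<lambda>v. 0)"
    and FW: "frontier K \<inter> W = {x\<in>W. \<phi> x = 0}"
    using eqn unfolding local_C3_equation_def by auto
  obtain R0 where R0: "0 < R0" "cball z R0 \<subseteq> W"
    using W zW open_contains_cball by blast
  have \<phi>2: "Ck_on 2 \<phi> W"
    by (rule Ck_on_antimono[OF \<phi>3]) simp
  obtain n A1 where gradient: "0 \<le> A1 \<and> (\<forall>x\<in>cball z R0. (\<phi> has_derivative (\<lambda>v. n x \<bullet> v)) (at x) \<and> norm (n x) \<le> A1 \<and>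
    (\<forall>y\<in>cball z R0. \<bar>\<phi> y - \<phi> x - n x \<bullet> (y - x)\<bar> \<le> A1 * (norm (y - x))\<^sup>2 \<and> norm (n x - n y) \<le> A1 * norm (x - y)))"
    using C2_gradient_estimates[OF \<phi>2 R0(2) less_imp_le[OF R0(1)]] by (elim exE)
  then have A1: "0 \<le> A1"
    by (rule conjunct1)
  note g = bspec[OF conjunct2[OF gradient]]
  have der: "(\<phi> has_derivative (\<lambda>v. n x \<bullet> v)) (at x)" if "x \<in> cball z R0" for x
    by (rule conjunct1[OF g[OF that]])
  have nb: "norm (n x) \<le> A1" if "x \<in> cball z R0" for x
    by (rule conjunct1[OF conjunct2[OF g[OF that]]])
  have g2: "\<bar>\<phi> y - \<phi> x - n x \<bullet> (y - x)\<bar> \<le> A1 * (norm (y - x))\<^sup>2 \<and> norm (n x - n y) \<le> A1 * norm (x - y)"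
    if "x \<in> cball z R0" "y \<in> cball z R0" for x y
    by (rule bspec[OF conjunct2[OF conjunct2[OF g[OF that(1)]]] that(2)])
  note Tay = g2[THEN conjunct1] and nL = g2[THEN conjunct2]
  have z0: "z \<in> cball z R0"
    using R0 by simp
  have "n z \<noteq> 0"
  proof
    assume "n z = 0"
    then have "(\<phi> has_derivative (\<lambda>v. 0)) (at z)"
      using der[OF z0] by simp
    then have "frechet_derivative \<phi> (at z) = (\<lambda>v. 0)"
      by (rule frechet_derivative_at[symmetric])
    then show False
      using nz[OF zW] by simp
  qed
  define c where "c = norm (n z)"
  have c: "0 < c"
    using \<open>n z \<noteq> 0\<close> by (simp add: c_def)
  define \<nu> where "\<nu> = (1 / c) *\<^sub>R n z"
  define R where "R = min R0 (c / (2 * (A1 + 1)))"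
  have R: "0 < R" "R \<le> R0" "A1 * R \<le> c / 2"
  proof -
    show "0 < R" "R \<le> R0"
      using R0 c A1 by (auto simp: R_def)
    have "A1 * R \<le> (A1 + 1) * (c / (2 * (A1 + 1)))"
      using A1 c \<open>0 < R\<close> by (intro mult_mono) (auto simp: R_def)
    also have "\<dots> = c / 2"
      using A1 by (simp add: field_simps)
    finally show "A1 * R \<le> c / 2" .
  qed
  have sub: "x \<in> cball z R0" if "x \<in> cball z R" for x
    using that R by auto
  have subW: "x \<in> W" if "x \<in> cball z R" for x
    using sub[OF that] R0 by blast
  obtain \<alpha>1 where \<alpha>1: "0 < \<alpha>1" "\<And>x v. x \<in> cball z R \<Longrightarrow> \<alpha>1 * (norm v)\<^sup>2 \<le> v \<bullet> (M x *v v)"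
  proof (rule uniformly_elliptic_on_cball[of M R z])
    show "continuous_on UNIV M"
      using Ck_on_antimono[OF M, of 0] by simp
  qed (use pos R in auto)
  obtain A2 where A2: "0 \<le> A2" "\<And>x. x \<in> cball z R \<Longrightarrow> norm (M x) \<le> A2"
    "\<And>x y. x \<in> cball z R \<Longrightarrow> y \<in> cball z R \<Longrightarrow> norm (M x - M y) \<le> A2 * norm (x - y)"
    "\<And>x d. x \<in> cball z R \<Longrightarrow> x + d \<in> cball z R \<Longrightarrow> x - d \<in> cball z R \<Longrightarrow>
      norm (M (x + d) + M (x - d) - 2 *\<^sub>R M x) \<le> A2 * (norm d)\<^sup>2"
    using C2_metric_estimates[OF M less_imp_le[OF R(1)], of z] by blast
  define \<alpha> where "\<alpha> = min \<alpha>1 (c / 2)"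
  define A where "A = 1 + A1 + A2"
  have \<alpha>: "0 < \<alpha>" "\<alpha> \<le> \<alpha>1" "\<alpha> \<le> c / 2"
    using \<alpha>1 c by (auto simp: \<alpha>_def)
  have A: "1 \<le> A" "A1 \<le> A" "A2 \<le> A"
    using A1 A2(1) by (auto simp: A_def)
  have up: "t \<le> A * s" if "t \<le> A' * s" "A' \<le> A" "0 \<le> s" for t s A' :: real
    using that mult_right_mono[of A' A s] by linarith
  have in_frontier: "x \<in> frontier K \<longleftrightarrow> \<phi> x = 0" if "x \<in> W" for x
    using that arg_cong[OF FW, of "\<lambda>S. x \<in> S"] by simp
  have in_K: "x \<in> K \<longleftrightarrow> \<phi> x \<le> 0" if "x \<in> W" for x
    using that arg_cong[OF KW, of "\<lambda>S. x \<in> S"] by simp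
  have \<nu>1: "norm \<nu> = 1"
    using c by (simp add: \<nu>_def c_def)
  have nz\<nu>: "n z \<bullet> \<nu> = c"
  proof -
    have "n z \<bullet> \<nu> = (n z \<bullet> n z) / c"
      by (simp add: \<nu>_def)
    also have "\<dots> = c"
      using c unfolding power2_norm_eq_inner[symmetric] c_def by (simp add: power2_eq_square)
    finally show ?thesis .
  qed
  interpret hypersurface_ball M z R \<alpha> A K \<phi> n \<nu>
  proof
    show "continuous_on UNIV M"
      using Ck_on_antimono[OF M, of 0] by simp
    show "sym_pos_def (M u)" for u
      by (rule pos)
    show "0 < R" "0 < \<alpha>" "1 \<le> A"
      by (rule R \<alpha> A)+
    show "\<phi> z = 0"
      using in_frontier[OF zW] z by simp
    show "norm \<nu> = 1"
      by (rule \<nu>1)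
  next
    fix x v
    assume x: "x \<in> cball z R"
    show "\<alpha> * (norm v)\<^sup>2 \<le> v \<bullet> (M x *v v)"
      using \<alpha>1(2)[OF x, of v] mult_right_mono[OF \<alpha>(2), of "(norm v)\<^sup>2"] by simp
  next
    fix x
    assume x: "x \<in> cball z R"
    show "norm (M x) \<le> A" "norm (n x) \<le> A"
      using A2(2)[OF x] nb[OF sub[OF x]] A by linarith+
    show "(\<phi> has_derivative (\<lambda>v. n x \<bullet> v)) (at x)"
      by (rule der[OF sub[OF x]])
    show "x \<in> K \<longleftrightarrow> \<phi> x \<le> 0"
      by (rule in_K[OF subW[OF x]])
    show "x \<in> frontier K \<longleftrightarrow> \<phi> x = 0"
      by (rule in_frontier[OF subW[OF x]])
    show "\<alpha> \<le> n x \<bullet> \<nu>"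
    proof -
      note nz\<nu>
      moreover have "\<bar>(n z - n x) \<bullet> \<nu>\<bar> \<le> norm (n z - n x)"
        using Cauchy_Schwarz_ineq2[of "n z - n x" \<nu>] \<nu>1 by simp
      moreover have "norm (n z - n x) \<le> A1 * R"
      proof -
        have "norm (n z - n x) \<le> A1 * norm (z - x)"
          by (rule nL[OF z0 sub[OF x]])
        also have "\<dots> \<le> A1 * R"
          using x A1 by (intro mult_left_mono) (auto simp: dist_norm)
        finally show ?thesis .
      qed
      ultimately show ?thesis
        using \<alpha>(3) R(3) by (simp add: inner_diff_left)
    qed
  next
    fix x y
    assume xy: "x \<in> cball z R" "y \<in> cball z R"
    show "norm (M x - M y) \<le> A * norm (x - y)"
      by (rule up[OF A2(3)[OF xy] A(3)]) simp
    show "\<bar>\<phi> y - \<phi> x - n x \<bullet> (y - x)\<bar> \<le> A * (norm (y - x))\<^sup>2"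
      by (rule up[OF Tay[OF sub[OF xy(1)] sub[OF xy(2)]] A(2)]) simp
    show "norm (n x - n y) \<le> A * norm (x - y)"
      by (rule up[OF nL[OF sub[OF xy(1)] sub[OF xy(2)]] A(2)]) simp
  next
    fix x d
    assume xd: "x \<in> cball z R" "x + d \<in> cball z R" "x - d \<in> cball z R"
    show "norm (M (x + d) + M (x - d) - 2 *\<^sub>R M x) \<le> A * (norm d)\<^sup>2"
      by (rule up[OF A2(4)[OF xd] A(3)]) simp
  qed
  show ?thesis
    by (rule regular_projection_at_frontier) (rule that)
qed

text \<open>At an interior point \<open>P\<^sub>K\<close> is the identity nearby, and \<open>\<phi> = -1\<close> encodes that there is no contact.\<close>

lemma regular_projection_everywhere:
  fixes M :: "real^'n \<Rightarrow> real^'n^'n"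
  assumes M: "Ck_on 3 M UNIV" and pos: "\<And>u. sym_pos_def (M u)" and K: "closed K"
    and side: "on_one_side_of_frontier K" and z: "z \<in> K"
  obtains \<phi> n b R A where "cball z R \<subseteq> proj_dom M K" "regular_projection (proj M K) \<phi> n b z R A"
proof (cases "z \<in> frontier K")
  case True
  show ?thesis
    by (rule regular_projection_near_frontier[OF M pos side True]) (rule that)
next
  case False
  then have "z \<in> interior K"
    using z K by (simp add: frontier_def)
  then obtain R where R: "0 < R" "cball z R \<subseteq> K"
    using mem_interior_cball by blast
  have "cball z R \<subseteq> proj_dom M K"
    using R by (auto simp: proj_dom_def)
  moreover have "regular_projection (proj M K) (\<lambda>x. -1) (\<lambda>x. 0) (\<lambda>x. 0) z R 1"
    by unfold_locales (use R in \<open>auto simp: proj_def subset_iff\<close>)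
  ultimately show ?thesis
    by (rule that)
qed

lemma force_estimates:
  fixes F :: "real \<Rightarrow> real^'n \<Rightarrow> real^'n \<Rightarrow> real^'n \<Rightarrow> real \<Rightarrow> real^'n"
  assumes cont: "continuous_on ({0..T} \<times> UNIV \<times> UNIV \<times> UNIV \<times> {0..hs}) (\<lambda>(t, u, u', v, h). F t u u' v h)"
    and Lip: "local_lipschitz ({0..T} \<times> {0..hs}) UNIV (\<lambda>(t, h) (u, u', v). F t u u' v h)"
  shows "\<exists>\<Phi>\<ge>0. \<forall>t\<in>{0..T}. \<forall>h\<in>{0..hs}. \<forall>u\<in>cball z R. \<forall>u'\<in>cball z R. \<forall>v\<in>cball 0 C. \<forall>v'\<in>cball 0 C.
      norm (F t u u' v h) \<le> \<Phi> \<and> norm (F t u u' v h - F t u u' v' h) \<le> \<Phi> * norm (v - v')"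
proof -
  let ?X = "cball z R \<times> cball z R \<times> cball (0::real^'n) C"
  let ?T = "{0..T} \<times> {0..hs}"
  let ?f = "\<lambda>(t, h) (u, u', v). F t u u' v h"
  have "local_lipschitz ?T ?X ?f"
    by (rule local_lipschitz_subset[OF Lip]) auto
  moreover have "compact ?X" "compact ?T"
    by (intro compact_Times; simp)+
  moreover have "continuous_on ?T (\<lambda>s. ?f s x)" if "x \<in> ?X" for x
  proof -
    obtain u u' v where x: "x = (u, u', v)"
      by (cases x)
    have "continuous_on ?T (\<lambda>s. (\<lambda>(t, u, u', v, h). F t u u' v h) (fst s, u, u', v, snd s))"
      by (rule continuous_on_compose2[OF cont]) (auto intro!: continuous_intros)
    then show ?thesis
      by (simp add: x case_prod_beta)
  qed
  ultimately obtain L where L: "\<And>s. s \<in> ?T \<Longrightarrow> L-lipschitz_on ?X (?f s)"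
    using local_lipschitz_compact_implies_lipschitz[of ?T ?X ?f] by blast
  let ?Y = "{0..T} \<times> cball z R \<times> cball z R \<times> cball (0::real^'n) C \<times> {0..hs}"
  have "compact ((\<lambda>(t, u, u', v, h). F t u u' v h) ` ?Y)"
    by (intro compact_continuous_image continuous_on_subset[OF cont] compact_Times) auto
  then obtain B where B: "\<And>y. y \<in> (\<lambda>(t, u, u', v, h). F t u u' v h) ` ?Y \<Longrightarrow> norm y \<le> B"
    using compact_imp_bounded bounded_iff by metis
  define \<Phi> where "\<Phi> = max 0 (max L B)"
  have "norm (F t u u' v h) \<le> \<Phi>" "norm (F t u u' v h - F t u u' v' h) \<le> \<Phi> * norm (v - v')"
    if "t \<in> {0..T}" "h \<in> {0..hs}" "u \<in> cball z R" "u' \<in> cball z R" "v \<in> cball 0 C" "v' \<in> cball 0 C"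
    for t h u u' v v'
  proof -
    have "norm (F t u u' v h) \<le> B"
      using that by (intro B image_eqI[of _ _ "(t, u, u', v, h)"]) auto
    then show "norm (F t u u' v h) \<le> \<Phi>"
      by (simp add: \<Phi>_def)
    have "dist (?f (t, h) (u, u', v)) (?f (t, h) (u, u', v')) \<le> L * dist (u, u', v) (u, u', v')"
      using that by (intro lipschitz_onD[OF L]) auto
    then have "norm (F t u u' v h - F t u u' v' h) \<le> L * norm (v - v')"
      by (simp add: dist_norm[symmetric] dist_Pair_Pair)
    also have "\<dots> \<le> \<Phi> * norm (v - v')"
      by (intro mult_right_mono) (auto simp: \<Phi>_def)
    finally show "norm (F t u u' v h - F t u u' v' h) \<le> \<Phi> * norm (v - v')" .
  qed
  then show ?thesis
    by (intro exI[of _ \<Phi>]) (simp add: \<Phi>_def)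
qed

section \<open>Covering a compact set\<close>

theorem theorem3p5:
  fixes T e hs :: real
    and K :: "(real^'n) set"
    and M :: "real^'n \<Rightarrow> real^'n^'n"
    and f :: "real \<Rightarrow> real^'n \<Rightarrow> real^'n \<Rightarrow> real^'n"
    and F :: "real \<Rightarrow> real^'n \<Rightarrow> real^'n \<Rightarrow> real^'n \<Rightarrow> real \<Rightarrow> real^'n"
  assumes "0 < T" and "0 \<le> e" and "e \<le> 1" and "0 < hs" and "hs \<le> 1"
    and "closed K" and "interior K \<noteq> {}"
    and "C3_hypersurface (frontier K)" and "on_one_side_of_frontier K"
    and "Ck_on 3 M UNIV" and "\<And>u. sym_pos_def (M u)"
    and "continuous_on ({0..T} \<times> UNIV) (\<lambda>(t, u, p). f t u p)"
    and "local_lipschitz {0..T} UNIV (\<lambda>t (u, p). f t u p)"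
    and "continuous_on ({0..T} \<times> UNIV \<times> UNIV \<times> UNIV \<times> {0..hs}) (\<lambda>(t, u, u', v, h). F t u u' v h)"
    and "local_lipschitz ({0..T} \<times> {0..hs}) UNIV (\<lambda>(t, h) (u, u', v). F t u u' v h)"
    and "\<And>t u v. t \<in> {0..T} \<Longrightarrow> F t u u v 0 = matrix_inv (M u) *v f t u (M u *v v)"
  shows "\<forall>\<C> C2. compact \<C> \<and> \<C> \<subseteq> K \<and> 0 < C2 \<longrightarrow>
    (\<exists>r1 r2 \<tau> C3 h1. 0 < r1 \<and> r1 < r2 \<and> 0 < \<tau> \<and> 0 < C3 \<and> 0 < h1 \<and> h1 \<le> hs \<and>
      (\<forall>t0 ubar h U0 U1. 0 \<le> t0 \<and> t0 < T \<and> ubar \<in> \<C> \<and> 0 < h \<and> h \<le> h1 \<and>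
         cond_E M K e F T t0 ubar r1 C2 h U0 U1 \<longrightarrow>
         (let n = nat \<lfloor>min \<tau> (T - t0) / h\<rfloor> in
            \<exists>U. scheme_solution M K e F t0 h C3 n U0 U1 U \<and>
              (\<forall>W. scheme_solution M K e F t0 h C3 n U0 U1 W \<longrightarrow> (\<forall>m\<le>n. W m = U m)))))"
proof (intro allI impI)
  fix \<C> :: "(real^'n) set" and C2 :: real
  assume "compact \<C> \<and> \<C> \<subseteq> K \<and> 0 < C2"
  then have compact: "compact \<C>" and sub: "\<C> \<subseteq> K" and C2: "0 < C2"
    by auto
  define solvable where "solvable h \<tau> t0 C3 U0 U1 \<longleftrightarrow>
    (let n = nat \<lfloor>min \<tau> (T - t0) / h\<rfloor> in
       \<exists>U. scheme_solution M K e F t0 h C3 n U0 U1 U \<and>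
         (\<forall>W. scheme_solution M K e F t0 h C3 n U0 U1 W \<longrightarrow> (\<forall>m\<le>n. W m = U m)))" for h \<tau> t0 C3 U0 U1
  define good where "good z \<rho> C3 \<delta> \<longleftrightarrow> (\<forall>\<tau> t0 h U0 U1 U2. 0 < \<tau> \<and> \<tau> \<le> \<delta> \<and> 0 \<le> t0 \<and> 0 < h \<and> h \<le> \<delta> \<and>
    h \<le> hs \<and> U0 \<in> cball z \<rho> \<and> norm (U1 - U0) \<le> C2 * h \<and> first_step M K e F h (t0 + h) U0 U1 U2 \<and>
    norm (U2 - U1) \<le> C2 * h \<longrightarrow> solvable h \<tau> t0 C3 U0 U1)" for z \<rho> C3 \<delta>
  have local: "\<exists>\<rho> c. 0 < \<rho> \<and> (\<forall>C3\<ge>c. \<exists>\<delta>>0. good z \<rho> C3 \<delta>)" if z: "z \<in> K" for z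
  proof (rule regular_projection_everywhere[OF assms(10,11,6,9) z])
    fix \<phi> n b R A
    assume dom: "cball z R \<subseteq> proj_dom M K" and reg: "regular_projection (proj M K) \<phi> n b z R A"
    interpret regular_projection "proj M K" \<phi> n b z R A
      by (rule reg)
    show ?thesis
    proof (rule exI[of _ "R / 8"], rule exI[of _ "C2 + 2 * A\<^sup>2 * (C2 + C2\<^sup>2) + 1"], intro conjI allI impI)
      show "0 < R / 8"
        using R_pos by simp
      show "\<exists>\<delta>>0. good z (R / 8) C3 \<delta>" if "C2 + 2 * A\<^sup>2 * (C2 + C2\<^sup>2) + 1 \<le> C3" for C3
        unfolding good_def solvable_def
        by (rule local_scheme[OF refl dom assms(2-5) C2 force_estimates[OF assms(14,15)] that])
    qed
  qed
  then obtain \<rho> c where \<rho>: "\<And>z. z \<in> \<C> \<Longrightarrow> 0 < \<rho> z"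
    and c: "\<And>z C3. z \<in> \<C> \<Longrightarrow> c z \<le> C3 \<Longrightarrow> \<exists>\<delta>>0. good z (\<rho> z) C3 \<delta>"
    using sub by (metis subsetD)
  obtain D where D: "D \<subseteq> \<C>" "finite D" "\<C> \<subseteq> (\<Union>z\<in>D. ball z (\<rho> z / 2))"
  proof (rule compactE_image[OF compact, of \<C> "\<lambda>z. ball z (\<rho> z / 2)"])
    show "\<C> \<subseteq> (\<Union>z\<in>\<C>. ball z (\<rho> z / 2))"
      using \<rho> by force
  qed (auto intro: that)
  define C3 where "C3 = Max (insert 1 (c ` D))"
  have C3: "0 < C3" "\<And>z. z \<in> D \<Longrightarrow> c z \<le> C3"
  proof -
    have "1 \<le> C3"
      unfolding C3_def using D(2) by (intro Max_ge) auto
    then show "0 < C3"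
      by simp
    show "c z \<le> C3" if "z \<in> D" for z
      unfolding C3_def using D(2) that by (intro Max_ge) auto
  qed
  have "\<forall>z\<in>D. \<exists>\<delta>. 0 < \<delta> \<and> good z (\<rho> z) C3 \<delta>"
    using c C3(2) D(1) by blast
  then obtain \<delta> where \<delta>: "\<And>z. z \<in> D \<Longrightarrow> 0 < \<delta> z" "\<And>z. z \<in> D \<Longrightarrow> good z (\<rho> z) C3 (\<delta> z)"
    by metis
  define \<tau> where "\<tau> = Min (insert 1 (\<delta> ` D))"
  define r1 where "r1 = Min (insert 1 ((\<lambda>z. \<rho> z / 2) ` D))"
  have \<tau>: "0 < \<tau>" "\<And>z. z \<in> D \<Longrightarrow> \<tau> \<le> \<delta> z"
    using D(2) \<delta>(1) by (auto simp: \<tau>_def)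
  have r1: "0 < r1" "\<And>z. z \<in> D \<Longrightarrow> r1 \<le> \<rho> z / 2"
  proof -
    show "0 < r1"
      unfolding r1_def using D(1,2) \<rho> by (subst Min_gr_iff) auto
    show "r1 \<le> \<rho> z / 2" if "z \<in> D" for z
      unfolding r1_def using D(2) that by (intro Min_le) auto
  qed
  have main: "solvable h \<tau> t0 C3 U0 U1"
    if t0: "0 \<le> t0" and ubar: "ubar \<in> \<C>" and h: "0 < h" "h \<le> min \<tau> hs"
      and E: "cond_E M K e F T t0 ubar r1 C2 h U0 U1" for t0 ubar h U0 U1
  proof -
    obtain z where z: "z \<in> D" "ubar \<in> ball z (\<rho> z / 2)"
      using D(3) ubar by auto
    have U0: "norm (U0 - ubar) \<le> r1" and V0: "norm (U1 - U0) \<le> C2 * h"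
      using E by (auto simp: cond_E_def)
    obtain U2 where U2: "first_step M K e F h (t0 + h) U0 U1 U2" "norm (U2 - U1) \<le> C2 * h"
      using E by (auto simp: cond_E_def)
    have "U0 \<in> cball z (\<rho> z)"
      using U0 r1(2)[OF z(1)] z(2) norm_triangle_ineq[of "U0 - ubar" "ubar - z"]
      by (simp add: dist_norm norm_minus_commute)
    then show ?thesis
      using \<delta>(2)[OF z(1), unfolded good_def, rule_format, of \<tau> t0 h U0 U1 U2] \<tau>(1) \<tau>(2)[OF z(1)] t0 h V0 U2
      by simp
  qed
  show "\<exists>r1 r2 \<tau> C3 h1. 0 < r1 \<and> r1 < r2 \<and> 0 < \<tau> \<and> 0 < C3 \<and> 0 < h1 \<and> h1 \<le> hs \<and>
      (\<forall>t0 ubar h U0 U1. 0 \<le> t0 \<and> t0 < T \<and> ubar \<in> \<C> \<and> 0 < h \<and> h \<le> h1 \<and>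
         cond_E M K e F T t0 ubar r1 C2 h U0 U1 \<longrightarrow>
         (let n = nat \<lfloor>min \<tau> (T - t0) / h\<rfloor> in
            \<exists>U. scheme_solution M K e F t0 h C3 n U0 U1 U \<and>
              (\<forall>W. scheme_solution M K e F t0 h C3 n U0 U1 W \<longrightarrow> (\<forall>m\<le>n. W m = U m))))"
    unfolding solvable_def[symmetric]
    using r1(1) \<tau>(1) C3(1) assms(4) main
    by (intro exI[of _ r1] exI[of _ "r1 + 1"] exI[of _ \<tau>] exI[of _ C3] exI[of _ "min \<tau> hs"]) auto
qed

end
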